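(* Let $\mu$ and $\nu$ be two finite measures. Then $\operatorname{RSE}(L_1(\mu),L_1(\nu))$ is dense in $\mathcal{L}(L_1(\mu),L_1(\nu))$ if and only if at least one of the two measures $\mu$, $\nu$ is purely atomic.
   Context: Banach spaces are over $\mathbb{K}$, where $\mathbb{K}=\mathbb{R}$ or $\mathbb{C}$, and are nonzero (in particular $L_1(\mu)\neq\{0\}$ and $L_1(\nu)\ne\{0\}$). $\mathbb{T}=\{\theta\in\mathbb{K}\colon |\theta|=1\}$; $B_X$, $S_X$ are the closed unit ball and unit sphere of $X$; $\mathcal{L}(X,Y)$ is the space of bounded linear operators with the operator norm, and density is with respect to this norm. $T\in\operatorname{RSE}(X,Y)$ (range strongly exposing) means: there exists $x_0\in S_X$ such that whenever $(x_n)\subseteq B_X$ satisfies $\|Tx_n\|\to\|T\|$, there are a subsequence $(x_{\sigma(n)})$ and $\theta\in\mathbb{T}$ with $Tx_{\sigma(n)}\to\theta Tx_0$ in norm. A finite measure is purely atomic if every measurable set of positive measure contains an atom. *)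

theory Defs
  imports "HOL-Analysis.Analysis"
begin

section \<open>Normed spaces given by an explicit carrier\<close>

text \<open>\<open>L\<^sub>1(\<mu>)\<close> depends on a measure, hence cannot be a type; normed spaces over the scalar
  type \<open>'k\<close> are therefore records carrying their underlying set.\<close>

record ('k, 'v) nspace =
  vecs :: "'v set"
  vadd :: "'v \<Rightarrow> 'v \<Rightarrow> 'v"
  vzero :: "'v"
  vscale :: "'k \<Rightarrow> 'v \<Rightarrow> 'v"
  vnorm :: "'v \<Rightarrow> real"

locale normed_space_on =
  fixes X :: "('k::real_normed_field, 'v) nspace"
  assumes add_closed: "x \<in> vecs X \<Longrightarrow> y \<in> vecs X \<Longrightarrow> vadd X x y \<in> vecs X"
    and zero_closed: "vzero X \<in> vecs X"
    and scale_closed: "x \<in> vecs X \<Longrightarrow> vscale X c x \<in> vecs X"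
    and add_assoc: "x \<in> vecs X \<Longrightarrow> y \<in> vecs X \<Longrightarrow> z \<in> vecs X \<Longrightarrow>
      vadd X (vadd X x y) z = vadd X x (vadd X y z)"
    and add_commute: "x \<in> vecs X \<Longrightarrow> y \<in> vecs X \<Longrightarrow> vadd X x y = vadd X y x"
    and add_zero: "x \<in> vecs X \<Longrightarrow> vadd X (vzero X) x = x"
    and add_uminus: "x \<in> vecs X \<Longrightarrow> vadd X x (vscale X (- 1) x) = vzero X"
    and scale_one: "x \<in> vecs X \<Longrightarrow> vscale X 1 x = x"
    and scale_scale: "x \<in> vecs X \<Longrightarrow> vscale X a (vscale X b x) = vscale X (a * b) x"
    and scale_add_right: "x \<in> vecs X \<Longrightarrow> y \<in> vecs X \<Longrightarrow>
      vscale X a (vadd X x y) = vadd X (vscale X a x) (vscale X a y)"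
    and scale_add_left: "x \<in> vecs X \<Longrightarrow>
      vscale X (a + b) x = vadd X (vscale X a x) (vscale X b x)"
    and norm_nonneg: "x \<in> vecs X \<Longrightarrow> 0 \<le> vnorm X x"
    and norm_eq_0: "x \<in> vecs X \<Longrightarrow> vnorm X x = 0 \<longleftrightarrow> x = vzero X"
    and norm_scale: "x \<in> vecs X \<Longrightarrow> vnorm X (vscale X a x) = norm a * vnorm X x"
    and norm_triangle: "x \<in> vecs X \<Longrightarrow> y \<in> vecs X \<Longrightarrow>
      vnorm X (vadd X x y) \<le> vnorm X x + vnorm X y"

definition vdiff :: "('k::real_normed_field, 'v) nspace \<Rightarrow> 'v \<Rightarrow> 'v \<Rightarrow> 'v" where
  "vdiff X x y = vadd X x (vscale X (- 1) y)"

definition nonzero_space :: "('k, 'v) nspace \<Rightarrow> bool" where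
  "nonzero_space X \<longleftrightarrow> vecs X \<noteq> {vzero X}"

definition unit_ball :: "('k, 'v) nspace \<Rightarrow> 'v set" where
  "unit_ball X = {x \<in> vecs X. vnorm X x \<le> 1}"

definition unit_sphere :: "('k, 'v) nspace \<Rightarrow> 'v set" where
  "unit_sphere X = {x \<in> vecs X. vnorm X x = 1}"


section \<open>Bounded operators and range strongly exposing operators\<close>

text \<open>Operators are extensional functions, so that they are determined by their values on the
  underlying set of the domain.\<close>

definition bounded_ops ::
  "('k, 'v) nspace \<Rightarrow> ('k, 'w) nspace \<Rightarrow> ('v \<Rightarrow> 'w) set" where
  "bounded_ops X Y = {T \<in> vecs X \<rightarrow>\<^sub>E vecs Y.
     (\<forall>x\<in>vecs X. \<forall>y\<in>vecs X. T (vadd X x y) = vadd Y (T x) (T y)) \<and>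
     (\<forall>c. \<forall>x\<in>vecs X. T (vscale X c x) = vscale Y c (T x)) \<and>
     (\<exists>C. \<forall>x\<in>vecs X. vnorm Y (T x) \<le> C * vnorm X x)}"

definition op_norm :: "('k, 'v) nspace \<Rightarrow> ('k, 'w) nspace \<Rightarrow> ('v \<Rightarrow> 'w) \<Rightarrow> real" where
  "op_norm X Y T = (SUP x\<in>unit_ball X. vnorm Y (T x))"

definition op_diff ::
  "('k::real_normed_field, 'v) nspace \<Rightarrow> ('k, 'w) nspace \<Rightarrow> ('v \<Rightarrow> 'w) \<Rightarrow> ('v \<Rightarrow> 'w) \<Rightarrow> 'v \<Rightarrow> 'w"
  where "op_diff X Y S T = (\<lambda>x\<in>vecs X. vdiff Y (S x) (T x))"

definition RSE ::
  "('k::real_normed_field, 'v) nspace \<Rightarrow> ('k, 'w) nspace \<Rightarrow> ('v \<Rightarrow> 'w) set" where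
  "RSE X Y = {T \<in> bounded_ops X Y. \<exists>x0\<in>unit_sphere X. \<forall>x :: nat \<Rightarrow> 'v.
     (\<forall>n. x n \<in> unit_ball X) \<longrightarrow>
     (\<lambda>n. vnorm Y (T (x n))) \<longlonglongrightarrow> op_norm X Y T \<longrightarrow>
     (\<exists>\<sigma> \<theta>. strict_mono \<sigma> \<and> norm \<theta> = 1 \<and>
        (\<lambda>n. vnorm Y (vdiff Y (T (x (\<sigma> n))) (vscale Y \<theta> (T x0)))) \<longlonglongrightarrow> 0)}"

definition dense_ops ::
  "('k::real_normed_field, 'v) nspace \<Rightarrow> ('k, 'w) nspace \<Rightarrow> ('v \<Rightarrow> 'w) set \<Rightarrow> bool" where
  "dense_ops X Y D \<longleftrightarrow>
     (\<forall>T\<in>bounded_ops X Y. \<forall>\<epsilon>>0. \<exists>S\<in>D. op_norm X Y (op_diff X Y S T) < \<epsilon>)"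


section \<open>The space of (classes of) integrable functions\<close>

definition L1_class ::
  "'a measure \<Rightarrow> ('a \<Rightarrow> 'k::{banach, second_countable_topology}) \<Rightarrow> ('a \<Rightarrow> 'k) set" where
  "L1_class M f = {g. integrable M g \<and> (AE x in M. g x = f x)}"

definition L1 :: "'k::{real_normed_field, banach, second_countable_topology} itself \<Rightarrow>
    'a measure \<Rightarrow> ('k, ('a \<Rightarrow> 'k) set) nspace" where
  "L1 K M = \<lparr>
     vecs = L1_class M ` {f. integrable M f},
     vadd = (\<lambda>A B. \<Union>f\<in>A. \<Union>g\<in>B. L1_class M (\<lambda>x. f x + g x)),
     vzero = L1_class M (\<lambda>x. 0),
     vscale = (\<lambda>c A. \<Union>f\<in>A. L1_class M (\<lambda>x. c * f x)),
     vnorm = (\<lambda>A. the_elem ((\<lambda>f. \<integral>x. norm (f x) \<partial>M) ` A))\<rparr>"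

lemma L1_class_self: "integrable M f \<Longrightarrow> f \<in> L1_class M f"
  by (simp add: L1_class_def)

lemma L1_class_cong:
  assumes "AE x in M. f x = g x"
  shows "L1_class M f = L1_class M g"
proof -
  have "(AE x in M. h x = f x) \<longleftrightarrow> (AE x in M. h x = g x)" for h
  proof
    show "AE x in M. h x = g x" if "AE x in M. h x = f x"
      using that assms by eventually_elim simp
    show "AE x in M. h x = f x" if "AE x in M. h x = g x"
      using that assms by eventually_elim simp
  qed
  then show ?thesis by (simp add: L1_class_def)
qed

lemma L1_class_eq_iff:
  assumes "integrable M f"
  shows "L1_class M f = L1_class M g \<longleftrightarrow> (AE x in M. f x = g x)"
proof
  assume "L1_class M f = L1_class M g"
  with L1_class_self[OF assms] have "f \<in> L1_class M g" by simp
  then show "AE x in M. f x = g x" by (simp add: L1_class_def)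
qed (rule L1_class_cong)

lemma vecs_L1: "vecs (L1 K M) = L1_class M ` {f. integrable M f}"
  by (simp add: L1_def)

lemma vzero_L1: "vzero (L1 K M) = L1_class M (\<lambda>x. 0)"
  by (simp add: L1_def)

lemma vadd_L1:
  assumes "integrable M f" "integrable M g"
  shows "vadd (L1 K M) (L1_class M f) (L1_class M g) = L1_class M (\<lambda>x. f x + g x)"
proof -
  have "L1_class M (\<lambda>x. f' x + g' x) = L1_class M (\<lambda>x. f x + g x)"
    if "f' \<in> L1_class M f" "g' \<in> L1_class M g" for f' g'
  proof (rule L1_class_cong)
    have "AE x in M. f' x = f x" "AE x in M. g' x = g x"
      using that by (simp_all add: L1_class_def)
    then show "AE x in M. f' x + g' x = f x + g x" by eventually_elim simp
  qed
  then have "vadd (L1 K M) (L1_class M f) (L1_class M g) =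
      (\<Union>f'\<in>L1_class M f. \<Union>g'\<in>L1_class M g. L1_class M (\<lambda>x. f x + g x))"
    unfolding L1_def nspace.simps by (intro SUP_cong refl)
  also have "\<dots> = L1_class M (\<lambda>x. f x + g x)"
    using L1_class_self[OF assms(1)] L1_class_self[OF assms(2)] by blast
  finally show ?thesis .
qed

lemma vscale_L1:
  assumes "integrable M f"
  shows "vscale (L1 K M) c (L1_class M f) = L1_class M (\<lambda>x. c * f x)"
proof -
  have "L1_class M (\<lambda>x. c * f' x) = L1_class M (\<lambda>x. c * f x)" if "f' \<in> L1_class M f" for f'
  proof (rule L1_class_cong)
    have "AE x in M. f' x = f x" using that by (simp add: L1_class_def)
    then show "AE x in M. c * f' x = c * f x" by eventually_elim simp
  qed
  then have "vscale (L1 K M) c (L1_class M f) =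
      (\<Union>f'\<in>L1_class M f. L1_class M (\<lambda>x. c * f x))"
    unfolding L1_def nspace.simps by (intro SUP_cong refl)
  also have "\<dots> = L1_class M (\<lambda>x. c * f x)"
    using L1_class_self[OF assms] by blast
  finally show ?thesis .
qed

lemma vnorm_L1:
  assumes "integrable M f"
  shows "vnorm (L1 K M) (L1_class M f) = (\<integral>x. norm (f x) \<partial>M)"
proof -
  have "(\<integral>x. norm (f' x) \<partial>M) = (\<integral>x. norm (f x) \<partial>M)" if "f' \<in> L1_class M f" for f'
  proof (rule integral_cong_AE)
    have "AE x in M. f' x = f x" using that by (simp add: L1_class_def)
    then show "AE x in M. norm (f' x) = norm (f x)" by eventually_elim simp
  qed (use that assms in \<open>auto simp: L1_class_def intro: borel_measurable_norm\<close>)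
  then have "(\<lambda>f. \<integral>x. norm (f x) \<partial>M) ` L1_class M f = {\<integral>x. norm (f x) \<partial>M}"
    using L1_class_self[OF assms] by (intro equalityI subsetI) (blast, metis image_eqI singletonD)
  then show ?thesis by (simp add: L1_def)
qed

lemma normed_space_on_L1: "normed_space_on (L1 K M)"
proof
  fix A B C and a b
  assume "A \<in> vecs (L1 K M)" "B \<in> vecs (L1 K M)" "C \<in> vecs (L1 K M)"
  then obtain f g h where f: "integrable M f" "A = L1_class M f"
    and g: "integrable M g" "B = L1_class M g" and h: "integrable M h" "C = L1_class M h"
    by (auto simp: vecs_L1)
  note [simp] = f g h vadd_L1 vscale_L1 vzero_L1 vnorm_L1
  show "vadd (L1 K M) A B \<in> vecs (L1 K M)" "vscale (L1 K M) a A \<in> vecs (L1 K M)"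
    by (auto simp: vecs_L1)
  show "vadd (L1 K M) (vadd (L1 K M) A B) C = vadd (L1 K M) A (vadd (L1 K M) B C)"
    by (simp add: add.assoc)
  show "vadd (L1 K M) A B = vadd (L1 K M) B A"
    by (simp add: add.commute)
  show "vadd (L1 K M) (vzero (L1 K M)) A = A"
    "vadd (L1 K M) A (vscale (L1 K M) (- 1) A) = vzero (L1 K M)"
    "vscale (L1 K M) 1 A = A"
    by simp_all
  show "vscale (L1 K M) a (vscale (L1 K M) b A) = vscale (L1 K M) (a * b) A"
    by (simp add: mult.assoc)
  show "vscale (L1 K M) a (vadd (L1 K M) A B) = vadd (L1 K M) (vscale (L1 K M) a A) (vscale (L1 K M) a B)"
    by (simp add: distrib_left)
  show "vscale (L1 K M) (a + b) A = vadd (L1 K M) (vscale (L1 K M) a A) (vscale (L1 K M) b A)"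
    by (simp add: distrib_right)
  show "0 \<le> vnorm (L1 K M) A" by simp
  show "vnorm (L1 K M) A = 0 \<longleftrightarrow> A = vzero (L1 K M)"
    by (simp add: L1_class_eq_iff integral_nonneg_eq_0_iff_AE)
  show "vnorm (L1 K M) (vscale (L1 K M) a A) = norm a * vnorm (L1 K M) A"
    by (simp add: norm_mult)
  have "(\<integral>x. norm (f x + g x) \<partial>M) \<le> (\<integral>x. norm (f x) + norm (g x) \<partial>M)"
    by (intro integral_mono) (auto intro: norm_triangle_ineq)
  then show "vnorm (L1 K M) (vadd (L1 K M) A B) \<le> vnorm (L1 K M) A + vnorm (L1 K M) B"
    by simp
next
  show "vzero (L1 K M) \<in> vecs (L1 K M)" by (auto simp: vzero_L1 vecs_L1)
qed


section \<open>Purely atomic measures\<close>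

text \<open>The notion of atom is the one for finite measures: every measurable subset is null or has
  full measure (equivalently, null complement).\<close>

definition atom :: "'a measure \<Rightarrow> 'a set \<Rightarrow> bool" where
  "atom M A \<longleftrightarrow> A \<in> sets M \<and> emeasure M A > 0 \<and>
     (\<forall>B\<in>sets M. B \<subseteq> A \<longrightarrow> emeasure M B = 0 \<or> emeasure M B = emeasure M A)"

definition purely_atomic :: "'a measure \<Rightarrow> bool" where
  "purely_atomic M \<longleftrightarrow>
     (\<forall>A\<in>sets M. emeasure M A > 0 \<longrightarrow> (\<exists>B\<subseteq>A. atom M B))"

end

theory Submission
  imports Defs "HOL-Probability.Distribution_Functions"
begin

text \<open>
  Both implications turn on how an operator \<open>T\<close> acts on the parts of a function, that is, on its
  restrictions to measurable sets.

  Suppose that one of the measures is purely atomic. Then the averages \<open>T \<chi>\<^sub>H / \<mu>(H)\<close> oscillate little: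
  every set of positive measure contains a set \<open>A\<close> of positive measure such that all averages over
  subsets of \<open>A\<close> are close to one vector \<open>y\<close>. If \<open>\<mu>\<close> is purely atomic, \<open>A\<close> can be an atom, on which there
  is only one average (\<open>small_oscillation_atomic_domain\<close>). If \<open>\<nu>\<close> is purely atomic, \<open>L\<^sub>1(\<nu>)\<close> is a space
  \<open>\<ell>\<^sub>1\<close>, and the claim expresses its Radon-Nikodym property; it holds for the part of \<open>T\<close> on a single
  atom of \<open>\<nu>\<close> by an exhaustion argument and passes to countable unions
  (\<open>small_oscillation_atomic_range\<close>). Moreover \<open>y\<close> can have almost the norm of \<open>T\<close>
  (\<open>small_oscillation_large\<close>), and then \<open>T\<close> is almost the rank one operator \<open>f \<mapsto> (\<integral>\<^sub>A f) y\<close> on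
  \<open>L\<^sub>1(A)\<close> (\<open>near_rank_one\<close>). Replacing it there by \<open>f \<mapsto> (\<integral>\<^sub>A f) z\<close>, where \<open>z\<close> is near \<open>y\<close> and slightly
  longer than the norm of \<open>T\<close>, forces all norming sequences to concentrate on \<open>A\<close>; their images then
  accumulate only at unimodular multiples of \<open>z\<close>, so the new operator is range strongly exposing
  (\<open>range_exposed_replace\<close>).

  Conversely, a range strongly exposing \<open>S\<close> attains its norm at its point \<open>x\<^sub>0\<close>. By the additivity of
  the norm it does so at every normalised part of \<open>x\<^sub>0\<close> as well, and a constant sequence at such a part
  shows that its image is a multiple of \<open>S x\<^sub>0\<close> (\<open>range_exposed_cutoff\<close>): on the parts of \<open>x\<^sub>0\<close>, the
  operator has rank one. If neither measure is purely atomic, some operator does the opposite. Take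
  uniformly distributed variables \<open>u\<close> and \<open>v\<close> on atomless parts of the two spaces and let \<open>T f = h \<circ> v\<close>,
  where \<open>h\<close> is the density of the image under \<open>u\<close> of the measure \<open>f d\<mu>\<close>. Restricting \<open>f\<close> to \<open>{u \<le> c}\<close>
  restricts \<open>T f\<close> to \<open>{v \<le> c}\<close>, and for a suitable \<open>c\<close> this cuts \<open>T f\<close> into two parts of equal norm and
  disjoint supports (\<open>exists_halving_operator\<close>). The two behaviours at \<open>x\<^sub>0\<close> are compatible only if the
  distance from \<open>S\<close> to \<open>T\<close> is at least a sixth of the norm of \<open>T\<close>
  (\<open>halving_far_from_range_exposed\<close>).
\<close>

section \<open>Maximal measurable sets\<close>

text \<open>A substitute for Zorn's lemma: extending a set greedily, each time up to \<open>1 / 2 ^ n\<close> of the largest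
  possible measure, leads in the limit to a set that no member of the family enlarges by more than a
  null set. All exhaustion arguments below are instances.\<close>

lemma (in finite_measure) exists_maximal_in_family:
  assumes sets: "F \<subseteq> sets M" and "B0 \<in> F"
    and union: "\<And>A::nat \<Rightarrow> 'a set. incseq A \<Longrightarrow> range A \<subseteq> F \<Longrightarrow> (\<Union>n. A n) \<in> F"
  shows "\<exists>B\<in>F. B0 \<subseteq> B \<and> (\<forall>C\<in>F. B \<subseteq> C \<longrightarrow> measure M C = measure M B)"
proof -
  define S where "S B = {C \<in> F. B \<subseteq> C}" for B
  have bdd: "bdd_above (measure M ` S B)" for B
    by (rule bdd_aboveI[of _ "measure M (space M)"]) (auto intro: bounded_measure)
  have "\<exists>C. C \<in> F \<and> B \<subseteq> C \<and> (SUP D\<in>S B. measure M D) < measure M C + 1 / 2 ^ n"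
    if "B \<in> F" for B and n :: nat
  proof -
    have "S B \<noteq> {}" using that by (auto simp: S_def)
    moreover have "(SUP D\<in>S B. measure M D) - 1 / 2 ^ n < (SUP D\<in>S B. measure M D)" by simp
    ultimately obtain C where "C \<in> S B" "(SUP D\<in>S B. measure M D) - 1 / 2 ^ n < measure M C"
      using bdd less_cSUP_iff by metis
    then show ?thesis by (auto simp: S_def algebra_simps)
  qed
  then have ex: "\<forall>B n. \<exists>C. B \<in> F \<longrightarrow> C \<in> F \<and> B \<subseteq> C \<and>
      (SUP D\<in>S B. measure M D) < measure M C + 1 / 2 ^ (n::nat)"
    by blast
  obtain g where g: "\<And>B n. B \<in> F \<Longrightarrow> g B n \<in> F"
      "\<And>B n. B \<in> F \<Longrightarrow> B \<subseteq> g B n"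
      "\<And>B n. B \<in> F \<Longrightarrow> (SUP D\<in>S B. measure M D) < measure M (g B n) + 1 / 2 ^ (n::nat)"
    using ex by metis
  define A where "A = rec_nat B0 (\<lambda>n B. g B n)"
  have A0: "A 0 = B0" and AS: "A (Suc n) = g (A n) n" for n by (simp_all add: A_def)
  have AF: "A n \<in> F" for n by (induction n) (auto simp: A0 AS \<open>B0 \<in> F\<close> g)
  have inc: "incseq A" by (rule incseq_SucI) (use AF g AS in auto)
  show ?thesis
  proof (intro bexI conjI ballI impI)
    show "(\<Union>n. A n) \<in> F" using AF by (intro union inc) auto
    show "B0 \<subseteq> (\<Union>n. A n)" using A0 by auto
    fix C assume C: "C \<in> F" "(\<Union>n. A n) \<subseteq> C"
    have Am: "A n \<in> sets M" for n using AF sets by auto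
    have "measure M C \<le> measure M (\<Union>n. A n) + 1 / 2 ^ n" for n
    proof -
      have "measure M C \<le> (SUP D\<in>S (A n). measure M D)"
        using C by (intro cSUP_upper bdd) (auto simp: S_def)
      also have "\<dots> < measure M (A (Suc n)) + 1 / 2 ^ n" using g AF AS by simp
      also have "measure M (A (Suc n)) \<le> measure M (\<Union>n. A n)"
        using Am by (intro finite_measure_mono) auto
      finally show ?thesis by simp
    qed
    moreover have "(\<lambda>n. measure M (\<Union>n. A n) + 1 / 2 ^ n) \<longlonglongrightarrow> measure M (\<Union>n. A n) + 0"
      by (intro tendsto_intros LIMSEQ_divide_realpow_zero) simp
    ultimately have "measure M C \<le> measure M (\<Union>n. A n)"
      by (intro LIMSEQ_le_const) auto
    moreover have "measure M (\<Union>n. A n) \<le> measure M C"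
      using C sets by (intro finite_measure_mono) auto
    ultimately show "measure M C = measure M (\<Union>n. A n)" by simp
  qed
qed

section \<open>Operators between spaces of integrable functions\<close>

definition L1norm :: "'a measure \<Rightarrow> ('a \<Rightarrow> 'k::real_normed_vector) \<Rightarrow> real" where
  "L1norm M f = (\<integral>x. norm (f x) \<partial>M)"

lemma L1norm_nonneg[simp]: "0 \<le> L1norm M f"
  by (simp add: L1norm_def)

lemma L1norm_cong_AE:
  fixes f g :: "'a \<Rightarrow> 'k::{banach, second_countable_topology}"
  assumes "integrable M f" "integrable M g" "AE x in M. f x = g x"
  shows "L1norm M f = L1norm M g"
  unfolding L1norm_def using assms
  by (intro integral_cong_AE) (auto intro!: borel_measurable_norm)

lemma L1norm_add:
  fixes f g :: "'a \<Rightarrow> 'k::{banach, second_countable_topology}"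
  assumes "integrable M f" "integrable M g"
  shows "L1norm M (\<lambda>x. f x + g x) \<le> L1norm M f + L1norm M g"
proof -
  have "L1norm M (\<lambda>x. f x + g x) \<le> (\<integral>x. norm (f x) + norm (g x) \<partial>M)"
    unfolding L1norm_def using assms by (intro integral_mono) (auto intro: norm_triangle_ineq)
  then show ?thesis using assms by (simp add: L1norm_def)
qed

lemma L1norm_scale: "L1norm M (\<lambda>x. (c::'k::real_normed_field) * f x) = norm c * L1norm M f"
  by (simp add: L1norm_def norm_mult)

lemma L1norm_minus: "L1norm M (\<lambda>x. - f x) = L1norm M f"
  by (simp add: L1norm_def)

lemma L1norm_diff_commute: "L1norm M (\<lambda>x. f x - g x) = L1norm M (\<lambda>x. g x - f x)"
  by (simp add: L1norm_def norm_minus_commute)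

lemma L1norm_le_diff:
  fixes f g :: "'a \<Rightarrow> 'k::{banach, second_countable_topology}"
  assumes "integrable M f" "integrable M g"
  shows "L1norm M f \<le> L1norm M g + L1norm M (\<lambda>x. f x - g x)"
  using L1norm_add[of M g "\<lambda>x. f x - g x"] assms by simp

lemma L1norm_eq_0:
  fixes f :: "'a \<Rightarrow> 'k::{banach, second_countable_topology}"
  assumes "integrable M f" "L1norm M f \<le> 0"
  shows "AE x in M. f x = 0"
proof -
  have "(\<integral>x. norm (f x) \<partial>M) = 0"
    using assms(2) L1norm_nonneg[of M f] unfolding L1norm_def by (rule antisym)
  then show ?thesis using assms(1) by (subst (asm) integral_nonneg_eq_0_iff_AE) auto
qed

lemma norm_integral_le_L1norm:
  fixes f :: "'a \<Rightarrow> 'k::{banach, second_countable_topology}"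
  shows "norm (\<integral>x. f x \<partial>M) \<le> L1norm M f"
  by (simp add: L1norm_def)

definition cutoff :: "'a set \<Rightarrow> ('a \<Rightarrow> 'k::real_normed_field) \<Rightarrow> 'a \<Rightarrow> 'k" where
  "cutoff A f = (\<lambda>x. indicator A x * f x)"

lemma cutoff_scaleR: "cutoff A f = (\<lambda>x. indicator A x *\<^sub>R f x)"
  by (auto simp: cutoff_def indicator_def)

lemma integrable_cutoff[simp, intro]:
  fixes f :: "'a \<Rightarrow> 'k::{real_normed_field, banach, second_countable_topology}"
  assumes "integrable M f" "A \<in> sets M"
  shows "integrable M (cutoff A f)"
  unfolding cutoff_scaleR using assms by (intro integrable_mult_indicator)

lemma cutoff_cutoff: "cutoff A (cutoff B f) = cutoff (A \<inter> B) f"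
  by (auto simp: cutoff_def indicator_def)

lemma cutoff_add: "cutoff A (\<lambda>x. f x + g x) = (\<lambda>x. cutoff A f x + cutoff A g x)"
  by (auto simp: cutoff_def algebra_simps)

lemma cutoff_scale: "cutoff A (\<lambda>x. c * f x) = (\<lambda>x. c * cutoff A f x)"
  by (auto simp: cutoff_def algebra_simps)

lemma L1norm_cutoff_Un:
  fixes f :: "'a \<Rightarrow> 'k::{real_normed_field, banach, second_countable_topology}"
  assumes "integrable M f" "A \<in> sets M" "B \<in> sets M" "A \<inter> B = {}"
  shows "L1norm M (cutoff (A \<union> B) f) = L1norm M (cutoff A f) + L1norm M (cutoff B f)"
proof -
  have "norm (cutoff (A \<union> B) f x) = norm (cutoff A f x) + norm (cutoff B f x)" for x
    using assms(4) by (auto simp: cutoff_def indicator_def)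
  then show ?thesis unfolding L1norm_def
    using integrable_cutoff[OF assms(1,2)] integrable_cutoff[OF assms(1,3)] by simp
qed

lemma L1norm_cutoff_le:
  fixes f :: "'a \<Rightarrow> 'k::{real_normed_field, banach, second_countable_topology}"
  assumes "integrable M f" "A \<in> sets M"
  shows "L1norm M (cutoff A f) \<le> L1norm M f"
  unfolding L1norm_def using assms
  by (intro integral_mono integrable_norm integrable_cutoff) (auto simp: cutoff_def indicator_def)

lemma L1norm_cutoff_space: "L1norm M (cutoff (space M) f) = L1norm M f"
  unfolding L1norm_def by (intro Bochner_Integration.integral_cong) (auto simp: cutoff_def)

lemma L1norm_cutoff_compl:
  fixes f :: "'a \<Rightarrow> 'k::{real_normed_field, banach, second_countable_topology}"
  assumes "integrable M f" "A \<in> sets M"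
  shows "L1norm M f = L1norm M (cutoff A f) + L1norm M (cutoff (space M - A) f)"
proof -
  have "A \<union> (space M - A) = space M" using sets.sets_into_space[OF assms(2)] by auto
  then show ?thesis
    using L1norm_cutoff_Un[of M f A "space M - A"] assms by (simp add: L1norm_cutoff_space)
qed

lemma L1norm_cutoff_tendsto:
  fixes f :: "'a \<Rightarrow> 'k::{real_normed_field, banach, second_countable_topology}"
  assumes f: "integrable M f" and A: "\<And>n. A n \<in> sets M" "incseq A"
  shows "(\<lambda>n. L1norm M (cutoff (A n) f)) \<longlonglongrightarrow> L1norm M (cutoff (\<Union>n. A n) f)"
proof -
  have UA: "(\<Union>n. A n) \<in> sets M" using A by auto
  have "set_integrable M (\<Union>n. A n) (\<lambda>x. norm (f x))"
    unfolding set_integrable_def using f UA by (intro integrable_mult_indicator) auto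
  from set_integral_cont_up[OF A this] show ?thesis
    by (simp add: L1norm_def cutoff_scaleR set_lebesgue_integral_def abs_mult)
qed

text \<open>The indicator function with its codomain tied to a field of scalars, so that the scalar type of an
  operator determines the type of the functions it is applied to.\<close>

definition chi :: "'a set \<Rightarrow> 'a \<Rightarrow> 'k::real_normed_field" where
  "chi A = indicator A"

lemma (in finite_measure) integrable_chi[simp, intro]:
  "A \<in> sets M \<Longrightarrow> integrable M (chi A :: 'a \<Rightarrow> 'k::{real_normed_field, banach, second_countable_topology})"
  using integrable_cutoff[of M "\<lambda>_. 1::'k" A] by (simp add: chi_def cutoff_def)

lemma cutoff_chi: "cutoff A (chi B) = chi (A \<inter> B)"
  by (auto simp: cutoff_def chi_def indicator_def)

lemma (in finite_measure) L1norm_chi[simp]: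
  assumes "A \<in> sets M"
  shows "L1norm M (chi A :: 'a \<Rightarrow> 'k::{real_normed_field, banach, second_countable_topology}) = measure M A"
proof -
  have "norm (chi A x :: 'k) = indicator A x" for x by (auto simp: chi_def indicator_def)
  then show ?thesis unfolding L1norm_def using assms by simp
qed

lemma (in finite_measure) integral_chi[simp]:
  assumes "A \<in> sets M"
  shows "(\<integral>x. chi A x \<partial>M) = (of_real (measure M A) :: 'k::{real_normed_field, banach, second_countable_topology})"
proof -
  have "(\<integral>x. chi A x \<partial>M) = (\<integral>x. indicator A x *\<^sub>R (1::'k) \<partial>M)"
    by (intro Bochner_Integration.integral_cong) (auto simp: chi_def indicator_def)
  also have "\<dots> = of_real (measure M A)"
    using assms by (simp add: emeasure_eq_measure of_real_def)
  finally show ?thesis .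
qed

text \<open>A bounded operator between \<open>L\<^sub>1\<close> spaces, as a map on integrable functions that is linear up to null
  sets; measure theory can then be done with functions, and classes enter only at the end. The sort
  \<open>{real_normed_field, euclidean_space}\<close> of the scalars covers the real and the complex case at once:
  it provides scalars to rotate with as well as finitely many real coordinates.\<close>

locale L1_operator = M: finite_measure M + N: finite_measure N
  for M :: "'a measure" and N :: "'b measure" +
  fixes t :: "('a \<Rightarrow> 'k::{real_normed_field, euclidean_space}) \<Rightarrow> 'b \<Rightarrow> 'k" and C :: real
  assumes integrable_t[simp, intro]: "integrable M f \<Longrightarrow> integrable N (t f)"
    and t_add: "integrable M f \<Longrightarrow> integrable M g \<Longrightarrow>
      AE x in N. t (\<lambda>x. f x + g x) x = t f x + t g x"
    and t_scale: "integrable M f \<Longrightarrow> AE x in N. t (\<lambda>x. c * f x) x = c * t f x"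
    and t_bound: "integrable M f \<Longrightarrow> L1norm N (t f) \<le> C * L1norm M f"
    and C_nonneg: "0 \<le> C"
begin

lemma t_diff:
  assumes "integrable M f" "integrable M g"
  shows "AE x in N. t (\<lambda>x. f x - g x) x = t f x - t g x"
proof -
  have "AE x in N. t (\<lambda>x. f x + (-1) * g x) x = t f x + t (\<lambda>x. (-1) * g x) x"
    using assms by (intro t_add) auto
  moreover have "AE x in N. t (\<lambda>x. (-1) * g x) x = (-1) * t g x"
    using assms by (intro t_scale)
  ultimately show ?thesis by eventually_elim simp
qed

lemma L1norm_t_diff:
  assumes "integrable M f" "integrable M g"
  shows "L1norm N (\<lambda>x. t f x - t g x) \<le> C * L1norm M (\<lambda>x. f x - g x)"
proof -
  have "L1norm N (\<lambda>x. t f x - t g x) = L1norm N (t (\<lambda>x. f x - g x))"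
    using t_diff[OF assms] assms by (intro L1norm_cong_AE) auto
  then show ?thesis using t_bound[of "\<lambda>x. f x - g x"] assms by simp
qed

lemma t_cong:
  assumes "integrable M f" "integrable M g" "AE x in M. f x = g x"
  shows "AE x in N. t f x = t g x"
proof -
  have "L1norm M (\<lambda>x. f x - g x) = L1norm M (\<lambda>x. 0::'k)"
    using assms by (intro L1norm_cong_AE) auto
  then have "L1norm M (\<lambda>x. f x - g x) = 0" by (simp add: L1norm_def)
  then have "L1norm N (\<lambda>x. t f x - t g x) \<le> 0"
    using L1norm_t_diff[OF assms(1,2)] by simp
  then have "AE x in N. t f x - t g x = 0"
    using assms by (intro L1norm_eq_0) auto
  then show ?thesis by eventually_elim simp
qed

lemma t_cutoff_Un:
  assumes "integrable M f" "A \<in> sets M" "B \<in> sets M" "A \<inter> B = {}"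
  shows "AE x in N. t (cutoff (A \<union> B) f) x = t (cutoff A f) x + t (cutoff B f) x"
proof -
  have "cutoff (A \<union> B) f = (\<lambda>x. cutoff A f x + cutoff B f x)"
    using assms(4) by (auto simp: cutoff_def indicator_def fun_eq_iff)
  then show ?thesis using t_add[of "cutoff A f" "cutoff B f"] assms by auto
qed

lemma t_cutoff_compl:
  assumes "integrable M f" "A \<in> sets M"
  shows "AE x in N. t f x = t (cutoff A f) x + t (cutoff (space M - A) f) x"
proof -
  have *: "A \<union> (space M - A) = space M" using sets.sets_into_space[OF assms(2)] by auto
  have "AE x in N. t (cutoff (space M) f) x = t (cutoff A f) x + t (cutoff (space M - A) f) x"
    using t_cutoff_Un[of f A "space M - A"] assms unfolding * by auto
  moreover have "AE x in N. t (cutoff (space M) f) x = t f x"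
    using assms by (intro t_cong integrable_cutoff) (auto simp: cutoff_def)
  ultimately show ?thesis by eventually_elim simp
qed

lemma t_chi_Un:
  assumes "A \<in> sets M" "B \<in> sets M" "A \<inter> B = {}"
  shows "AE x in N. t (chi (A \<union> B)) x = t (chi A) x + t (chi B) x"
proof -
  have "chi (A \<union> B) = (\<lambda>x. chi A x + chi B x :: 'k)"
    using assms(3) by (auto simp: chi_def indicator_def fun_eq_iff)
  then show ?thesis using t_add[of "chi A" "chi B"] assms by auto
qed

text \<open>The norm of an operator on \<open>L\<^sub>1\<close> is determined by its values on indicator functions: the pieces of a
  simple function have disjoint supports, so their norms add up exactly.\<close>

lemma bound_from_indicators:
  assumes "0 \<le> c" and *: "\<And>H. H \<in> sets M \<Longrightarrow> L1norm N (t (chi H)) \<le> c * measure M H"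
    and "integrable M f"
  shows "L1norm N (t f) \<le> c * L1norm M f"
proof -
  obtain s where s: "\<And>i. simple_function M (s i)"
      "\<And>i. emeasure M {y \<in> space M. s i y \<noteq> 0} \<noteq> \<infinity>"
      "\<And>x. x \<in> space M \<Longrightarrow> (\<lambda>i. s i x) \<longlonglongrightarrow> f x"
      "\<And>x i. x \<in> space M \<Longrightarrow> norm (s i x) \<le> 2 * norm (f x)"
    using integrable_implies_simple_function_sequence[OF assms(3)] by blast
  have int: "integrable M g" if "simple_function M g" for g :: "'a \<Rightarrow> 'k"
    using integrable_simple_function[OF that] by simp
  have simple: "L1norm N (t g) \<le> c * L1norm M g"
    if "simple_function M g" "emeasure M {y \<in> space M. g y \<noteq> 0} \<noteq> \<infinity>" for g
    using that
  proof (induction rule: integrable_simple_function_induct)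
    case (cong f g)
    have "L1norm N (t g) = L1norm N (t f)"
      by (intro L1norm_cong_AE integrable_t int cong t_cong) (use cong in auto)
    moreover have "L1norm M f = L1norm M g"
      by (intro L1norm_cong_AE int cong) (use cong in auto)
    ultimately show ?case using cong by simp
  next
    case (indicator A y)
    have eq: "(\<lambda>x. indicator A x *\<^sub>R y) = (\<lambda>x. y * chi A x)"
      by (auto simp: chi_def indicator_def)
    have "L1norm N (t (\<lambda>x. y * chi A x)) = L1norm N (\<lambda>x. y * t (chi A) x)"
      using indicator by (intro L1norm_cong_AE t_scale) auto
    then show ?case unfolding eq using indicator *[of A]
      by (simp add: L1norm_scale) (metis mult.left_commute mult_left_mono norm_ge_zero)
  next
    case (add f g)
    have "L1norm N (t (\<lambda>x. f x + g x)) = L1norm N (\<lambda>x. t f x + t g x)"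
      using add int by (intro L1norm_cong_AE t_add integrable_t) auto
    also have "\<dots> \<le> L1norm N (t f) + L1norm N (t g)"
      using add int by (intro L1norm_add) auto
    also have "\<dots> \<le> c * (L1norm M f + L1norm M g)" using add by (simp add: algebra_simps)
    also have "L1norm M f + L1norm M g = (\<integral>x. norm (f x) + norm (g x) \<partial>M)"
      unfolding L1norm_def using add int by simp
    also have "\<dots> = L1norm M (\<lambda>x. f x + g x)"
      unfolding L1norm_def using add by (intro Bochner_Integration.integral_cong) auto
    finally show ?case .
  qed
  have lim: "(\<lambda>i. L1norm M (\<lambda>x. f x - s i x)) \<longlonglongrightarrow> L1norm M (\<lambda>x. 0::'k)"
    unfolding L1norm_def
  proof (rule integral_dominated_convergence[where w="\<lambda>x. 3 * norm (f x)"])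
    show "AE x in M. (\<lambda>i. norm (f x - s i x)) \<longlonglongrightarrow> norm (0::'k)"
      using s(3) by (intro AE_I2 tendsto_norm) (auto intro!: tendsto_eq_intros)
    show "AE x in M. norm (norm (f x - s i x)) \<le> 3 * norm (f x)" for i
    proof (rule AE_I2)
      fix x assume "x \<in> space M"
      then show "norm (norm (f x - s i x)) \<le> 3 * norm (f x)"
        using s(4)[of x i] norm_triangle_ineq4[of "f x" "s i x"] by simp
    qed
    show "(\<lambda>x. norm (f x - s i x)) \<in> borel_measurable M" for i
      by (rule borel_measurable_integrable)
        (intro integrable_norm Bochner_Integration.integrable_diff assms(3) int s(1))
  qed (use assms(3) in auto)
  have le: "L1norm N (t f) \<le> c * L1norm M f + (c + C) * L1norm M (\<lambda>x. f x - s i x)" for i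
  proof -
    note si = int[OF s(1), of i]
    have "L1norm N (t f) \<le> L1norm N (t (s i)) + L1norm N (\<lambda>x. t f x - t (s i) x)"
      using si assms(3) by (intro L1norm_le_diff) auto
    also have "\<dots> \<le> c * L1norm M (s i) + C * L1norm M (\<lambda>x. f x - s i x)"
      using si assms(3) simple[OF s(1,2)] L1norm_t_diff by (intro add_mono) auto
    also have "\<dots> \<le> c * (L1norm M f + L1norm M (\<lambda>x. f x - s i x)) + C * L1norm M (\<lambda>x. f x - s i x)"
      using L1norm_le_diff[OF si assms(3)] L1norm_diff_commute[of M f "s i"] \<open>0 \<le> c\<close> C_nonneg
      by (intro add_mono mult_left_mono) auto
    finally show ?thesis by (simp add: algebra_simps)
  qed
  have "(\<lambda>i. c * L1norm M f + (c + C) * L1norm M (\<lambda>x. f x - s i x)) \<longlonglongrightarrow>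
      c * L1norm M f + (c + C) * L1norm M (\<lambda>x. 0::'k)"
    using lim by (intro tendsto_intros)
  then show ?thesis using le by (intro LIMSEQ_le_const) (auto simp: L1norm_def)
qed

end

section \<open>Operator norm and range exposing functions\<close>

definition fun_op_norm :: "'a measure \<Rightarrow> 'b measure \<Rightarrow>
    (('a \<Rightarrow> 'k::{banach, second_countable_topology}) \<Rightarrow> 'b \<Rightarrow> 'k) \<Rightarrow> real" where
  "fun_op_norm M N t = (SUP f\<in>{f. integrable M f \<and> L1norm M f \<le> 1}. L1norm N (t f))"

text \<open>The defining property of a range strongly exposing operator at a given point \<open>x0\<close>, for functions
  instead of classes.\<close>

definition range_exposed_at :: "'a measure \<Rightarrow> 'b measure \<Rightarrow>
    (('a \<Rightarrow> 'k::{real_normed_field, banach, second_countable_topology}) \<Rightarrow> 'b \<Rightarrow> 'k) \<Rightarrow> ('a \<Rightarrow> 'k) \<Rightarrow> bool" where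
  "range_exposed_at M N t x0 \<longleftrightarrow> (\<forall>x. (\<forall>n::nat. integrable M (x n) \<and> L1norm M (x n) \<le> 1) \<longrightarrow>
     (\<lambda>n. L1norm N (t (x n))) \<longlonglongrightarrow> fun_op_norm M N t \<longrightarrow>
     (\<exists>\<sigma> \<theta>. strict_mono \<sigma> \<and> norm \<theta> = 1 \<and>
        (\<lambda>n. L1norm N (\<lambda>z. t (x (\<sigma> n)) z - \<theta> * t x0 z)) \<longlonglongrightarrow> 0))"

context L1_operator
begin

lemma L1norm_t_scale: "integrable M f \<Longrightarrow> L1norm N (t (\<lambda>x. c * f x)) = norm c * L1norm N (t f)"
  using L1norm_cong_AE[OF _ _ t_scale[of f c]] by (auto simp: L1norm_scale)

lemma bdd_above_t: "bdd_above ((\<lambda>f. L1norm N (t f)) ` {f. integrable M f \<and> L1norm M f \<le> 1})"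
proof (rule bdd_aboveI2)
  fix f :: "'a \<Rightarrow> 'k" assume "f \<in> {f. integrable M f \<and> L1norm M f \<le> 1}"
  then show "L1norm N (t f) \<le> C"
    using t_bound[of f] C_nonneg mult_left_mono[of "L1norm M f" 1 C] by auto
qed

lemma bound_fun_op_norm:
  assumes f: "integrable M f"
  shows "L1norm N (t f) \<le> fun_op_norm M N t * L1norm M f"
proof (cases "L1norm M f = 0")
  case True
  then show ?thesis using t_bound[OF f] by simp
next
  case False
  then have pos: "L1norm M f > 0" using L1norm_nonneg[of M f] by linarith
  define c :: 'k where "c = of_real (1 / L1norm M f)"
  have c: "norm c = 1 / L1norm M f" using pos by (simp add: c_def norm_divide)
  have "L1norm N (t (\<lambda>x. c * f x)) \<le> fun_op_norm M N t"
    unfolding fun_op_norm_def using f c pos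
    by (intro cSUP_upper bdd_above_t) (auto simp: L1norm_scale)
  then show ?thesis using L1norm_t_scale[OF f, of c] c pos by (simp add: field_simps)
qed

lemma fun_op_norm_nonneg: "0 \<le> fun_op_norm M N t"
proof -
  have "L1norm N (t (\<lambda>_. 0)) \<le> fun_op_norm M N t"
    unfolding fun_op_norm_def by (intro cSUP_upper bdd_above_t) (auto simp: L1norm_def)
  then show ?thesis using L1norm_nonneg[of N "t (\<lambda>_. 0)"] by linarith
qed

lemma fun_op_norm_le:
  assumes "0 \<le> c" "\<And>f. integrable M f \<Longrightarrow> L1norm N (t f) \<le> c * L1norm M f"
  shows "fun_op_norm M N t \<le> c"
  unfolding fun_op_norm_def
proof (rule cSUP_least)
  show "{f. integrable M f \<and> L1norm M f \<le> 1} \<noteq> {}"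
    by (auto intro!: exI[of _ "\<lambda>_. 0"] simp: L1norm_def)
  show "L1norm N (t f) \<le> c" if "f \<in> {f. integrable M f \<and> L1norm M f \<le> 1}" for f :: "'a \<Rightarrow> 'k"
    using that assms(2)[of f] mult_left_mono[of "L1norm M f" 1 c] \<open>0 \<le> c\<close> by fastforce
qed

lemma less_fun_op_normE:
  assumes "c < fun_op_norm M N t"
  obtains f where "integrable M f" "L1norm M f \<le> 1" "c < L1norm N (t f)"
proof -
  have "{f :: 'a \<Rightarrow> 'k. integrable M f \<and> L1norm M f \<le> 1} \<noteq> {}"
    by (auto intro!: exI[of _ "\<lambda>_. 0"] simp: L1norm_def)
  then show ?thesis
    using assms that less_cSUP_iff[OF _ bdd_above_t, of c] unfolding fun_op_norm_def by blast
qed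

end

section \<open>Operators on classes of functions\<close>

text \<open>An operator on classes is always induced by a map on functions, obtained by choosing
  representatives; this relation transports norms, differences and range exposure between the two.\<close>

definition represents :: "'a measure \<Rightarrow> 'b measure \<Rightarrow>
    (('a \<Rightarrow> 'k::{banach, second_countable_topology}) set \<Rightarrow> ('b \<Rightarrow> 'k) set) \<Rightarrow>
    (('a \<Rightarrow> 'k) \<Rightarrow> 'b \<Rightarrow> 'k) \<Rightarrow> bool" where
  "represents M N T t \<longleftrightarrow> (\<forall>f. integrable M f \<longrightarrow> T (L1_class M f) = L1_class N (t f))"

lemma vnorm_L1norm:
  fixes f :: "'a \<Rightarrow> 'k::{real_normed_field, banach, second_countable_topology}"
  shows "integrable M f \<Longrightarrow> vnorm (L1 TYPE('k) M) (L1_class M f) = L1norm M f"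
  by (simp add: vnorm_L1 L1norm_def)

lemma vdiff_L1:
  fixes f g :: "'a \<Rightarrow> 'k::{real_normed_field, banach, second_countable_topology}"
  assumes "integrable M f" "integrable M g"
  shows "vdiff (L1 TYPE('k) M) (L1_class M f) (L1_class M g) = L1_class M (\<lambda>x. f x - g x)"
  using assms by (simp add: vdiff_def vscale_L1 vadd_L1)

lemma unit_ball_L1:
  "unit_ball (L1 TYPE('k::{real_normed_field, banach, second_countable_topology}) M) =
    L1_class M ` {f. integrable M f \<and> L1norm M f \<le> 1}"
  by (auto simp: unit_ball_def vecs_L1 vnorm_L1norm)

lemma unit_sphere_L1:
  "unit_sphere (L1 TYPE('k::{real_normed_field, banach, second_countable_topology}) M) =
    L1_class M ` {f. integrable M f \<and> L1norm M f = 1}"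
  by (auto simp: unit_sphere_def vecs_L1 vnorm_L1norm)

lemma bounded_op_represented:
  fixes T :: "('a \<Rightarrow> 'k::{real_normed_field, euclidean_space}) set \<Rightarrow> ('b \<Rightarrow> 'k) set"
  assumes fin: "finite_measure M" "finite_measure N"
    and T: "T \<in> bounded_ops (L1 TYPE('k) M) (L1 TYPE('k) N)"
  obtains t C where "L1_operator M N t C" "represents M N T t"
proof -
  interpret M: finite_measure M by fact
  interpret N: finite_measure N by fact
  obtain C where C: "\<And>A. A \<in> vecs (L1 TYPE('k) M) \<Longrightarrow>
      vnorm (L1 TYPE('k) N) (T A) \<le> C * vnorm (L1 TYPE('k) M) A"
    using T unfolding bounded_ops_def by blast
  have Tadd: "T (vadd (L1 TYPE('k) M) A B) = vadd (L1 TYPE('k) N) (T A) (T B)"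
    if "A \<in> vecs (L1 TYPE('k) M)" "B \<in> vecs (L1 TYPE('k) M)" for A B
    using T that unfolding bounded_ops_def by blast
  have Tscale: "T (vscale (L1 TYPE('k) M) c A) = vscale (L1 TYPE('k) N) c (T A)"
    if "A \<in> vecs (L1 TYPE('k) M)" for A c
    using T that unfolding bounded_ops_def by blast
  have mem: "L1_class M f \<in> vecs (L1 TYPE('k) M)" if "integrable M f" for f :: "'a \<Rightarrow> 'k"
    using that by (auto simp: vecs_L1)
  have "\<exists>g. integrable N g \<and> T (L1_class M f) = L1_class N g" if "integrable M f" for f :: "'a \<Rightarrow> 'k"
  proof -
    have "T (L1_class M f) \<in> vecs (L1 TYPE('k) N)"
      using T mem[OF that] unfolding bounded_ops_def by blast
    then show ?thesis by (auto simp: vecs_L1)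
  qed
  then obtain t where int: "\<And>f. integrable M f \<Longrightarrow> integrable N (t f)"
      and t: "\<And>f. integrable M f \<Longrightarrow> T (L1_class M f) = L1_class N (t f)"
    by metis
  have "L1_operator M N t \<bar>C\<bar>"
  proof unfold_locales
    fix f g :: "'a \<Rightarrow> 'k" and c :: 'k assume f: "integrable M f"
    show "integrable N (t f)" using int f .
    show "AE x in N. t (\<lambda>x. c * f x) x = c * t f x"
      using Tscale[OF mem[OF f], of c] f by (simp add: vscale_L1 t int L1_class_eq_iff)
    have "L1norm N (t f) \<le> C * L1norm M f"
      using C[OF mem[OF f]] f by (simp add: t int vnorm_L1norm)
    also have "\<dots> \<le> \<bar>C\<bar> * L1norm M f" by (intro mult_right_mono) auto
    finally show "L1norm N (t f) \<le> \<bar>C\<bar> * L1norm M f" .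
    assume g: "integrable M g"
    show "AE x in N. t (\<lambda>x. f x + g x) x = t f x + t g x"
      using Tadd[OF mem[OF f] mem[OF g]] f g by (simp add: vadd_L1 t int L1_class_eq_iff)
  qed simp
  moreover have "represents M N T t" using t by (simp add: represents_def)
  ultimately show ?thesis using that by blast
qed

lemma (in L1_operator) lift_op:
  obtains T where "T \<in> bounded_ops (L1 TYPE('k) M) (L1 TYPE('k) N)" "represents M N T t"
proof -
  define T where "T = (\<lambda>A\<in>vecs (L1 TYPE('k) M). L1_class N (t (SOME f. f \<in> A)))"
  have T: "T (L1_class M f) = L1_class N (t f)" if f: "integrable M f" for f :: "'a \<Rightarrow> 'k"
  proof -
    define g where "g = (SOME g. g \<in> L1_class M f)"
    have "g \<in> L1_class M f" unfolding g_def using L1_class_self[OF f]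
      by (rule someI[of "\<lambda>g. g \<in> L1_class M f"])
    then have g: "integrable M g" "AE x in M. g x = f x" by (auto simp: L1_class_def)
    have "T (L1_class M f) = L1_class N (t g)"
      using f by (auto simp: T_def g_def vecs_L1)
    also have "\<dots> = L1_class N (t f)" using t_cong[OF g(1) f g(2)] by (rule L1_class_cong)
    finally show ?thesis .
  qed
  have "T \<in> bounded_ops (L1 TYPE('k) M) (L1 TYPE('k) N)"
    unfolding bounded_ops_def
  proof (intro CollectI conjI ballI allI exI[of _ C])
    show "T \<in> vecs (L1 TYPE('k) M) \<rightarrow>\<^sub>E vecs (L1 TYPE('k) N)"
      using T by (auto simp: vecs_L1) (auto simp: T_def vecs_L1)
    fix A assume "A \<in> vecs (L1 TYPE('k) M)"
    then obtain f :: "'a \<Rightarrow> 'k" where f: "integrable M f" "A = L1_class M f" by (auto simp: vecs_L1)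
    show "vnorm (L1 TYPE('k) N) (T A) \<le> C * vnorm (L1 TYPE('k) M) A"
      using f t_bound by (simp add: T vnorm_L1norm)
    show "T (vscale (L1 TYPE('k) M) c A) = vscale (L1 TYPE('k) N) c (T A)" for c
      using f L1_class_cong[OF t_scale[OF f(1), of c]] by (simp add: T vscale_L1)
    fix B assume "B \<in> vecs (L1 TYPE('k) M)"
    then obtain g :: "'a \<Rightarrow> 'k" where g: "integrable M g" "B = L1_class M g" by (auto simp: vecs_L1)
    show "T (vadd (L1 TYPE('k) M) A B) = vadd (L1 TYPE('k) N) (T A) (T B)"
      using f g L1_class_cong[OF t_add[OF f(1) g(1)]] by (simp add: T vadd_L1)
  qed
  moreover have "represents M N T t" using T by (simp add: represents_def)
  ultimately show ?thesis using that by blast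
qed

lemma (in L1_operator) op_norm_represented:
  assumes "represents M N T t"
  shows "op_norm (L1 TYPE('k) M) (L1 TYPE('k) N) T = fun_op_norm M N t"
  unfolding op_norm_def fun_op_norm_def unit_ball_L1 image_image
  using assms by (intro SUP_cong refl) (auto simp: represents_def vnorm_L1norm)

lemma (in L1_operator) op_diff_represented:
  assumes "L1_operator M N s D" "represents M N S s" "represents M N T t"
  shows "L1_operator M N (\<lambda>f x. s f x - t f x) (D + C)"
    and "represents M N (op_diff (L1 TYPE('k) M) (L1 TYPE('k) N) S T) (\<lambda>f x. s f x - t f x)"
proof -
  interpret S: L1_operator M N s D by fact
  show "L1_operator M N (\<lambda>f x. s f x - t f x) (D + C)"
  proof unfold_locales
    fix f g :: "'a \<Rightarrow> 'k" and c :: 'k assume f: "integrable M f"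
    show "integrable N (\<lambda>x. s f x - t f x)" using f by auto
    show "AE x in N. s (\<lambda>x. c * f x) x - t (\<lambda>x. c * f x) x = c * (s f x - t f x)"
      using S.t_scale[OF f, of c] t_scale[OF f, of c] by eventually_elim (simp add: algebra_simps)
    have "L1norm N (\<lambda>x. s f x + - t f x) \<le> L1norm N (s f) + L1norm N (\<lambda>x. - t f x)"
      using f by (intro L1norm_add) auto
    then show "L1norm N (\<lambda>x. s f x - t f x) \<le> (D + C) * L1norm M f"
      using S.t_bound[OF f] t_bound[OF f] by (simp add: L1norm_minus algebra_simps)
    assume g: "integrable M g"
    show "AE x in N. s (\<lambda>x. f x + g x) x - t (\<lambda>x. f x + g x) x = s f x - t f x + (s g x - t g x)"
      using S.t_add[OF f g] t_add[OF f g] by eventually_elim (simp add: algebra_simps)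
  qed (use C_nonneg S.C_nonneg in auto)
  show "represents M N (op_diff (L1 TYPE('k) M) (L1 TYPE('k) N) S T) (\<lambda>f x. s f x - t f x)"
    using assms(2,3) by (auto simp: represents_def op_diff_def vecs_L1 vdiff_L1)
qed

lemma (in L1_operator) RSE_iff_range_exposed:
  assumes T: "T \<in> bounded_ops (L1 TYPE('k) M) (L1 TYPE('k) N)" and rep: "represents M N T t"
  shows "T \<in> RSE (L1 TYPE('k) M) (L1 TYPE('k) N) \<longleftrightarrow>
    (\<exists>x0. integrable M x0 \<and> L1norm M x0 = 1 \<and> range_exposed_at M N t x0)"
    (is "_ \<longleftrightarrow> (\<exists>x0. ?P x0)")
proof -
  let ?X = "L1 TYPE('k) M" and ?Y = "L1 TYPE('k) N"
  define Q where "Q A0 \<longleftrightarrow> (\<forall>x :: nat \<Rightarrow> ('a \<Rightarrow> 'k) set.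
     (\<forall>n. x n \<in> unit_ball ?X) \<longrightarrow>
     (\<lambda>n. vnorm ?Y (T (x n))) \<longlonglongrightarrow> op_norm ?X ?Y T \<longrightarrow>
     (\<exists>\<sigma> \<theta>. strict_mono \<sigma> \<and> norm \<theta> = 1 \<and>
        (\<lambda>n. vnorm ?Y (vdiff ?Y (T (x (\<sigma> n))) (vscale ?Y \<theta> (T A0)))) \<longlonglongrightarrow> 0))" for A0
  have Tf: "T (L1_class M f) = L1_class N (t f)" if "integrable M f" for f :: "'a \<Rightarrow> 'k"
    using rep that by (simp add: represents_def)
  have dist: "vnorm ?Y (vdiff ?Y (T (L1_class M f)) (vscale ?Y \<theta> (T (L1_class M x0)))) =
      L1norm N (\<lambda>z. t f z - \<theta> * t x0 z)" if "integrable M f" "integrable M x0" for f x0 \<theta>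
    using that by (simp add: Tf vscale_L1 vdiff_L1 vnorm_L1norm)
  have Q: "Q (L1_class M x0) \<longleftrightarrow> range_exposed_at M N t x0" if x0: "integrable M x0" for x0
  proof
    assume Q: "Q (L1_class M x0)"
    show "range_exposed_at M N t x0"
      unfolding range_exposed_at_def
    proof (intro allI impI)
      fix x :: "nat \<Rightarrow> 'a \<Rightarrow> 'k"
      assume x: "\<forall>n. integrable M (x n) \<and> L1norm M (x n) \<le> 1"
        and lim: "(\<lambda>n. L1norm N (t (x n))) \<longlonglongrightarrow> fun_op_norm M N t"
      have "\<forall>n. L1_class M (x n) \<in> unit_ball ?X" using x by (auto simp: unit_ball_L1)
      moreover have "(\<lambda>n. vnorm ?Y (T (L1_class M (x n)))) \<longlonglongrightarrow> op_norm ?X ?Y T"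
        using lim x by (simp add: Tf vnorm_L1norm op_norm_represented[OF rep])
      ultimately have "\<exists>\<sigma> \<theta>. strict_mono \<sigma> \<and> norm \<theta> = 1 \<and>
        (\<lambda>n. vnorm ?Y (vdiff ?Y (T (L1_class M (x (\<sigma> n)))) (vscale ?Y \<theta> (T (L1_class M x0))))) \<longlonglongrightarrow> 0"
        using Q[unfolded Q_def, rule_format, of "\<lambda>n. L1_class M (x n)"] by simp
      then show "\<exists>\<sigma> \<theta>. strict_mono \<sigma> \<and> norm \<theta> = 1 \<and>
        (\<lambda>n. L1norm N (\<lambda>z. t (x (\<sigma> n)) z - \<theta> * t x0 z)) \<longlonglongrightarrow> 0"
        using x x0 by (simp add: dist)
    qed
  next
    assume P: "range_exposed_at M N t x0"
    show "Q (L1_class M x0)"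
      unfolding Q_def
    proof (intro allI impI)
      fix A :: "nat \<Rightarrow> ('a \<Rightarrow> 'k) set"
      assume "\<forall>n. A n \<in> unit_ball ?X"
        and lim: "(\<lambda>n. vnorm ?Y (T (A n))) \<longlonglongrightarrow> op_norm ?X ?Y T"
      then have "\<forall>n. \<exists>f. A n = L1_class M f \<and> integrable M f \<and> L1norm M f \<le> 1"
        by (auto simp: unit_ball_L1)
      then obtain x where A: "\<And>n. A n = L1_class M (x n)"
          and x: "\<And>n. integrable M (x n)" "\<And>n. L1norm M (x n) \<le> 1"
        by metis
      have "(\<lambda>n. L1norm N (t (x n))) \<longlonglongrightarrow> fun_op_norm M N t"
        using lim x by (simp add: A Tf vnorm_L1norm op_norm_represented[OF rep])
      then have "\<exists>\<sigma> \<theta>. strict_mono \<sigma> \<and> norm \<theta> = 1 \<and>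
        (\<lambda>n. L1norm N (\<lambda>z. t (x (\<sigma> n)) z - \<theta> * t x0 z)) \<longlonglongrightarrow> 0"
        using P x unfolding range_exposed_at_def by blast
      then show "\<exists>\<sigma> \<theta>. strict_mono \<sigma> \<and> norm \<theta> = 1 \<and>
        (\<lambda>n. vnorm ?Y (vdiff ?Y (T (A (\<sigma> n))) (vscale ?Y \<theta> (T (L1_class M x0))))) \<longlonglongrightarrow> 0"
        using x x0 by (simp add: A dist)
    qed
  qed
  have "T \<in> RSE ?X ?Y \<longleftrightarrow> (\<exists>A0\<in>unit_sphere ?X. Q A0)"
    using T unfolding RSE_def Q_def by simp
  also have "\<dots> \<longleftrightarrow> (\<exists>x0. ?P x0)"
    unfolding unit_sphere_L1 using Q by auto
  finally show ?thesis .
qed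

section \<open>Operators whose averages oscillate little\<close>

text \<open>Every set of positive measure contains one, \<open>A\<close>, such that the averages \<open>t (chi H) / measure M H\<close>
  over all \<open>H \<subseteq> A\<close> are within \<open>\<epsilon>\<close> of one function \<open>y\<close>. This is the form in which the existence of a
  vector density (the Radon-Nikodym property of the range) enters; multiplying by \<open>measure M H\<close> avoids
  an exception for null sets.\<close>

definition small_oscillation :: "'a measure \<Rightarrow> 'b measure \<Rightarrow>
    (('a \<Rightarrow> 'k::{real_normed_field, banach, second_countable_topology}) \<Rightarrow> 'b \<Rightarrow> 'k) \<Rightarrow> bool" where
  "small_oscillation M N t \<longleftrightarrow> (\<forall>E \<epsilon>. E \<in> sets M \<longrightarrow> 0 < measure M E \<longrightarrow> 0 < \<epsilon> \<longrightarrow>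
     (\<exists>A y. A \<in> sets M \<and> A \<subseteq> E \<and> 0 < measure M A \<and> integrable N y \<and>
       (\<forall>H\<in>sets M. H \<subseteq> A \<longrightarrow>
         L1norm N (\<lambda>x. t (chi H) x - of_real (measure M H) * y x) \<le> \<epsilon> * measure M H)))"

lemma small_oscillationE:
  fixes t :: "('a \<Rightarrow> 'k::{real_normed_field, banach, second_countable_topology}) \<Rightarrow> 'b \<Rightarrow> 'k"
  assumes "small_oscillation M N t" "E \<in> sets M" "0 < measure M E" "0 < \<epsilon>"
  obtains A y where "A \<in> sets M" "A \<subseteq> E" "0 < measure M A" "integrable N y"
    "\<And>H. H \<in> sets M \<Longrightarrow> H \<subseteq> A \<Longrightarrow>
      L1norm N (\<lambda>x. t (chi H) x - of_real (measure M H) * y x) \<le> \<epsilon> * measure M H"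
proof -
  from assms(1)[unfolded small_oscillation_def, rule_format, OF assms(2-4)]
  obtain A y where "A \<in> sets M" "A \<subseteq> E" "0 < measure M A" "integrable N y"
    and *: "\<forall>H\<in>sets M. H \<subseteq> A \<longrightarrow>
      L1norm N (\<lambda>x. t (chi H) x - of_real (measure M H) * y x) \<le> \<epsilon> * measure M H"
    by (elim exE conjE)
  then show ?thesis by (intro that[of A y] *[rule_format])
qed

lemma small_oscillationI:
  fixes t :: "('a \<Rightarrow> 'k::{real_normed_field, banach, second_countable_topology}) \<Rightarrow> 'b \<Rightarrow> 'k"
  assumes "\<And>E \<epsilon>. E \<in> sets M \<Longrightarrow> 0 < measure M E \<Longrightarrow> 0 < \<epsilon> \<Longrightarrow>
     \<exists>A y. A \<in> sets M \<and> A \<subseteq> E \<and> 0 < measure M A \<and> integrable N y \<and>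
       (\<forall>H\<in>sets M. H \<subseteq> A \<longrightarrow>
         L1norm N (\<lambda>x. t (chi H) x - of_real (measure M H) * y x) \<le> \<epsilon> * measure M H)"
  shows "small_oscillation M N t"
  unfolding small_oscillation_def by (intro allI impI assms)

context L1_operator
begin

lemma t_chi_bound: "H \<in> sets M \<Longrightarrow> L1norm N (t (chi H)) \<le> C * measure M H"
  using t_bound[of "chi H"] by simp

lemma t_chi_null: "H \<in> sets M \<Longrightarrow> measure M H = 0 \<Longrightarrow> L1norm N (t (chi H)) = 0"
  using t_chi_bound[of H] L1norm_nonneg[of N "t (chi H)"] by simp

lemma L1norm_t_chi_Un:
  assumes "A \<in> sets M" "B \<in> sets M" "A \<inter> B = {}"
  shows "L1norm N (t (chi (A \<union> B))) \<le> L1norm N (t (chi A)) + L1norm N (t (chi B))"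
proof -
  have "L1norm N (t (chi (A \<union> B))) = L1norm N (\<lambda>x. t (chi A) x + t (chi B) x)"
    using assms by (intro L1norm_cong_AE t_chi_Un) auto
  then show ?thesis using L1norm_add[of N "t (chi A)" "t (chi B)"] assms by simp
qed

lemma t_continuous:
  assumes f: "\<And>n. integrable M (f n)" "integrable M g"
    and lim: "(\<lambda>n. L1norm M (\<lambda>x. f n x - g x)) \<longlonglongrightarrow> 0"
  shows "(\<lambda>n. L1norm N (t (f n))) \<longlonglongrightarrow> L1norm N (t g)"
proof -
  have "norm (L1norm N (t (f n)) - L1norm N (t g)) \<le> C * L1norm M (\<lambda>x. f n x - g x)" for n
    using L1norm_le_diff[of N "t (f n)" "t g"] L1norm_le_diff[of N "t g" "t (f n)"]
      L1norm_diff_commute[of N "t g" "t (f n)"] L1norm_t_diff[OF f(1) f(2), of n] f by auto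
  moreover have "(\<lambda>n. C * L1norm M (\<lambda>x. f n x - g x)) \<longlonglongrightarrow> C * 0"
    using lim by (intro tendsto_intros)
  ultimately have "(\<lambda>n. L1norm N (t (f n)) - L1norm N (t g)) \<longlonglongrightarrow> 0"
    by - (rule Lim_null_comparison[where g="\<lambda>n. C * L1norm M (\<lambda>x. f n x - g x)"], auto)
  then show ?thesis by (rule LIM_zero_cancel)
qed

lemma t_chi_incseq:
  assumes A: "\<And>n. A n \<in> sets M" "incseq A"
  shows "(\<lambda>n. L1norm N (t (chi (A n)))) \<longlonglongrightarrow> L1norm N (t (chi (\<Union>n. A n)))"
proof (rule t_continuous)
  have UA: "(\<Union>n. A n) \<in> sets M" using A by auto
  have "L1norm M (\<lambda>x. chi (A n) x - chi (\<Union>n. A n) x :: 'k) = measure M (\<Union>n. A n) - measure M (A n)" for n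
  proof -
    have "L1norm M (\<lambda>x. chi (A n) x - chi (\<Union>n. A n) x :: 'k) = L1norm M (chi ((\<Union>n. A n) - A n) :: 'a \<Rightarrow> 'k)"
      unfolding L1norm_def
      by (intro Bochner_Integration.integral_cong) (auto simp: chi_def indicator_def)
    moreover have "measure M ((\<Union>n. A n) - A n) = measure M (\<Union>n. A n) - measure M (A n)"
      using A UA by (intro M.finite_measure_Diff) auto
    ultimately show ?thesis using A UA by (subst (asm) M.L1norm_chi) auto
  qed
  moreover have "(\<lambda>n. measure M (\<Union>n. A n) - measure M (A n)) \<longlonglongrightarrow> measure M (\<Union>n. A n) - measure M (\<Union>n. A n)"
    using A by (intro tendsto_intros M.finite_Lim_measure_incseq) auto
  ultimately show "(\<lambda>n. L1norm M (\<lambda>x. chi (A n) x - chi (\<Union>n. A n) x :: 'k)) \<longlonglongrightarrow> 0" by simp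
qed (use A in auto)

lemma L1_operator_cutoff:
  assumes B: "B \<in> sets N"
  shows "L1_operator M N (\<lambda>f. cutoff B (t f)) C"
proof unfold_locales
  fix f g :: "'a \<Rightarrow> 'k" and c :: 'k assume f: "integrable M f"
  show "integrable N (cutoff B (t f))" using f B by auto
  show "AE x in N. cutoff B (t (\<lambda>x. c * f x)) x = c * cutoff B (t f) x"
    using t_scale[OF f, of c] by eventually_elim (simp add: cutoff_def)
  show "L1norm N (cutoff B (t f)) \<le> C * L1norm M f"
    using L1norm_cutoff_le[OF integrable_t[OF f] B] t_bound[OF f] by simp
  assume g: "integrable M g"
  show "AE x in N. cutoff B (t (\<lambda>x. f x + g x)) x = cutoff B (t f) x + cutoff B (t g) x"
    using t_add[OF f g] by eventually_elim (simp add: cutoff_def algebra_simps)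
qed (rule C_nonneg)

text \<open>The set of small oscillation can be found inside \<open>E\<close> without losing the size of the average: after
  removal of a maximal subset with small average, every remaining subset of positive measure has a
  large one.\<close>

lemma small_oscillation_large:
  assumes osc: "small_oscillation M N t" and E: "E \<in> sets M"
    and large: "c * measure M E < L1norm N (t (chi E))" and "0 < \<epsilon>"
  obtains A y where "A \<in> sets M" "A \<subseteq> E" "0 < measure M A" "integrable N y"
    "c * measure M A < L1norm N (t (chi A))"
    "\<And>H. H \<in> sets M \<Longrightarrow> H \<subseteq> A \<Longrightarrow>
      L1norm N (\<lambda>x. t (chi H) x - of_real (measure M H) * y x) \<le> \<epsilon> * measure M H"
proof -
  define F where "F = {G \<in> sets M. G \<subseteq> E \<and> L1norm N (t (chi G)) \<le> c * measure M G}"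
  have "{} \<in> F" using t_chi_null[of "{}"] by (auto simp: F_def)
  have union: "(\<Union>n. G n) \<in> F" if G: "incseq G" "range G \<subseteq> F" for G :: "nat \<Rightarrow> 'a set"
  proof -
    have Gm: "\<And>n. G n \<in> sets M" and le: "\<And>n. L1norm N (t (chi (G n))) \<le> c * measure M (G n)"
      using G by (auto simp: F_def)
    have "(\<lambda>n. c * measure M (G n)) \<longlonglongrightarrow> c * measure M (\<Union>n. G n)"
      using G Gm by (intro tendsto_intros M.finite_Lim_measure_incseq) auto
    with t_chi_incseq[OF Gm G(1)] have "L1norm N (t (chi (\<Union>n. G n))) \<le> c * measure M (\<Union>n. G n)"
      using le by (intro LIMSEQ_le) auto
    then show ?thesis using G Gm by (auto simp: F_def)
  qed
  \<comment> \<open>The part of \<open>E\<close> outside a maximal such \<open>G\<close> contains no further subset of small average.\<close>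
  have "F \<subseteq> sets M" by (auto simp: F_def)
  then have "\<exists>G\<in>F. {} \<subseteq> G \<and> (\<forall>D\<in>F. G \<subseteq> D \<longrightarrow> measure M D = measure M G)"
    using \<open>{} \<in> F\<close> union by (rule M.exists_maximal_in_family)
  then obtain G where G: "G \<in> F"
    and max: "\<And>D. D \<in> F \<Longrightarrow> G \<subseteq> D \<Longrightarrow> measure M D = measure M G"
    by blast
  have Gm: "G \<in> sets M" "G \<subseteq> E" using G by (auto simp: F_def)
  have E': "E - G \<in> sets M" using E Gm by auto
  have split: "G \<union> (E - G) = E" using Gm by auto
  have "0 < measure M (E - G)"
  proof (rule ccontr)
    assume "\<not> 0 < measure M (E - G)"
    then have 0: "measure M (E - G) = 0" using measure_nonneg[of M "E - G"] by linarith
    then have "measure M E = measure M G" using M.finite_measure_Diff[OF E Gm(1)] Gm(2) by simp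
    moreover have "L1norm N (t (chi E)) \<le> L1norm N (t (chi G))"
      using L1norm_t_chi_Un[OF Gm(1) E'] t_chi_null[OF E' 0] unfolding split by auto
    ultimately show False using G large by (auto simp: F_def)
  qed
  from small_oscillationE[OF osc E' this \<open>0 < \<epsilon>\<close>]
  obtain A y where A: "A \<in> sets M" "A \<subseteq> E - G" "0 < measure M A" "integrable N y"
    "\<And>H. H \<in> sets M \<Longrightarrow> H \<subseteq> A \<Longrightarrow>
      L1norm N (\<lambda>x. t (chi H) x - of_real (measure M H) * y x) \<le> \<epsilon> * measure M H"
    by blast
  have meas: "measure M (G \<union> A) = measure M G + measure M A"
    using Gm A by (intro M.finite_measure_Union) auto
  have "c * measure M A < L1norm N (t (chi A))"
  proof (rule ccontr)
    assume "\<not> c * measure M A < L1norm N (t (chi A))"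
    then have "L1norm N (t (chi (G \<union> A))) \<le> c * measure M (G \<union> A)"
      using order_trans[OF L1norm_t_chi_Un[OF Gm(1) A(1)]] A(2) G
      unfolding meas by (force simp: F_def algebra_simps)
    then have "G \<union> A \<in> F" using Gm A by (auto simp: F_def)
    then show False using max[of "G \<union> A"] meas A(3) by auto
  qed
  then show ?thesis using A by (intro that[of A y]) auto
qed

end

lemma (in finite_measure) purely_atomicE:
  assumes "purely_atomic M" "E \<in> sets M" "0 < measure M E"
  obtains A where "A \<subseteq> E" "atom M A"
  using assms unfolding purely_atomic_def by (auto simp: emeasure_eq_measure)

lemma (in finite_measure) atom_measure:
  assumes "atom M A"
  shows "A \<in> sets M" "0 < measure M A"
    "\<And>B. B \<in> sets M \<Longrightarrow> B \<subseteq> A \<Longrightarrow> measure M B = 0 \<or> measure M B = measure M A"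
  using assms by (auto simp: atom_def emeasure_eq_measure)

text \<open>A subset of an atom is null or almost all of it, so on an atom there is only one average.\<close>

lemma (in L1_operator) small_oscillation_atomic_domain:
  assumes "purely_atomic M"
  shows "small_oscillation M N t"
proof (rule small_oscillationI)
  fix E and \<epsilon> :: real assume E: "E \<in> sets M" "0 < measure M E" "0 < \<epsilon>"
  obtain A where "A \<subseteq> E" and "atom M A" using M.purely_atomicE[OF assms E(1,2)] .
  note A = M.atom_measure[OF \<open>atom M A\<close>]
  define y where "y x = of_real (1 / measure M A) * t (chi A) x" for x
  have y: "integrable N y" unfolding y_def using A by auto
  have "L1norm N (\<lambda>x. t (chi H) x - of_real (measure M H) * y x) = 0"
    if H: "H \<in> sets M" "H \<subseteq> A" for H
  proof (cases "measure M H = 0")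
    case True
    then show ?thesis using t_chi_null[OF H(1)] by simp
  next
    case False
    then have eq: "measure M H = measure M A" using A(3) H by auto
    then have 0: "measure M (A - H) = 0" using M.finite_measure_Diff[OF A(1) H(1,2)] by simp
    have AH: "A - H \<in> sets M" "H \<union> (A - H) = A" using A(1) H by auto
    have "AE x in N. t (chi (A - H)) x = 0"
      using t_chi_null[OF AH(1) 0] AH by (intro L1norm_eq_0) auto
    moreover have "AE x in N. t (chi A) x = t (chi H) x + t (chi (A - H)) x"
      using t_chi_Un[OF H(1) AH(1)] unfolding AH(2) by auto
    ultimately have "AE x in N. t (chi H) x - of_real (measure M H) * y x = 0"
      by eventually_elim (use A(2) in \<open>simp add: y_def eq\<close>)
    then have "L1norm N (\<lambda>x. t (chi H) x - of_real (measure M H) * y x) = L1norm N (\<lambda>_. 0::'k)"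
      using H y by (intro L1norm_cong_AE) auto
    then show ?thesis by (simp add: L1norm_def)
  qed
  then show "\<exists>A y. A \<in> sets M \<and> A \<subseteq> E \<and> 0 < measure M A \<and> integrable N y \<and>
       (\<forall>H\<in>sets M. H \<subseteq> A \<longrightarrow>
         L1norm N (\<lambda>x. t (chi H) x - of_real (measure M H) * y x) \<le> \<epsilon> * measure M H)"
    using A \<open>A \<subseteq> E\<close> y E by (intro exI[of _ A] exI[of _ y]) auto
qed

lemma (in L1_operator) small_oscillation_Un:
  assumes B: "B1 \<in> sets N" "B2 \<in> sets N" "B1 \<inter> B2 = {}"
    and osc: "small_oscillation M N (\<lambda>f. cutoff B1 (t f))" "small_oscillation M N (\<lambda>f. cutoff B2 (t f))"
  shows "small_oscillation M N (\<lambda>f. cutoff (B1 \<union> B2) (t f))"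
proof (rule small_oscillationI)
  fix E and \<epsilon> :: real assume E: "E \<in> sets M" "0 < measure M E" "0 < \<epsilon>"
  then have "0 < \<epsilon> / 2" by simp
  obtain A1 y1 where A1: "A1 \<in> sets M" "A1 \<subseteq> E" "0 < measure M A1" "integrable N y1"
    "\<And>H. H \<in> sets M \<Longrightarrow> H \<subseteq> A1 \<Longrightarrow>
      L1norm N (\<lambda>x. cutoff B1 (t (chi H)) x - of_real (measure M H) * y1 x) \<le> \<epsilon> / 2 * measure M H"
    by (fact small_oscillationE[OF osc(1) E(1,2) \<open>0 < \<epsilon> / 2\<close>])
  obtain A2 y2 where A2: "A2 \<in> sets M" "A2 \<subseteq> A1" "0 < measure M A2" "integrable N y2"
    "\<And>H. H \<in> sets M \<Longrightarrow> H \<subseteq> A2 \<Longrightarrow>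
      L1norm N (\<lambda>x. cutoff B2 (t (chi H)) x - of_real (measure M H) * y2 x) \<le> \<epsilon> / 2 * measure M H"
    by (fact small_oscillationE[OF osc(2) A1(1,3) \<open>0 < \<epsilon> / 2\<close>])
  have "L1norm N (\<lambda>x. cutoff (B1 \<union> B2) (t (chi H)) x - of_real (measure M H) * (y1 x + y2 x))
      \<le> \<epsilon> * measure M H" if H: "H \<in> sets M" "H \<subseteq> A2" for H
  proof -
    have eq: "cutoff (B1 \<union> B2) (t (chi H)) x - of_real (measure M H) * (y1 x + y2 x) =
        (cutoff B1 (t (chi H)) x - of_real (measure M H) * y1 x) +
        (cutoff B2 (t (chi H)) x - of_real (measure M H) * y2 x)" for x
      using B(3) by (auto simp: cutoff_def indicator_def algebra_simps)
    have "L1norm N (\<lambda>x. (cutoff B1 (t (chi H)) x - of_real (measure M H) * y1 x) +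
        (cutoff B2 (t (chi H)) x - of_real (measure M H) * y2 x)) \<le>
        \<epsilon> / 2 * measure M H + \<epsilon> / 2 * measure M H"
      using A1 A2 B H by (intro order_trans[OF L1norm_add] add_mono) auto
    then show ?thesis unfolding eq by (simp add: field_simps)
  qed
  then show "\<exists>A y. A \<in> sets M \<and> A \<subseteq> E \<and> 0 < measure M A \<and> integrable N y \<and>
       (\<forall>H\<in>sets M. H \<subseteq> A \<longrightarrow>
         L1norm N (\<lambda>x. cutoff (B1 \<union> B2) (t (chi H)) x - of_real (measure M H) * y x) \<le> \<epsilon> * measure M H)"
    using A1 A2 by (intro exI[of _ A2] exI[of _ "\<lambda>x. y1 x + y2 x"]) auto
qed

text \<open>The step from finite to countable dimension. On a set \<open>F\<close> where the average of the operator cut to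
  \<open>\<Union>n. B n\<close> nearly has the largest possible norm \<open>s\<close>, some \<open>B n\<close> already carries almost all of that
  norm. Since norms over disjoint sets add up in \<open>L\<^sub>1\<close>, little is left for the part outside \<open>B n\<close>, and
  it suffices to control the part inside.\<close>

lemma (in L1_operator) small_oscillation_incseq:
  assumes B: "\<And>n. B n \<in> sets N" "incseq B"
    and osc: "\<And>n. small_oscillation M N (\<lambda>f. cutoff (B n) (t f))"
  shows "small_oscillation M N (\<lambda>f. cutoff (\<Union>n. B n) (t f))"
proof (rule small_oscillationI)
  fix E and \<epsilon> :: real assume E: "E \<in> sets M" "0 < measure M E" "0 < \<epsilon>"
  define U where "U = (\<Union>n. B n)"
  have U: "U \<in> sets N" using B by (auto simp: U_def)
  \<comment> \<open>The part outside \<open>B n\<close> contributes \<open>3 * \<delta>\<close>, the oscillation inside it \<open>\<delta>\<close>.\<close>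
  define \<delta> where "\<delta> = \<epsilon> / 4"
  have \<delta>: "0 < \<delta>" using E by (simp add: \<delta>_def)
  define q where "q F = L1norm N (cutoff U (t (chi F))) / measure M F" for F
  define FF where "FF = {F \<in> sets M. F \<subseteq> E \<and> 0 < measure M F}"
  define s where "s = (SUP F\<in>FF. q F)"
  interpret u: L1_operator M N "\<lambda>f. cutoff U (t f)" C using L1_operator_cutoff[OF U] .
  have bdd: "bdd_above (q ` FF)"
    using u.t_chi_bound by (intro bdd_aboveI2[of _ _ C]) (auto simp: q_def FF_def divide_le_eq)
  have le_s: "L1norm N (cutoff U (t (chi F))) \<le> s * measure M F" if "F \<in> sets M" "F \<subseteq> E" for F
  proof (cases "measure M F = 0")
    case True
    then show ?thesis using u.t_chi_null[OF that(1)] by simp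
  next
    case False
    then have pos: "0 < measure M F" using measure_nonneg[of M F] by linarith
    then have "q F \<le> s" unfolding s_def using that by (intro cSUP_upper bdd) (auto simp: FF_def)
    then show ?thesis using pos by (simp add: q_def divide_le_eq)
  qed
  have "FF \<noteq> {}" using E by (auto simp: FF_def)
  moreover have "s - \<delta> < s" using \<delta> by simp
  ultimately obtain F where "F \<in> FF" "s - \<delta> < q F"
    unfolding s_def by (subst (asm) less_cSUP_iff[OF _ bdd]) auto
  then have F: "F \<in> sets M" "F \<subseteq> E" "(s - \<delta>) * measure M F < L1norm N (cutoff U (t (chi F)))"
    by (auto simp: FF_def q_def less_divide_eq)
  have "(\<lambda>n. L1norm N (cutoff (B n) (t (chi F)))) \<longlonglongrightarrow> L1norm N (cutoff U (t (chi F)))"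
    unfolding U_def using F B by (intro L1norm_cutoff_tendsto) auto
  from order_tendstoD(1)[OF this F(3)]
  obtain n where n: "(s - \<delta>) * measure M F < L1norm N (cutoff (B n) (t (chi F)))"
    by (auto simp: eventually_sequentially)
  interpret b: L1_operator M N "\<lambda>f. cutoff (B n) (t f)" C using L1_operator_cutoff[OF B(1)] .
  obtain A y where A: "A \<in> sets M" "A \<subseteq> F" "0 < measure M A" "integrable N y"
    "(s - \<delta>) * measure M A < L1norm N (cutoff (B n) (t (chi A)))"
    "\<And>H. H \<in> sets M \<Longrightarrow> H \<subseteq> A \<Longrightarrow>
      L1norm N (\<lambda>x. cutoff (B n) (t (chi H)) x - of_real (measure M H) * y x) \<le> \<delta> * measure M H"
    by (fact b.small_oscillation_large[OF osc F(1) n \<delta>])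
  have near: "\<bar>L1norm N (cutoff (B n) (t (chi H))) - measure M H * L1norm N y\<bar> \<le> \<delta> * measure M H"
    if H: "H \<in> sets M" "H \<subseteq> A" for H
  proof -
    have 1: "L1norm N (\<lambda>x. of_real (measure M H) * y x) = measure M H * L1norm N y"
      by (simp add: L1norm_scale)
    show ?thesis
      using L1norm_le_diff[of N "cutoff (B n) (t (chi H))" "\<lambda>x. of_real (measure M H) * y x"]
        L1norm_le_diff[of N "\<lambda>x. of_real (measure M H) * y x" "cutoff (B n) (t (chi H))"]
        A(6)[OF H] 1 H A(4) B(1)
        L1norm_diff_commute[of N "cutoff (B n) (t (chi H))" "\<lambda>x. of_real (measure M H) * y x"]
      by auto
  qed
  have "(s - 2 * \<delta>) * measure M A \<le> L1norm N y * measure M A"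
    using near[of A] A(1,5) by (simp add: algebra_simps abs_le_iff)
  then have y_large: "s - 2 * \<delta> \<le> L1norm N y" using A(3) by simp
  have "L1norm N (\<lambda>x. cutoff U (t (chi H)) x - of_real (measure M H) * y x) \<le> \<epsilon> * measure M H"
    if H: "H \<in> sets M" "H \<subseteq> A" for H
  proof -
    have D: "U - B n \<in> sets N" using U B by auto
    have "B n \<union> (U - B n) = U" by (auto simp: U_def)
    then have "L1norm N (cutoff U (t (chi H))) =
        L1norm N (cutoff (B n) (t (chi H))) + L1norm N (cutoff (U - B n) (t (chi H)))"
      using L1norm_cutoff_Un[of N "t (chi H)" "B n" "U - B n"] H B(1) D by auto
    moreover have "L1norm N (cutoff U (t (chi H))) \<le> s * measure M H" using H A F by (intro le_s) auto
    moreover have "(s - 2 * \<delta>) * measure M H \<le> L1norm N y * measure M H"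
      using y_large by (intro mult_right_mono) auto
    ultimately have rest: "L1norm N (cutoff (U - B n) (t (chi H))) \<le> 3 * \<delta> * measure M H"
      using near[OF H] by (simp add: algebra_simps abs_le_iff)
    have eq: "cutoff U (t (chi H)) x - of_real (measure M H) * y x =
        cutoff (U - B n) (t (chi H)) x + (cutoff (B n) (t (chi H)) x - of_real (measure M H) * y x)" for x
      by (auto simp: cutoff_def indicator_def U_def)
    have "L1norm N (\<lambda>x. cutoff (U - B n) (t (chi H)) x +
        (cutoff (B n) (t (chi H)) x - of_real (measure M H) * y x)) \<le>
        3 * \<delta> * measure M H + \<delta> * measure M H"
      using rest A(6)[OF H] A(4) B(1) D H by (intro order_trans[OF L1norm_add] add_mono) auto
    then show ?thesis unfolding eq by (simp add: \<delta>_def)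
  qed
  then show "\<exists>A y. A \<in> sets M \<and> A \<subseteq> E \<and> 0 < measure M A \<and> integrable N y \<and>
       (\<forall>H\<in>sets M. H \<subseteq> A \<longrightarrow>
         L1norm N (\<lambda>x. cutoff (\<Union>n. B n) (t (chi H)) x - of_real (measure M H) * y x) \<le> \<epsilon> * measure M H)"
    unfolding U_def[symmetric] using A F by (intro exI[of _ A] exI[of _ y]) auto
qed

section \<open>Small oscillation into a purely atomic space\<close>

text \<open>The core of the Radon-Nikodym theorem, in one dimension. Let \<open>s\<close> be the supremum of the averages
  over subsets of \<open>E\<close> and take a set whose average exceeds \<open>s - \<epsilon>\<close>. Removing a maximal subset with
  average at most \<open>s - \<epsilon>\<close> leaves a set all of whose subsets have averages between \<open>s - \<epsilon>\<close> and \<open>s\<close>.\<close>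

lemma (in finite_measure) additive_small_oscillation:
  fixes \<phi> :: "'a set \<Rightarrow> real"
  assumes add: "\<And>A B. A \<in> sets M \<Longrightarrow> B \<in> sets M \<Longrightarrow> A \<inter> B = {} \<Longrightarrow> \<phi> (A \<union> B) = \<phi> A + \<phi> B"
    and bound: "\<And>A. A \<in> sets M \<Longrightarrow> \<bar>\<phi> A\<bar> \<le> C * measure M A"
    and E: "E \<in> sets M" "0 < measure M E" and "0 < \<epsilon>"
  shows "\<exists>A c. A \<in> sets M \<and> A \<subseteq> E \<and> 0 < measure M A \<and>
    (\<forall>H\<in>sets M. H \<subseteq> A \<longrightarrow> \<bar>\<phi> H - c * measure M H\<bar> \<le> \<epsilon> * measure M H)"
proof -
  define FF where "FF = {F \<in> sets M. F \<subseteq> E \<and> 0 < measure M F}"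
  define s where "s = (SUP F\<in>FF. \<phi> F / measure M F)"
  have null: "\<phi> A = 0" if "A \<in> sets M" "measure M A = 0" for A using bound[OF that(1)] that by simp
  have bdd: "bdd_above ((\<lambda>F. \<phi> F / measure M F) ` FF)"
  proof (rule bdd_aboveI2[of _ _ C])
    fix F assume "F \<in> FF"
    then show "\<phi> F / measure M F \<le> C" using bound[of F] by (auto simp: FF_def divide_le_eq)
  qed
  have le_s: "\<phi> F \<le> s * measure M F" if "F \<in> sets M" "F \<subseteq> E" for F
  proof (cases "measure M F = 0")
    case True
    then show ?thesis using null[OF that(1)] by simp
  next
    case False
    then have pos: "0 < measure M F" using measure_nonneg[of M F] by linarith
    then have "\<phi> F / measure M F \<le> s"
      unfolding s_def using that by (intro cSUP_upper bdd) (auto simp: FF_def)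
    then show ?thesis using pos by (simp add: divide_le_eq)
  qed
  have "FF \<noteq> {}" using E by (auto simp: FF_def)
  moreover have "s - \<epsilon> < s" using \<open>0 < \<epsilon>\<close> by simp
  ultimately obtain F where "F \<in> FF" "s - \<epsilon> < \<phi> F / measure M F"
    unfolding s_def by (subst (asm) less_cSUP_iff[OF _ bdd]) auto
  then have F: "F \<in> sets M" "F \<subseteq> E" "(s - \<epsilon>) * measure M F < \<phi> F"
    by (auto simp: FF_def less_divide_eq)
  define K where "K = {G \<in> sets M. G \<subseteq> F \<and> \<phi> G \<le> (s - \<epsilon>) * measure M G}"
  have "{} \<in> K" using null[of "{}"] by (auto simp: K_def)
  have union: "(\<Union>n. G n) \<in> K" if G: "incseq G" "range G \<subseteq> K" for G :: "nat \<Rightarrow> 'a set"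
  proof -
    define U where "U = (\<Union>n. G n)"
    have Gm: "\<And>n. G n \<in> sets M" and le: "\<And>n. \<phi> (G n) \<le> (s - \<epsilon>) * measure M (G n)"
      using G by (auto simp: K_def)
    have U: "U \<in> sets M" using Gm by (auto simp: U_def)
    have lim: "(\<lambda>n. measure M (G n)) \<longlonglongrightarrow> measure M U"
      unfolding U_def using G Gm by (intro finite_Lim_measure_incseq) auto
    have "\<phi> U \<le> (s - \<epsilon>) * measure M (G n) + C * (measure M U - measure M (G n))" for n
    proof -
      have "G n \<union> (U - G n) = U" by (auto simp: U_def)
      then have "\<phi> U = \<phi> (G n) + \<phi> (U - G n)" using add[of "G n" "U - G n"] Gm U by auto
      moreover have "measure M (U - G n) = measure M U - measure M (G n)"
        using U Gm by (intro finite_measure_Diff) (auto simp: U_def)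
      ultimately show ?thesis using le[of n] bound[of "U - G n"] U Gm by auto
    qed
    moreover have "(\<lambda>n. (s - \<epsilon>) * measure M (G n) + C * (measure M U - measure M (G n))) \<longlonglongrightarrow>
        (s - \<epsilon>) * measure M U + C * (measure M U - measure M U)"
      by (intro tendsto_intros lim)
    ultimately have "\<phi> U \<le> (s - \<epsilon>) * measure M U + C * (measure M U - measure M U)"
      by (intro LIMSEQ_le_const) auto
    then show ?thesis using U G by (auto simp: K_def U_def)
  qed
  have "K \<subseteq> sets M" by (auto simp: K_def)
  then have "\<exists>G\<in>K. {} \<subseteq> G \<and> (\<forall>D\<in>K. G \<subseteq> D \<longrightarrow> measure M D = measure M G)"
    using \<open>{} \<in> K\<close> union by (rule exists_maximal_in_family)
  then obtain G where G: "G \<in> K"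
    and max: "\<And>D. D \<in> K \<Longrightarrow> G \<subseteq> D \<Longrightarrow> measure M D = measure M G"
    by blast
  have Gm: "G \<in> sets M" "G \<subseteq> F" "\<phi> G \<le> (s - \<epsilon>) * measure M G" using G by (auto simp: K_def)
  have A: "F - G \<in> sets M" "G \<union> (F - G) = F" using F Gm by auto
  show ?thesis
  proof (intro exI[of _ "F - G"] exI[of _ s] conjI ballI impI)
    show "F - G \<in> sets M" "F - G \<subseteq> E" using A F by auto
    show "0 < measure M (F - G)"
    proof (rule ccontr)
      assume "\<not> 0 < measure M (F - G)"
      then have 0: "measure M (F - G) = 0" using measure_nonneg[of M "F - G"] by linarith
      then have "measure M F = measure M G" using finite_measure_Diff[OF F(1) Gm(1)] Gm(2) by simp
      moreover have "\<phi> F = \<phi> G + \<phi> (F - G)" using add[OF Gm(1) A(1)] unfolding A(2) by auto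
      ultimately show False using Gm F(3) null[OF A(1) 0] by simp
    qed
    fix H assume H: "H \<in> sets M" "H \<subseteq> F - G"
    have "(s - \<epsilon>) * measure M H \<le> \<phi> H"
    proof (rule ccontr)
      assume less: "\<not> (s - \<epsilon>) * measure M H \<le> \<phi> H"
      have meas: "measure M (G \<union> H) = measure M G + measure M H"
        using Gm H by (intro finite_measure_Union) auto
      have "\<phi> (G \<union> H) = \<phi> G + \<phi> H" using Gm H by (intro add) auto
      then have "G \<union> H \<in> K" using Gm H less meas by (auto simp: K_def algebra_simps)
      then have "measure M H = 0" using max[of "G \<union> H"] meas by auto
      then show False using less null[OF H(1)] by simp
    qed
    moreover have "\<phi> H \<le> s * measure M H" using H F by (intro le_s) auto
    ultimately show "\<bar>\<phi> H - s * measure M H\<bar> \<le> \<epsilon> * measure M H" using \<open>0 < \<epsilon>\<close>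
      by (auto simp: algebra_simps abs_le_iff intro: order_trans)
  qed
qed

text \<open>The coordinates are treated one after the other, each on a subset of the set found before; small
  oscillation is inherited by subsets.\<close>

lemma (in finite_measure) additive_small_oscillation_vector:
  fixes \<phi> :: "'a set \<Rightarrow> 'k::euclidean_space"
  assumes add: "\<And>A B. A \<in> sets M \<Longrightarrow> B \<in> sets M \<Longrightarrow> A \<inter> B = {} \<Longrightarrow> \<phi> (A \<union> B) = \<phi> A + \<phi> B"
    and bound: "\<And>A. A \<in> sets M \<Longrightarrow> norm (\<phi> A) \<le> C * measure M A"
    and E: "E \<in> sets M" "0 < measure M E" and "0 < \<epsilon>"
  shows "\<exists>A v. A \<in> sets M \<and> A \<subseteq> E \<and> 0 < measure M A \<and>
    (\<forall>H\<in>sets M. H \<subseteq> A \<longrightarrow> norm (\<phi> H - measure M H *\<^sub>R v) \<le> \<epsilon> * measure M H)"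
proof -
  define \<delta> where "\<delta> = \<epsilon> / DIM('k)"
  have \<delta>: "0 < \<delta>" using \<open>0 < \<epsilon>\<close> by (simp add: \<delta>_def)
  have "\<exists>A c. A \<in> sets M \<and> A \<subseteq> E \<and> 0 < measure M A \<and> (\<forall>b\<in>I. \<forall>H\<in>sets M. H \<subseteq> A \<longrightarrow>
      \<bar>\<phi> H \<bullet> b - c b * measure M H\<bar> \<le> \<delta> * measure M H)" if "I \<subseteq> Basis" for I :: "'k set"
    using finite_subset[OF that finite_Basis] that
  proof (induction I rule: finite_induct)
    case empty
    then show ?case using E by (intro exI[of _ E]) auto
  next
    case (insert i I)
    have "I \<subseteq> Basis" using insert by auto
    from insert.IH[OF this] obtain A c where A: "A \<in> sets M" "A \<subseteq> E" "0 < measure M A"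
      "\<forall>b\<in>I. \<forall>H\<in>sets M. H \<subseteq> A \<longrightarrow> \<bar>\<phi> H \<bullet> b - c b * measure M H\<bar> \<le> \<delta> * measure M H"
      by (elim exE conjE)
    have i: "i \<in> Basis" using insert by auto
    have bd: "\<bar>\<phi> H \<bullet> i\<bar> \<le> C * measure M H" if "H \<in> sets M" for H
      using Basis_le_norm[OF i, of "\<phi> H"] bound[OF that] by simp
    have "\<exists>A' d. A' \<in> sets M \<and> A' \<subseteq> A \<and> 0 < measure M A' \<and>
        (\<forall>H\<in>sets M. H \<subseteq> A' \<longrightarrow> \<bar>\<phi> H \<bullet> i - d * measure M H\<bar> \<le> \<delta> * measure M H)"
      using bd A(1,3) \<delta>
      by (intro additive_small_oscillation[of "\<lambda>H. \<phi> H \<bullet> i" C A \<delta>]) (auto simp: add inner_add_left)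
    then obtain A' d where A': "A' \<in> sets M" "A' \<subseteq> A" "0 < measure M A'"
      "\<forall>H\<in>sets M. H \<subseteq> A' \<longrightarrow> \<bar>\<phi> H \<bullet> i - d * measure M H\<bar> \<le> \<delta> * measure M H"
      by (elim exE conjE)
    show ?case
    proof (intro exI[of _ A'] exI[of _ "c(i := d)"] conjI ballI impI)
      fix b H assume "b \<in> insert i I" "H \<in> sets M" "H \<subseteq> A'"
      then show "\<bar>\<phi> H \<bullet> b - (c(i := d)) b * measure M H\<bar> \<le> \<delta> * measure M H"
        using A'(2,4) A(4) by auto
    qed (use A A' in auto)
  qed
  from this[OF subset_refl] obtain A c where A: "A \<in> sets M" "A \<subseteq> E" "0 < measure M A"
    "\<forall>b\<in>Basis. \<forall>H\<in>sets M. H \<subseteq> A \<longrightarrow> \<bar>\<phi> H \<bullet> b - c b * measure M H\<bar> \<le> \<delta> * measure M H"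
    by (elim exE conjE)
  define v where "v = (\<Sum>b\<in>Basis. c b *\<^sub>R b)"
  have v: "v \<bullet> b = c b" if "b \<in> Basis" for b using that by (simp add: v_def)
  show ?thesis
  proof (intro exI[of _ A] exI[of _ v] conjI ballI impI A(1-3))
    fix H assume H: "H \<in> sets M" "H \<subseteq> A"
    have "norm (\<phi> H - measure M H *\<^sub>R v) \<le> (\<Sum>b\<in>Basis. \<bar>(\<phi> H - measure M H *\<^sub>R v) \<bullet> b\<bar>)"
      by (rule norm_le_l1)
    also have "\<dots> \<le> (\<Sum>b\<in>(Basis::'k set). \<delta> * measure M H)"
      using A(4) H by (intro sum_mono) (simp add: v inner_diff_left mult.commute)
    also have "\<dots> = \<epsilon> * measure M H" by (simp add: \<delta>_def)
    finally show "norm (\<phi> H - measure M H *\<^sub>R v) \<le> \<epsilon> * measure M H" .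
  qed
qed

text \<open>The two functions have the same integral over every measurable set: a measurable set meets the atom
  in a null set or contains almost all of it.\<close>

lemma (in finite_measure) constant_on_atom:
  fixes g :: "'a \<Rightarrow> 'k::{real_normed_field, banach, second_countable_topology}"
  assumes "atom M B" and g: "integrable M g"
  shows "AE x in M. cutoff B g x = (\<integral>x. cutoff B g x \<partial>M) / of_real (measure M B) * chi B x"
proof (rule density_unique_banach)
  note B = atom_measure[OF \<open>atom M B\<close>]
  define c where "c = (\<integral>x. cutoff B g x \<partial>M) / of_real (measure M B)"
  show "integrable M (cutoff B g)" using g B by auto
  show "integrable M (\<lambda>x. (\<integral>x. cutoff B g x \<partial>M) / of_real (measure M B) * chi B x)" using B by auto
  fix D assume D: "D \<in> sets M"
  have DB: "D \<inter> B \<in> sets M" using D B by auto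
  have l: "set_lebesgue_integral M D (cutoff B g) = (\<integral>x. cutoff (D \<inter> B) g x \<partial>M)"
    by (simp add: set_lebesgue_integral_def cutoff_scaleR[symmetric] cutoff_cutoff)
  have r: "set_lebesgue_integral M D (\<lambda>x. c * chi B x) = c * of_real (measure M (D \<inter> B))"
  proof -
    have "(\<lambda>x. indicator D x *\<^sub>R (c * chi B x)) = (\<lambda>x. c * chi (D \<inter> B) x)"
      by (auto simp: chi_def indicator_def)
    then have "set_lebesgue_integral M D (\<lambda>x. c * chi B x) = (\<integral>x. c * chi (D \<inter> B) x \<partial>M)"
      by (simp only: set_lebesgue_integral_def)
    then show ?thesis using DB by simp
  qed
  have "(\<integral>x. cutoff (D \<inter> B) g x \<partial>M) = c * of_real (measure M (D \<inter> B))"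
  proof (cases "measure M (D \<inter> B) = 0")
    case True
    then have "D \<inter> B \<in> null_sets M" using DB by (simp add: null_sets_def emeasure_eq_measure)
    then have "AE x in M. x \<notin> D \<inter> B" by (rule AE_not_in)
    then have "AE x in M. cutoff (D \<inter> B) g x = 0" by eventually_elim (simp add: cutoff_def)
    then show ?thesis using True by (simp add: integral_eq_zero_AE)
  next
    case False
    then have eq: "measure M (D \<inter> B) = measure M B" using B(3)[OF DB] by auto
    then have "measure M (B - D \<inter> B) = 0" using finite_measure_Diff[OF B(1) DB] by simp
    then have "B - D \<inter> B \<in> null_sets M" using DB B(1) by (simp add: null_sets_def emeasure_eq_measure)
    then have "AE x in M. x \<notin> B - D \<inter> B" by (rule AE_not_in)
    then have "AE x in M. cutoff (D \<inter> B) g x = cutoff B g x"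
      by eventually_elim (auto simp: cutoff_def indicator_def)
    then have "(\<integral>x. cutoff (D \<inter> B) g x \<partial>M) = (\<integral>x. cutoff B g x \<partial>M)"
      using g DB B(1) by (intro integral_cong_AE borel_measurable_integrable integrable_cutoff)
    then show ?thesis using B(2) by (simp add: c_def eq)
  qed
  then show "set_lebesgue_integral M D (cutoff B g) = set_lebesgue_integral M D
      (\<lambda>x. (\<integral>x. cutoff B g x \<partial>M) / of_real (measure M B) * chi B x)"
    unfolding c_def[symmetric] l r .
qed

text \<open>On an atom of \<open>N\<close> the operator is a functional with values in the scalars.\<close>

lemma (in L1_operator) small_oscillation_atom:
  assumes "atom N B"
  shows "small_oscillation M N (\<lambda>f. cutoff B (t f))"
proof (rule small_oscillationI)
  fix E and \<epsilon> :: real assume E: "E \<in> sets M" "0 < measure M E" "0 < \<epsilon>"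
  note B = N.atom_measure[OF assms]
  define \<phi> where "\<phi> H = (\<integral>x. cutoff B (t (chi H)) x \<partial>N)" for H
  interpret b: L1_operator M N "\<lambda>f. cutoff B (t f)" C using L1_operator_cutoff[OF B(1)] .
  have bound: "norm (\<phi> H) \<le> C * measure M H" if "H \<in> sets M" for H
    unfolding \<phi>_def using norm_integral_le_L1norm b.t_chi_bound[OF that] by (rule order_trans)
  have add: "\<phi> (A1 \<union> A2) = \<phi> A1 + \<phi> A2" if A: "A1 \<in> sets M" "A2 \<in> sets M" "A1 \<inter> A2 = {}" for A1 A2
  proof -
    have "\<phi> (A1 \<union> A2) = (\<integral>x. cutoff B (t (chi A1)) x + cutoff B (t (chi A2)) x \<partial>N)"
      unfolding \<phi>_def using A
      by (intro integral_cong_AE b.t_chi_Un borel_measurable_integrable) auto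
    then show ?thesis using A by (simp add: \<phi>_def)
  qed
  have "\<exists>A v. A \<in> sets M \<and> A \<subseteq> E \<and> 0 < measure M A \<and>
      (\<forall>H\<in>sets M. H \<subseteq> A \<longrightarrow> norm (\<phi> H - measure M H *\<^sub>R v) \<le> \<epsilon> * measure M H)"
    using add bound E by (rule M.additive_small_oscillation_vector)
  then obtain A v where A: "A \<in> sets M" "A \<subseteq> E" "0 < measure M A"
    and osc: "\<forall>H\<in>sets M. H \<subseteq> A \<longrightarrow> norm (\<phi> H - measure M H *\<^sub>R v) \<le> \<epsilon> * measure M H"
    by (elim exE conjE)
  define y where "y x = v / of_real (measure N B) * chi B x" for x
  have y: "integrable N y" unfolding y_def using B by auto
  have "L1norm N (\<lambda>x. cutoff B (t (chi H)) x - of_real (measure M H) * y x) \<le> \<epsilon> * measure M H"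
    if H: "H \<in> sets M" "H \<subseteq> A" for H
  proof -
    have "AE x in N. cutoff B (t (chi H)) x - of_real (measure M H) * y x =
        (\<phi> H - measure M H *\<^sub>R v) / of_real (measure N B) * chi B x"
      using N.constant_on_atom[OF assms integrable_t[OF M.integrable_chi[OF H(1)]]]
      by eventually_elim (simp add: \<phi>_def y_def scaleR_conv_of_real field_simps diff_divide_distrib)
    then have "L1norm N (\<lambda>x. cutoff B (t (chi H)) x - of_real (measure M H) * y x) =
        L1norm N (\<lambda>x. (\<phi> H - measure M H *\<^sub>R v) / of_real (measure N B) * chi B x)"
      using H B y by (intro L1norm_cong_AE) auto
    also have "\<dots> = norm (\<phi> H - measure M H *\<^sub>R v)"
      unfolding L1norm_scale using B by (simp add: norm_divide)
    finally show ?thesis using osc H by simp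
  qed
  then show "\<exists>A y. A \<in> sets M \<and> A \<subseteq> E \<and> 0 < measure M A \<and> integrable N y \<and>
       (\<forall>H\<in>sets M. H \<subseteq> A \<longrightarrow>
         L1norm N (\<lambda>x. cutoff B (t (chi H)) x - of_real (measure M H) * y x) \<le> \<epsilon> * measure M H)"
    using A y by (intro exI[of _ A] exI[of _ y]) auto
qed

text \<open>Sets \<open>B\<close> for which the operator cut to \<open>B\<close> oscillates little include the atoms and are closed under
  disjoint and increasing unions; a maximal one must have full measure, since its complement would
  otherwise contain an atom.\<close>

lemma (in L1_operator) small_oscillation_atomic_range:
  assumes "purely_atomic N"
  shows "small_oscillation M N t"
proof -
  define F where "F = {B \<in> sets N. small_oscillation M N (\<lambda>f. cutoff B (t f))}"
  have "small_oscillation M N (\<lambda>f. cutoff {} (t f))"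
    by (rule small_oscillationI) (auto simp: cutoff_def L1norm_def intro!: exI[of _ "\<lambda>_. 0"])
  then have "{} \<in> F" by (auto simp: F_def)
  have union: "(\<Union>n. B n) \<in> F" if "incseq B" "range B \<subseteq> F" for B :: "nat \<Rightarrow> 'b set"
    using that small_oscillation_incseq[of B] by (auto simp: F_def)
  have "F \<subseteq> sets N" by (auto simp: F_def)
  then have "\<exists>B\<in>F. {} \<subseteq> B \<and> (\<forall>D\<in>F. B \<subseteq> D \<longrightarrow> measure N D = measure N B)"
    using \<open>{} \<in> F\<close> union by (rule N.exists_maximal_in_family)
  then obtain B where B: "B \<in> F"
    and max: "\<And>D. D \<in> F \<Longrightarrow> B \<subseteq> D \<Longrightarrow> measure N D = measure N B"
    by blast
  have Bm: "B \<in> sets N" and osc: "small_oscillation M N (\<lambda>f. cutoff B (t f))"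
    using B by (auto simp: F_def)
  have null: "measure N (space N - B) = 0"
  proof (rule ccontr)
    assume "measure N (space N - B) \<noteq> 0"
    then have "0 < measure N (space N - B)" using measure_nonneg[of N "space N - B"] by linarith
    then obtain D where D: "D \<subseteq> space N - B" "atom N D"
      using N.purely_atomicE[OF assms, of "space N - B"] Bm by blast
    note Dm = N.atom_measure[OF D(2)]
    have "B \<union> D \<in> F" using small_oscillation_Un[OF Bm Dm(1) _ osc small_oscillation_atom[OF D(2)]] D(1) Bm Dm
      by (auto simp: F_def)
    then have "measure N (B \<union> D) = measure N B" using max by auto
    then show False using N.finite_measure_Union[OF Bm Dm(1)] D(1) Dm(2) by auto
  qed
  have "space N - B \<in> null_sets N" using null Bm by (simp add: null_sets_def N.emeasure_eq_measure)
  then have "AE x in N. x \<notin> space N - B" by (rule AE_not_in)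
  then have ae: "AE x in N. x \<in> B" by (simp add: eventually_mono[OF AE_conjI[OF _ AE_space]])
  have eq: "L1norm N (\<lambda>x. cutoff B (t (chi H)) x - of_real (measure M H) * y x) =
      L1norm N (\<lambda>x. t (chi H) x - of_real (measure M H) * y x)"
    if "H \<in> sets M" "integrable N y" for H y
  proof (rule L1norm_cong_AE)
    show "AE x in N. cutoff B (t (chi H)) x - of_real (measure M H) * y x =
        t (chi H) x - of_real (measure M H) * y x"
      using ae by eventually_elim (simp add: cutoff_def)
  qed (use that Bm in auto)
  show ?thesis
  proof (rule small_oscillationI)
    fix E and \<epsilon> :: real assume E: "E \<in> sets M" "0 < measure M E" "0 < \<epsilon>"
    show "\<exists>A y. A \<in> sets M \<and> A \<subseteq> E \<and> 0 < measure M A \<and> integrable N y \<and>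
       (\<forall>H\<in>sets M. H \<subseteq> A \<longrightarrow>
         L1norm N (\<lambda>x. t (chi H) x - of_real (measure M H) * y x) \<le> \<epsilon> * measure M H)"
    proof -
      obtain A y where A: "A \<in> sets M" "A \<subseteq> E" "0 < measure M A" "integrable N y"
        "\<And>H. H \<in> sets M \<Longrightarrow> H \<subseteq> A \<Longrightarrow>
          L1norm N (\<lambda>x. cutoff B (t (chi H)) x - of_real (measure M H) * y x) \<le> \<epsilon> * measure M H"
        by (fact small_oscillationE[OF osc E])
      then show ?thesis using eq[OF _ A(4)] by (intro exI[of _ A] exI[of _ y]) simp
    qed
  qed
qed

section \<open>Operators of small oscillation are limits of range exposing ones\<close>

context L1_operator
begin

text \<open>Small oscillation on \<open>A\<close> says that \<open>t\<close> differs by at most \<open>\<epsilon>\<close> from the rank one operator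
  \<open>f \<mapsto> (\<integral>\<^sub>A f) y\<close> on indicators, hence on all functions supported by \<open>A\<close>.\<close>

lemma near_rank_one:
  assumes osc: "small_oscillation M N t" and c: "c < fun_op_norm M N t"
    and \<epsilon>: "0 < \<epsilon>" and pos: "0 < measure M (space M)"
  shows "\<exists>A y. A \<in> sets M \<and> 0 < measure M A \<and> integrable N y \<and> c - \<epsilon> \<le> L1norm N y \<and>
    (\<forall>f. integrable M f \<longrightarrow>
      L1norm N (\<lambda>x. t (cutoff A f) x - (\<integral>x. cutoff A f x \<partial>M) * y x) \<le> \<epsilon> * L1norm M f)"
proof -
  have "\<exists>E\<in>sets M. c * measure M E < L1norm N (t (chi E))"
  proof (rule ccontr)
    assume neg: "\<not> (\<exists>E\<in>sets M. c * measure M E < L1norm N (t (chi E)))"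
    show False
    proof (cases "0 \<le> c")
      case True
      then have "fun_op_norm M N t \<le> c"
        using neg by (intro fun_op_norm_le bound_from_indicators) (auto simp: not_less)
      then show False using c by simp
    next
      case False
      then have "c * measure M (space M) < 0" using pos by (simp add: mult_neg_pos)
      then have "c * measure M (space M) < L1norm N (t (chi (space M)))"
        using L1norm_nonneg[of N "t (chi (space M))"] by linarith
      then show False using neg by auto
    qed
  qed
  then obtain E where E: "E \<in> sets M" "c * measure M E < L1norm N (t (chi E))" by blast
  obtain A y where A: "A \<in> sets M" "A \<subseteq> E" "0 < measure M A" "integrable N y"
    "c * measure M A < L1norm N (t (chi A))"
    "\<And>H. H \<in> sets M \<Longrightarrow> H \<subseteq> A \<Longrightarrow>
      L1norm N (\<lambda>x. t (chi H) x - of_real (measure M H) * y x) \<le> \<epsilon> * measure M H"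
    by (fact small_oscillation_large[OF osc E \<epsilon>])
  have "L1norm N (t (chi A)) \<le> L1norm N (\<lambda>x. of_real (measure M A) * y x) + \<epsilon> * measure M A"
    using L1norm_le_diff[of N "t (chi A)" "\<lambda>x. of_real (measure M A) * y x"] A(1,4) A(6)[of A]
    by auto
  then have "(c - \<epsilon>) * measure M A \<le> L1norm N y * measure M A"
    using A(5) unfolding L1norm_scale by (simp add: algebra_simps)
  then have y: "c - \<epsilon> \<le> L1norm N y" using A(3) by simp
  define u where "u f x = t (cutoff A f) x - (\<integral>x. cutoff A f x \<partial>M) * y x" for f x
  have u_int: "integrable N (u f)" if "integrable M f" for f
    unfolding u_def using A that by auto
  interpret u: L1_operator M N u "C + L1norm N y"
  proof unfold_locales
    fix f g :: "'a \<Rightarrow> 'k" and a :: 'k assume f: "integrable M f"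
    note fA = integrable_cutoff[OF f A(1)]
    show "integrable N (u f)" using u_int f .
    show "AE x in N. u (\<lambda>x. a * f x) x = a * u f x"
      using t_scale[OF fA, of a] by eventually_elim (simp add: u_def cutoff_scale algebra_simps)
    have "L1norm N (\<lambda>x. (\<integral>x. cutoff A f x \<partial>M) * y x) \<le> L1norm M (cutoff A f) * L1norm N y"
      unfolding L1norm_scale by (intro mult_right_mono norm_integral_le_L1norm) auto
    moreover have "L1norm N (t (cutoff A f)) \<le> C * L1norm M (cutoff A f)" using fA by (rule t_bound)
    moreover have "L1norm N (u f) \<le> L1norm N (t (cutoff A f)) + L1norm N (\<lambda>x. (\<integral>x. cutoff A f x \<partial>M) * y x)"
      using L1norm_add[of N "t (cutoff A f)" "\<lambda>x. - ((\<integral>x. cutoff A f x \<partial>M) * y x)"] fA A(4)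
      by (simp add: u_def[abs_def] L1norm_minus)
    ultimately have "L1norm N (u f) \<le> (C + L1norm N y) * L1norm M (cutoff A f)"
      by (simp add: algebra_simps)
    also have "\<dots> \<le> (C + L1norm N y) * L1norm M f"
      using L1norm_cutoff_le[OF f A(1)] C_nonneg by (intro mult_left_mono) auto
    finally show "L1norm N (u f) \<le> (C + L1norm N y) * L1norm M f" .
    assume g: "integrable M g"
    note gA = integrable_cutoff[OF g A(1)]
    show "AE x in N. u (\<lambda>x. f x + g x) x = u f x + u g x"
      using t_add[OF fA gA] by eventually_elim (use fA gA in \<open>simp add: u_def cutoff_add algebra_simps\<close>)
  qed (use C_nonneg in auto)
  have "L1norm N (u f) \<le> \<epsilon> * L1norm M f" if "integrable M f" for f
  proof (rule u.bound_from_indicators[OF _ _ that])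
    fix H assume H: "H \<in> sets M"
    then have AH: "A \<inter> H \<in> sets M" using A by auto
    have "L1norm N (u (chi H)) \<le> \<epsilon> * measure M (A \<inter> H)"
      using A(6)[of "A \<inter> H"] AH by (simp add: u_def[abs_def] cutoff_chi)
    also have "\<dots> \<le> \<epsilon> * measure M H"
      using \<epsilon> H by (intro mult_left_mono M.finite_measure_mono) auto
    finally show "L1norm N (u (chi H)) \<le> \<epsilon> * measure M H" .
  qed (use \<epsilon> in simp)
  then show ?thesis using A y unfolding u_def by (intro exI[of _ A] exI[of _ y]) auto
qed

text \<open>Outside \<open>A\<close> the operator is unchanged, of norm at most \<open>fun_op_norm M N t\<close>, and on \<open>A\<close> it has rank
  one and larger norm. A norming sequence therefore puts its mass on \<open>A\<close> and has integrals over \<open>A\<close> of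
  modulus tending to \<open>1\<close>; by compactness of the scalar unit ball they converge along a subsequence
  to some \<open>\<theta>\<close>, and then the images tend to \<open>\<theta>\<close> times \<open>z\<close>, the image of \<open>x0\<close>.\<close>

lemma range_exposed_replace:
  assumes A: "A \<in> sets M" "0 < measure M A" and z: "integrable N z" "fun_op_norm M N t < L1norm N z"
  defines "s \<equiv> (\<lambda>f x. t (cutoff (space M - A) f) x + (\<integral>x. cutoff A f x \<partial>M) * z x)"
    and "x0 \<equiv> (\<lambda>x. of_real (1 / measure M A) * chi A x)"
  shows "L1_operator M N s (L1norm N z)" "integrable M x0" "L1norm M x0 = 1" "range_exposed_at M N s x0"
proof -
  define n where "n = fun_op_norm M N t"
  define R where "R = L1norm N z"
  define a where "a f = (\<integral>x. cutoff A f x \<partial>M)" for f :: "'a \<Rightarrow> 'k"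
  have n: "0 \<le> n" "n < R" using fun_op_norm_nonneg z by (auto simp: n_def R_def)
  have Ac: "space M - A \<in> sets M" using A by auto
  have s_int: "integrable N (s f)" if "integrable M f" for f
    unfolding s_def using that Ac z by auto
  have a_le: "norm (a f) \<le> L1norm M (cutoff A f)" for f
    unfolding a_def by (rule norm_integral_le_L1norm)
  have rest: "L1norm N (t (cutoff (space M - A) f)) \<le> n * (L1norm M f - norm (a f))"
    if f: "integrable M f" for f
  proof -
    have "L1norm N (t (cutoff (space M - A) f)) \<le> n * L1norm M (cutoff (space M - A) f)"
      unfolding n_def using f Ac by (intro bound_fun_op_norm) auto
    also have "\<dots> \<le> n * (L1norm M f - norm (a f))"
      using a_le[of f] L1norm_cutoff_compl[OF f A(1)] n by (intro mult_left_mono) auto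
    finally show ?thesis .
  qed
  have s_bound: "L1norm N (s f) \<le> n * (L1norm M f - norm (a f)) + norm (a f) * R"
    if f: "integrable M f" for f
  proof -
    have "L1norm N (s f) \<le> L1norm N (t (cutoff (space M - A) f)) + L1norm N (\<lambda>x. a f * z x)"
      unfolding s_def a_def using f Ac z by (intro L1norm_add) auto
    then show ?thesis using rest[OF f] by (simp add: L1norm_scale R_def)
  qed
  have op: "L1_operator M N s R"
  proof unfold_locales
    fix f g :: "'a \<Rightarrow> 'k" and c :: 'k assume f: "integrable M f"
    note fA = integrable_cutoff[OF f A(1)] and fAc = integrable_cutoff[OF f Ac]
    show "integrable N (s f)" using s_int f .
    show "AE x in N. s (\<lambda>x. c * f x) x = c * s f x"
      using t_scale[OF fAc, of c] by eventually_elim (simp add: s_def cutoff_scale algebra_simps)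
    have "norm (a f) \<le> L1norm M f" using a_le[of f] L1norm_cutoff_le[OF f A(1)] by simp
    then have "n * (L1norm M f - norm (a f)) \<le> R * (L1norm M f - norm (a f))"
      using n by (intro mult_right_mono) auto
    then show "L1norm N (s f) \<le> R * L1norm M f" using s_bound[OF f] by (simp add: algebra_simps)
    assume g: "integrable M g"
    note gA = integrable_cutoff[OF g A(1)] and gAc = integrable_cutoff[OF g Ac]
    show "AE x in N. s (\<lambda>x. f x + g x) x = s f x + s g x"
      using t_add[OF fAc gAc] by eventually_elim (use fA gA in \<open>simp add: s_def cutoff_add algebra_simps\<close>)
  qed (use n in auto)
  then interpret s: L1_operator M N s R .
  show "L1_operator M N s (L1norm N z)" using op by (simp add: R_def)
  show x0: "integrable M x0" unfolding x0_def using A by auto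
  show x0_norm: "L1norm M x0 = 1" unfolding x0_def L1norm_scale using A by (simp add: norm_divide)
  have ax0: "a x0 = 1"
    unfolding a_def x0_def cutoff_scale cutoff_chi using A by simp
  have sx0: "AE x in N. s x0 x = z x"
  proof -
    have "L1norm N (t (cutoff (space M - A) x0)) \<le> 0"
      using rest[OF x0] by (simp add: x0_norm ax0)
    then have "AE x in N. t (cutoff (space M - A) x0) x = 0"
      using x0 Ac by (intro L1norm_eq_0) auto
    then show ?thesis by eventually_elim (use ax0 in \<open>simp add: s_def a_def\<close>)
  qed
  have norm_s: "fun_op_norm M N s = R"
  proof (rule antisym)
    show "fun_op_norm M N s \<le> R" using n by (intro s.fun_op_norm_le s.t_bound) auto
    have "L1norm N (s x0) = R"
      unfolding R_def using sx0 x0 z by (intro L1norm_cong_AE) auto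
    then show "R \<le> fun_op_norm M N s" using s.bound_fun_op_norm[OF x0] by (simp add: x0_norm)
  qed
  show "range_exposed_at M N s x0"
    unfolding range_exposed_at_def
  proof (intro allI impI)
    fix x :: "nat \<Rightarrow> 'a \<Rightarrow> 'k"
    assume x: "\<forall>n. integrable M (x n) \<and> L1norm M (x n) \<le> 1"
      and lim: "(\<lambda>n. L1norm N (s (x n))) \<longlonglongrightarrow> fun_op_norm M N s"
    have a1: "norm (a (x i)) \<le> 1" for i
      using a_le[of "x i"] L1norm_cutoff_le[of M "x i" A] x A by (meson order_trans)
    have low: "1 - (R - L1norm N (s (x i))) / (R - n) \<le> norm (a (x i))" for i
    proof -
      have "L1norm N (s (x i)) \<le> n * (L1norm M (x i) - norm (a (x i))) + norm (a (x i)) * R"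
        using s_bound x by blast
      also have "n * (L1norm M (x i) - norm (a (x i))) \<le> n * (1 - norm (a (x i)))"
        using x n by (intro mult_left_mono) auto
      finally have "(R - n) * (1 - norm (a (x i))) \<le> R - L1norm N (s (x i))"
        by (simp add: algebra_simps)
      then show ?thesis using n by (simp add: field_simps)
    qed
    have "(\<lambda>i. 1 - (R - L1norm N (s (x i))) / (R - n)) \<longlonglongrightarrow> 1 - (R - R) / (R - n)"
      using lim n unfolding norm_s by (intro tendsto_intros) auto
    then have lim_a: "(\<lambda>i. norm (a (x i))) \<longlonglongrightarrow> 1"
      using low a1 by - (rule tendsto_sandwich[OF _ _ _ tendsto_const], auto)
    have "\<forall>i. a (x i) \<in> cball 0 1" using a1 by auto
    then obtain \<theta> \<sigma> where \<sigma>: "strict_mono \<sigma>" and \<theta>: "((\<lambda>i. a (x i)) \<circ> \<sigma>) \<longlonglongrightarrow> \<theta>"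
      using compact_cball[of "0::'k" 1] unfolding compact_def by metis
    have "(\<lambda>i. norm (a (x (\<sigma> i)))) \<longlonglongrightarrow> norm \<theta>" using tendsto_norm[OF \<theta>] by (simp add: o_def)
    moreover have sub: "(\<lambda>i. norm (a (x (\<sigma> i)))) \<longlonglongrightarrow> 1"
      using LIMSEQ_subseq_LIMSEQ[OF lim_a \<sigma>] by (simp add: o_def)
    ultimately have \<theta>1: "norm \<theta> = 1" by (rule LIMSEQ_unique)
    have "L1norm N (\<lambda>w. s (x (\<sigma> i)) w - \<theta> * s x0 w) \<le>
        n * (1 - norm (a (x (\<sigma> i)))) + norm (a (x (\<sigma> i)) - \<theta>) * R" for i
    proof -
      define f where "f = x (\<sigma> i)"
      have f: "integrable M f" "L1norm M f \<le> 1" using x by (auto simp: f_def)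
      have "AE w in N. s f w - \<theta> * s x0 w = t (cutoff (space M - A) f) w + (a f - \<theta>) * z w"
        using sx0 by eventually_elim (simp add: s_def a_def algebra_simps)
      then have "L1norm N (\<lambda>w. s f w - \<theta> * s x0 w) =
          L1norm N (\<lambda>w. t (cutoff (space M - A) f) w + (a f - \<theta>) * z w)"
        using f x0 z Ac by (intro L1norm_cong_AE) auto
      also have "\<dots> \<le> L1norm N (t (cutoff (space M - A) f)) + L1norm N (\<lambda>w. (a f - \<theta>) * z w)"
        using f z Ac by (intro L1norm_add) auto
      also have "\<dots> \<le> n * (L1norm M f - norm (a f)) + norm (a f - \<theta>) * R"
        using rest[OF f(1)] by (simp add: L1norm_scale R_def)
      also have "\<dots> \<le> n * (1 - norm (a f)) + norm (a f - \<theta>) * R"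
        using f n by (intro add_right_mono mult_left_mono) auto
      finally show ?thesis by (simp add: f_def)
    qed
    moreover have "(\<lambda>i. n * (1 - norm (a (x (\<sigma> i)))) + norm (a (x (\<sigma> i)) - \<theta>) * R) \<longlonglongrightarrow>
        n * (1 - 1) + norm (\<theta> - \<theta>) * R"
      using \<theta> sub by (intro tendsto_intros) (auto simp: o_def)
    then have "(\<lambda>i. n * (1 - norm (a (x (\<sigma> i)))) + norm (a (x (\<sigma> i)) - \<theta>) * R) \<longlonglongrightarrow> 0"
      by simp
    ultimately have "(\<lambda>i. L1norm N (\<lambda>w. s (x (\<sigma> i)) w - \<theta> * s x0 w)) \<longlonglongrightarrow> 0"
      by - (rule tendsto_sandwich[OF _ _ tendsto_const], auto)
    with \<sigma> \<theta>1 show "\<exists>\<sigma> \<theta>. strict_mono \<sigma> \<and> norm \<theta> = 1 \<and>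
        (\<lambda>n. L1norm N (\<lambda>w. s (x (\<sigma> n)) w - \<theta> * s x0 w)) \<longlonglongrightarrow> 0"
      by blast
  qed
qed

lemma range_exposed_approx:
  assumes osc: "small_oscillation M N t" and e: "0 < e"
    and pos: "0 < measure M (space M)" "0 < measure N (space N)"
  shows "\<exists>s D x0. L1_operator M N s D \<and> integrable M x0 \<and> L1norm M x0 = 1 \<and> range_exposed_at M N s x0 \<and>
    (\<forall>f. integrable M f \<longrightarrow> L1norm N (\<lambda>x. s f x - t f x) \<le> e * L1norm M f)"
proof -
  define n where "n = fun_op_norm M N t"
  \<comment> \<open>One \<open>\<epsilon>\<close> is the distance of \<open>t\<close> from rank one on \<open>A\<close>, four are the price of lengthening \<open>y\<close>.\<close>
  define \<epsilon> where "\<epsilon> = e / 5"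
  have \<epsilon>: "0 < \<epsilon>" using e by (simp add: \<epsilon>_def)
  have "n - \<epsilon> < fun_op_norm M N t" using \<epsilon> by (simp add: n_def)
  from near_rank_one[OF osc this \<epsilon> pos(1)]
  obtain A y where A: "A \<in> sets M" "0 < measure M A" and y: "integrable N y" "n - \<epsilon> - \<epsilon> \<le> L1norm N y"
    and near: "\<forall>f. integrable M f \<longrightarrow>
      L1norm N (\<lambda>x. t (cutoff A f) x - (\<integral>x. cutoff A f x \<partial>M) * y x) \<le> \<epsilon> * L1norm M f"
    by (elim exE conjE)
  have "measure M A * L1norm N y \<le> (n + \<epsilon>) * measure M A"
  proof -
    have "L1norm N (\<lambda>x. of_real (measure M A) * y x) \<le>
        L1norm N (t (chi A)) + L1norm N (\<lambda>x. of_real (measure M A) * y x - t (chi A) x)"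
      using A y by (intro L1norm_le_diff) auto
    also have "L1norm N (\<lambda>x. of_real (measure M A) * y x - t (chi A) x) \<le> \<epsilon> * measure M A"
      using near[rule_format, of "chi A"] A by (subst L1norm_diff_commute) (simp add: cutoff_chi)
    also have "L1norm N (t (chi A)) \<le> n * measure M A"
      using bound_fun_op_norm[of "chi A"] A by (simp add: n_def)
    finally show ?thesis unfolding L1norm_scale by (simp add: algebra_simps)
  qed
  then have y_le: "L1norm N y \<le> n + \<epsilon>" using A(2) by simp
  define d where "d = n + 2 * \<epsilon> - L1norm N y"
  have d: "0 < d" "d \<le> 4 * \<epsilon>" using y y_le \<epsilon> by (auto simp: d_def)
  \<comment> \<open>\<open>z\<close> prolongs \<open>y\<close> in its own direction, or in any direction if \<open>y\<close> vanishes.\<close>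
  have "\<exists>z. integrable N z \<and> L1norm N z = n + 2 * \<epsilon> \<and> L1norm N (\<lambda>x. z x - y x) = d"
  proof (cases "L1norm N y = 0")
    case True
    define w where "w x = of_real (d / measure N (space N)) * (chi (space N) x :: 'k)" for x
    have w: "integrable N w" unfolding w_def by auto
    have "L1norm N w = d" unfolding w_def L1norm_scale using pos d by (simp add: norm_divide)
    have y0: "AE x in N. y x = 0" using y True by (intro L1norm_eq_0) auto
    then have "L1norm N (\<lambda>x. w x - y x) = L1norm N w" using w y by (intro L1norm_cong_AE) auto
    then show ?thesis using w \<open>L1norm N w = d\<close> True by (intro exI[of _ w]) (auto simp: d_def)
  next
    case False
    then have ypos: "0 < L1norm N y" using L1norm_nonneg[of N y] by linarith
    define z where "z x = of_real ((n + 2 * \<epsilon>) / L1norm N y) * y x" for x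
    have "n + 2 * \<epsilon> > 0" using d ypos by (simp add: d_def)
    then have "L1norm N z = n + 2 * \<epsilon>" unfolding z_def L1norm_scale norm_of_real using ypos by simp
    moreover have "L1norm N (\<lambda>x. z x - y x) = d"
    proof -
      have "(\<lambda>x. z x - y x) = (\<lambda>x. of_real (d / L1norm N y) * y x)"
      proof
        fix x
        have "d / L1norm N y = (n + 2 * \<epsilon>) / L1norm N y - 1" using ypos by (simp add: d_def diff_divide_distrib)
        then show "z x - y x = of_real (d / L1norm N y) * y x"
          by (simp only: z_def of_real_diff left_diff_distrib of_real_1 mult_1)
      qed
      then show ?thesis using ypos d by (simp only: L1norm_scale norm_of_real) simp
    qed
    moreover have "integrable N z" unfolding z_def using y by auto
    ultimately show ?thesis by blast
  qed
  then obtain z where z: "integrable N z" "L1norm N z = n + 2 * \<epsilon>" "L1norm N (\<lambda>x. z x - y x) = d"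
    by blast
  define s where "s = (\<lambda>f x. t (cutoff (space M - A) f) x + (\<integral>x. cutoff A f x \<partial>M) * z x)"
  define x0 :: "'a \<Rightarrow> 'k" where "x0 = (\<lambda>x. of_real (1 / measure M A) * chi A x)"
  have less: "fun_op_norm M N t < L1norm N z" using z \<epsilon> by (simp add: n_def)
  note props = range_exposed_replace[OF A z(1) less, folded s_def x0_def]
  interpret s: L1_operator M N s "L1norm N z" by (fact props)
  have "L1norm N (\<lambda>x. s f x - t f x) \<le> e * L1norm M f" if f: "integrable M f" for f
  proof -
    define a where "a = (\<integral>x. cutoff A f x \<partial>M)"
    have "norm a \<le> L1norm M f"
      unfolding a_def using norm_integral_le_L1norm L1norm_cutoff_le[OF f A(1)] by (rule order_trans)
    have "AE x in N. s f x - t f x = a * (z x - y x) + - (t (cutoff A f) x - a * y x)"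
      using t_cutoff_compl[OF f A(1)] by eventually_elim (simp add: s_def a_def algebra_simps)
    then have "L1norm N (\<lambda>x. s f x - t f x) = L1norm N (\<lambda>x. a * (z x - y x) + - (t (cutoff A f) x - a * y x))"
      using f A y z by (intro L1norm_cong_AE) auto
    also have "\<dots> \<le> L1norm N (\<lambda>x. a * (z x - y x)) + L1norm N (\<lambda>x. - (t (cutoff A f) x - a * y x))"
      using f A y z by (intro L1norm_add) auto
    also have "\<dots> = norm a * d + L1norm N (\<lambda>x. t (cutoff A f) x - a * y x)"
      by (simp only: L1norm_scale L1norm_minus z)
    also have "\<dots> \<le> L1norm M f * (4 * \<epsilon>) + \<epsilon> * L1norm M f"
      using near f d \<open>norm a \<le> L1norm M f\<close> unfolding a_def by (intro add_mono mult_mono) auto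
    also have "\<dots> = e * L1norm M f" by (simp add: \<epsilon>_def)
    finally show ?thesis .
  qed
  with props show ?thesis by blast
qed

end

lemma nonzero_space_L1D:
  assumes "finite_measure M" "nonzero_space (L1 TYPE('k::{real_normed_field, banach, second_countable_topology}) M)"
  shows "0 < measure M (space M)"
proof (rule ccontr)
  assume "\<not> 0 < measure M (space M)"
  then have "measure M (space M) = 0" using measure_nonneg[of M "space M"] by linarith
  then have "space M \<in> null_sets M"
    using assms(1) by (simp add: null_sets_def finite_measure.emeasure_eq_measure)
  then have "AE x in M. x \<notin> space M" by (rule AE_not_in)
  then have ae: "AE x in M. False" using AE_space by eventually_elim simp
  have "L1_class M f = L1_class M g" for f g :: "'a \<Rightarrow> 'k"
    by (rule L1_class_cong) (use ae in eventually_elim, simp)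
  then have "vecs (L1 TYPE('k) M) = {vzero (L1 TYPE('k) M)}"
    unfolding vecs_L1 vzero_L1 by (auto intro!: exI[of _ "\<lambda>_. 0"])
  then show False using assms(2) by (simp add: nonzero_space_def)
qed

theorem RSE_dense_if_purely_atomic:
  fixes M :: "'a measure" and N :: "'b measure"
  assumes fin: "finite_measure M" "finite_measure N"
    and nz: "nonzero_space (L1 TYPE('k::{real_normed_field, euclidean_space}) M)" "nonzero_space (L1 TYPE('k) N)"
    and atomic: "purely_atomic M \<or> purely_atomic N"
  shows "dense_ops (L1 TYPE('k) M) (L1 TYPE('k) N) (RSE (L1 TYPE('k) M) (L1 TYPE('k) N))"
  unfolding dense_ops_def
proof (intro ballI allI impI)
  fix T and e :: real assume T: "T \<in> bounded_ops (L1 TYPE('k) M) (L1 TYPE('k) N)" and e: "0 < e"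
  obtain t C where t: "L1_operator M N t C" and rt: "represents M N T t"
    using bounded_op_represented[OF fin T] by blast
  interpret t: L1_operator M N t C by fact
  have osc: "small_oscillation M N t"
    using atomic t.small_oscillation_atomic_domain t.small_oscillation_atomic_range by blast
  have "0 < e / 2" using e by simp
  from t.range_exposed_approx[OF osc this nonzero_space_L1D[OF fin(1) nz(1)] nonzero_space_L1D[OF fin(2) nz(2)]]
  obtain s D x0 where s: "L1_operator M N s D"
    and x0: "integrable M x0" "L1norm M x0 = 1" "range_exposed_at M N s x0"
    and near: "\<forall>f. integrable M f \<longrightarrow> L1norm N (\<lambda>x. s f x - t f x) \<le> e / 2 * L1norm M f"
    by (elim exE conjE)
  interpret s: L1_operator M N s D by fact
  obtain S where S: "S \<in> bounded_ops (L1 TYPE('k) M) (L1 TYPE('k) N)" and rs: "represents M N S s"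
    using s.lift_op by blast
  note diff = t.op_diff_represented[OF s rs rt]
  interpret d: L1_operator M N "\<lambda>f x. s f x - t f x" "D + C" by (fact diff(1))
  have "op_norm (L1 TYPE('k) M) (L1 TYPE('k) N) (op_diff (L1 TYPE('k) M) (L1 TYPE('k) N) S T) \<le> e / 2"
    unfolding d.op_norm_represented[OF diff(2)] using near e by (intro d.fun_op_norm_le) auto
  moreover have "S \<in> RSE (L1 TYPE('k) M) (L1 TYPE('k) N)"
    using s.RSE_iff_range_exposed[OF S rs] x0 by blast
  ultimately show "\<exists>S\<in>RSE (L1 TYPE('k) M) (L1 TYPE('k) N).
      op_norm (L1 TYPE('k) M) (L1 TYPE('k) N) (op_diff (L1 TYPE('k) M) (L1 TYPE('k) N) S T) < e"
    using e by (intro bexI[of _ S]) auto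
qed

section \<open>Atomless sets and uniformly distributed variables\<close>

context finite_measure
begin

text \<open>A set that is not an atom splits into two parts of positive measure, and the smaller part has at
  most half of the measure; iterate.\<close>

lemma atomless_small_subset:
  assumes atomless: "\<And>B. B \<subseteq> \<Omega> \<Longrightarrow> \<not> atom M B"
    and A: "A \<in> sets M" "A \<subseteq> \<Omega>" "0 < measure M A" and "0 < e"
  shows "\<exists>B\<in>sets M. B \<subseteq> A \<and> 0 < measure M B \<and> measure M B < e"
proof -
  have halve: "\<exists>C\<in>sets M. C \<subseteq> B \<and> 0 < measure M C \<and> measure M C \<le> measure M B / 2"
    if B: "B \<in> sets M" "B \<subseteq> A" "0 < measure M B" for B
  proof -
    have "\<not> atom M B" using atomless B A by blast
    then obtain C where C: "C \<in> sets M" "C \<subseteq> B" "measure M C \<noteq> 0" "measure M C \<noteq> measure M B"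
      using B unfolding atom_def by (auto simp: emeasure_eq_measure)
    have diff: "measure M (B - C) = measure M B - measure M C"
      using finite_measure_Diff[OF B(1) C(1,2)] .
    have "measure M C \<le> measure M B" using C B by (intro finite_measure_mono)
    then show ?thesis
    proof (cases "measure M C \<le> measure M B / 2")
      case True
      then show ?thesis using C by (intro bexI[of _ C]) (auto simp: zero_less_measure_iff)
    next
      case False
      then show ?thesis using C B diff \<open>measure M C \<le> measure M B\<close> by (intro bexI[of _ "B - C"]) auto
    qed
  qed
  have "\<exists>B\<in>sets M. B \<subseteq> A \<and> 0 < measure M B \<and> measure M B \<le> measure M A / 2 ^ n" for n
  proof (induction n)
    case 0
    then show ?case using A by auto
  next
    case (Suc n)
    then obtain B where B: "B \<in> sets M" "B \<subseteq> A" "0 < measure M B" "measure M B \<le> measure M A / 2 ^ n"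
      by blast
    from halve[OF B(1-3)] obtain C where C: "C \<in> sets M" "C \<subseteq> B" "0 < measure M C"
      "measure M C \<le> measure M B / 2" by blast
    have "measure M C \<le> measure M A / 2 ^ Suc n" using C(4) B(4) by simp
    then show ?case using C B by (intro bexI[of _ C]) auto
  qed
  moreover have "\<exists>n. measure M A / 2 ^ n < e"
  proof -
    obtain n where "measure M A / e < 2 ^ n" using real_arch_pow[of 2 "measure M A / e"] by auto
    then show ?thesis using \<open>0 < e\<close> by (auto simp: field_simps)
  qed
  ultimately show ?thesis by (meson le_less_trans)
qed

text \<open>A theorem of Sierpinski. A maximal set of measure at most \<open>r\<close> has measure \<open>r\<close>, as a sufficiently small
  set could be added otherwise.\<close>

lemma atomless_intermediate_value:
  assumes atomless: "\<And>B. B \<subseteq> \<Omega> \<Longrightarrow> \<not> atom M B"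
    and A: "A0 \<in> sets M" "A1 \<in> sets M" "A0 \<subseteq> A1" "A1 \<subseteq> \<Omega>"
    and r: "measure M A0 \<le> r" "r \<le> measure M A1"
  shows "\<exists>C\<in>sets M. A0 \<subseteq> C \<and> C \<subseteq> A1 \<and> measure M C = r"
proof -
  define F where "F = {C \<in> sets M. A0 \<subseteq> C \<and> C \<subseteq> A1 \<and> measure M C \<le> r}"
  have "A0 \<in> F" using A r by (auto simp: F_def)
  have union: "(\<Union>n. G n) \<in> F" if G: "incseq G" "range G \<subseteq> F" for G :: "nat \<Rightarrow> 'a set"
  proof -
    have Gm: "\<And>n. G n \<in> sets M" "\<And>n. measure M (G n) \<le> r" using G by (auto simp: F_def)
    have "(\<lambda>n. measure M (G n)) \<longlonglongrightarrow> measure M (\<Union>n. G n)"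
      using G Gm by (intro finite_Lim_measure_incseq) auto
    then have "measure M (\<Union>n. G n) \<le> r" using Gm(2) by (intro LIMSEQ_le_const2) auto
    then show ?thesis using G Gm by (auto simp: F_def)
  qed
  have "F \<subseteq> sets M" by (auto simp: F_def)
  then have "\<exists>C\<in>F. A0 \<subseteq> C \<and> (\<forall>D\<in>F. C \<subseteq> D \<longrightarrow> measure M D = measure M C)"
    using \<open>A0 \<in> F\<close> union by (rule exists_maximal_in_family)
  then obtain C where C: "C \<in> F" and max: "\<And>D. D \<in> F \<Longrightarrow> C \<subseteq> D \<Longrightarrow> measure M D = measure M C"
    by blast
  have Cm: "C \<in> sets M" "A0 \<subseteq> C" "C \<subseteq> A1" "measure M C \<le> r" using C by (auto simp: F_def)
  have "measure M C = r"
  proof (rule ccontr)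
    assume "measure M C \<noteq> r"
    then have less: "measure M C < r" using Cm by simp
    have "measure M (A1 - C) = measure M A1 - measure M C"
      using finite_measure_Diff[OF A(2) Cm(1,3)] .
    then have "0 < measure M (A1 - C)" using less r by simp
    moreover have "0 < r - measure M C" using less by simp
    moreover have "A1 - C \<in> sets M" "A1 - C \<subseteq> \<Omega>" using A Cm(1) by auto
    ultimately have "\<exists>B\<in>sets M. B \<subseteq> A1 - C \<and> 0 < measure M B \<and> measure M B < r - measure M C"
      using atomless by (intro atomless_small_subset)
    then obtain B where B: "B \<in> sets M" "B \<subseteq> A1 - C" "0 < measure M B" "measure M B < r - measure M C"
      by (elim bexE conjE)
    have meas: "measure M (C \<union> B) = measure M C + measure M B"
      using Cm B by (intro finite_measure_Union) auto
    then have "C \<union> B \<in> F" using Cm B by (auto simp: F_def)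
    from max[OF this] meas B(3) show False by auto
  qed
  then show ?thesis using Cm by blast
qed

end

text \<open>The set with index \<open>k\<close> at level \<open>n\<close> is meant to have the fraction \<open>k / 2 ^ n\<close> of the measure of \<open>\<Omega>\<close>,
  capped at \<open>1\<close>. A level consists of the sets of the previous level, at even indices, and of sets
  halfway between consecutive ones.\<close>

primrec dyadic_chain :: "'a measure \<Rightarrow> 'a set \<Rightarrow> nat \<Rightarrow> nat \<Rightarrow> 'a set" where
  "dyadic_chain M \<Omega> 0 k = (if k = 0 then {} else \<Omega>)"
| "dyadic_chain M \<Omega> (Suc n) k =
    (let A = dyadic_chain M \<Omega> n (k div 2); B = dyadic_chain M \<Omega> n (Suc (k div 2))
     in if even k then A
        else SOME C. C \<in> sets M \<and> A \<subseteq> C \<and> C \<subseteq> B \<and> measure M C = (measure M A + measure M B) / 2)"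

lemma (in finite_measure) dyadic_chain:
  assumes \<Omega>: "\<Omega> \<in> sets M" and atomless: "\<And>B. B \<subseteq> \<Omega> \<Longrightarrow> \<not> atom M B"
  shows "dyadic_chain M \<Omega> n k \<in> sets M" "dyadic_chain M \<Omega> n k \<subseteq> dyadic_chain M \<Omega> n (Suc k)"
    "dyadic_chain M \<Omega> n k \<subseteq> \<Omega>" "measure M (dyadic_chain M \<Omega> n k) = measure M \<Omega> * (min (real k) (2 ^ n) / 2 ^ n)"
proof -
  define a where "a = dyadic_chain M \<Omega>"
  have "\<forall>k. a n k \<in> sets M \<and> a n k \<subseteq> a n (Suc k) \<and> a n k \<subseteq> \<Omega> \<and>
      measure M (a n k) = measure M \<Omega> * (min (real k) (2 ^ n) / 2 ^ n)"
  proof (induction n)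
    case 0
    then show ?case using \<Omega> by (auto simp: a_def min_def)
  next
    case (Suc n)
    have even: "a (Suc n) (2 * j) = a n j" for j by (simp add: a_def)
    define P where "P j C \<longleftrightarrow> C \<in> sets M \<and> a n j \<subseteq> C \<and> C \<subseteq> a n (Suc j) \<and>
        measure M C = (measure M (a n j) + measure M (a n (Suc j))) / 2" for j C
    have odd: "P j (a (Suc n) (Suc (2 * j)))" for j
    proof -
      have "\<exists>C\<in>sets M. a n j \<subseteq> C \<and> C \<subseteq> a n (Suc j) \<and>
          measure M C = (measure M (a n j) + measure M (a n (Suc j))) / 2"
      proof (rule atomless_intermediate_value[OF atomless])
        have "measure M (a n j) \<le> measure M (a n (Suc j))"
          using Suc by (intro finite_measure_mono) auto
        then show "measure M (a n j) \<le> (measure M (a n j) + measure M (a n (Suc j))) / 2"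
          "(measure M (a n j) + measure M (a n (Suc j))) / 2 \<le> measure M (a n (Suc j))" by auto
      qed (use Suc in auto)
      then have "\<exists>C. P j C" by (auto simp: P_def)
      then have "P j (SOME C. P j C)" by (rule someI_ex)
      moreover have "a (Suc n) (Suc (2 * j)) = (SOME C. P j C)"
        by (simp add: a_def P_def Let_def)
      ultimately show ?thesis by simp
    qed
    show ?case
    proof
      fix k :: nat
      obtain j where "k = 2 * j \<or> k = Suc (2 * j)" by (metis evenE oddE Suc_eq_plus1)
      then show "a (Suc n) k \<in> sets M \<and> a (Suc n) k \<subseteq> a (Suc n) (Suc k) \<and> a (Suc n) k \<subseteq> \<Omega> \<and>
          measure M (a (Suc n) k) = measure M \<Omega> * (min (real k) (2 ^ Suc n) / 2 ^ Suc n)"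
      proof
        assume k: "k = 2 * j"
        have "min (real (2 * j)) (2 ^ Suc n) / 2 ^ Suc n = min (real j) (2 ^ n) / 2 ^ n"
          by (simp add: min_def)
        then have "measure M (a n j) = measure M \<Omega> * (min (real (2 * j)) (2 ^ Suc n) / 2 ^ Suc n)"
          using Suc by metis
        moreover have "a n j \<in> sets M \<and> a n j \<subseteq> a (Suc n) (Suc (2 * j)) \<and> a n j \<subseteq> \<Omega>"
          using Suc odd[of j] unfolding P_def by blast
        ultimately show ?thesis unfolding k even by blast
      next
        assume k: "k = Suc (2 * j)"
        have Sk: "Suc k = 2 * Suc j" by (simp add: k)
        have num: "real (Suc j) = real j + 1" "real (Suc (2 * j)) = 2 * real j + 1" "(2::real) ^ Suc n = 2 * 2 ^ n"
          by simp_all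
        have "(min (real j) (2 ^ n) / 2 ^ n + min (real (Suc j)) (2 ^ n) / 2 ^ n) / 2 =
            min (real (Suc (2 * j))) (2 ^ Suc n) / 2 ^ Suc n"
        proof (cases "Suc j \<le> 2 ^ n")
          case True
          then have "real (Suc j) \<le> real (2 ^ n)" by (rule of_nat_mono)
          then have le: "real (Suc j) \<le> 2 ^ n" by simp
          have "real j \<le> 2 ^ n" "real (Suc (2 * j)) \<le> 2 ^ Suc n" using le unfolding num by linarith+
          with le have "min (real j) (2 ^ n) = real j" "min (real (Suc j)) (2 ^ n) = real (Suc j)"
              "min (real (Suc (2 * j))) (2 ^ Suc n) = real (Suc (2 * j))"
            by (simp_all only: min.absorb1)
          then show ?thesis by (simp only:) (simp add: field_simps)
        next
          case False
          then have "real (2 ^ n) \<le> real j" by (intro of_nat_mono) auto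
          then have le: "2 ^ n \<le> real j" by simp
          have "2 ^ n \<le> real (Suc j)" "2 ^ Suc n \<le> real (Suc (2 * j))" using le unfolding num by linarith+
          with le have "min (real j) (2 ^ n) = 2 ^ n" "min (real (Suc j)) (2 ^ n) = 2 ^ n"
              "min (real (Suc (2 * j))) (2 ^ Suc n) = 2 ^ Suc n"
            by (simp_all only: min.absorb2)
          then show ?thesis by (simp only:) simp
        qed
        then have "measure M (a (Suc n) k) = measure M \<Omega> * (min (real k) (2 ^ Suc n) / 2 ^ Suc n)"
          using odd[of j] Suc[rule_format, of j] Suc[rule_format, of "Suc j"] unfolding k P_def
          by (simp only: distrib_left[symmetric] times_divide_eq_right[symmetric])
        moreover have "a (Suc n) k \<in> sets M \<and> a (Suc n) k \<subseteq> a (Suc n) (Suc k) \<and> a (Suc n) k \<subseteq> \<Omega>"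
          unfolding Sk even using odd[of j] Suc unfolding k P_def by blast
        ultimately show ?thesis by blast
      qed
    qed
  qed
  then show "dyadic_chain M \<Omega> n k \<in> sets M" "dyadic_chain M \<Omega> n k \<subseteq> dyadic_chain M \<Omega> n (Suc k)"
    "dyadic_chain M \<Omega> n k \<subseteq> \<Omega>" "measure M (dyadic_chain M \<Omega> n k) = measure M \<Omega> * (min (real k) (2 ^ n) / 2 ^ n)"
    by (simp_all add: a_def)
qed

lemma (in finite_measure) dyadic_chain_mono:
  assumes \<Omega>: "\<Omega> \<in> sets M" and atomless: "\<And>B. B \<subseteq> \<Omega> \<Longrightarrow> \<not> atom M B"
    and le: "real k / 2 ^ n \<le> real l / 2 ^ p"
  shows "dyadic_chain M \<Omega> n k \<subseteq> dyadic_chain M \<Omega> p l"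
proof -
  define a where "a = dyadic_chain M \<Omega>"
  have refine: "a (i + j) (2 ^ j * k) = a i k" for i j k
    by (induction j) (simp_all add: a_def mult.assoc)
  have mono: "a i k \<subseteq> a i l" if "k \<le> l" for i k l
    using lift_Suc_mono_le[of "a i", OF _ that] dyadic_chain(2)[OF \<Omega> atomless] by (simp add: a_def)
  have "real (2 ^ p * k) \<le> real (2 ^ n * l)" using le by (simp add: field_simps)
  then have "2 ^ p * k \<le> 2 ^ n * l" by (simp only: of_nat_le_iff)
  then have "a (n + p) (2 ^ p * k) \<subseteq> a (p + n) (2 ^ n * l)" unfolding add.commute[of p n] by (rule mono)
  then show ?thesis unfolding refine by (simp add: a_def)
qed

definition unit_uniform :: "real measure" where
  "unit_uniform = uniform_measure lborel {0..1}"

lemma sets_unit_uniform[simp, measurable_cong]: "sets unit_uniform = sets borel"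
  by (simp add: unit_uniform_def)

lemma emeasure_unit_uniform: "B \<in> sets borel \<Longrightarrow> emeasure unit_uniform B = emeasure lborel ({0..1} \<inter> B)"
  by (simp add: unit_uniform_def divide_ennreal_def)

lemma unit_uniform_singleton: "emeasure unit_uniform {x} = 0"
proof -
  have "emeasure lborel ({0..1} \<inter> {x}) \<le> emeasure lborel {x}" by (intro emeasure_mono) auto
  then show ?thesis by (simp add: emeasure_unit_uniform)
qed

text \<open>The sets of the dyadic chain serve as the sublevel sets of \<open>w\<close>: if
  \<open>k / 2 ^ n < r \<le> (k + 1) / 2 ^ n \<le> 1\<close>, the measure of \<open>{w < r}\<close> lies between \<open>k / 2 ^ n\<close> and
  \<open>(k + 1) / 2 ^ n\<close> times that of \<open>\<Omega>\<close>; as \<open>n\<close> grows, it is seen to be \<open>r\<close> times that of \<open>\<Omega>\<close>.\<close>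

lemma (in finite_measure) exists_uniform_variable:
  assumes \<Omega>: "\<Omega> \<in> sets M" "0 < measure M \<Omega>" and atomless: "\<And>B. B \<subseteq> \<Omega> \<Longrightarrow> \<not> atom M B"
  shows "\<exists>u\<in>borel_measurable M. distr (uniform_measure M \<Omega>) borel u = unit_uniform"
proof -
  define a where "a = dyadic_chain M \<Omega>"
  define m where "m = measure M \<Omega>"
  note chain = dyadic_chain[OF \<Omega>(1) atomless, folded a_def m_def]
  have mono: "a n k \<subseteq> a p l" if "real k / 2 ^ n \<le> real l / 2 ^ p" for n k p l
    using dyadic_chain_mono[OF \<Omega>(1) atomless that] by (simp add: a_def)
  define Q where "Q x = {real k / 2 ^ n |n k. x \<in> a n k}" for x
  define w where "w x = Inf (Q x)" for x
  have "1 \<in> Q x" if "x \<in> \<Omega>" for x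
    unfolding Q_def using that by (intro CollectI exI[of _ 0] exI[of _ 1]) (simp add: a_def)
  then have Q_ne: "Q x \<noteq> {}" if "x \<in> \<Omega>" for x using that by blast
  have Q_bdd: "bdd_below (Q x)" for x by (rule bdd_belowI[of _ 0]) (auto simp: Q_def)
  have w_nonneg: "0 \<le> w x" if "x \<in> \<Omega>" for x
    unfolding w_def using Q_ne[OF that] by (intro cInf_greatest) (auto simp: Q_def)
  have w_less: "w x < r \<longleftrightarrow> (\<exists>n k. x \<in> a n k \<and> real k / 2 ^ n < r)" if "x \<in> \<Omega>" for x r
    unfolding w_def by (subst cInf_less_iff[OF Q_ne[OF that] Q_bdd]) (auto simp: Q_def)
  define L where "L r = {x \<in> \<Omega>. w x < r}" for r
  have L_eq: "L r = (\<Union>(n, k)\<in>{(n, k). real k / 2 ^ n < r}. a n k)" for r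
    using w_less chain(3) by (auto simp: L_def) blast+
  have L_sets: "L r \<in> sets M" for r
    unfolding L_eq using chain(1) by (intro sets.countable_UN') auto
  have L_measure: "measure M (L r) = m * r" if r: "0 < r" "r \<le> 1" for r
  proof -
    have "\<bar>measure M (L r) - m * r\<bar> \<le> m / 2 ^ n" for n
    proof -
      \<comment> \<open>Rounding up and subtracting one makes \<open>j / 2 ^ n\<close> strictly less than \<open>r\<close>, as needed for
        the inclusion in the sublevel set.\<close>
      define j where "j = nat (\<lceil>r * 2 ^ n\<rceil> - 1)"
      have pos: "0 < r * 2 ^ n" using r by simp
      then have "1 \<le> \<lceil>r * 2 ^ n\<rceil>" by (simp add: one_le_ceiling)
      then have "real j = of_int \<lceil>r * 2 ^ n\<rceil> - 1" by (simp add: j_def)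
      then have j: "real j < r * 2 ^ n" "r * 2 ^ n \<le> real (Suc j)" by linarith+
      have "real j / 2 ^ n < r" using j(1) by (simp add: field_simps)
      then have "a n j \<subseteq> L r" unfolding L_eq by auto
      then have "measure M (a n j) \<le> measure M (L r)" using L_sets by (intro finite_measure_mono)
      moreover have "L r \<subseteq> a n (Suc j)"
      proof
        fix x assume "x \<in> L r"
        then have "x \<in> \<Omega>" "w x < r" by (auto simp: L_def)
        then have "\<exists>p k. x \<in> a p k \<and> real k / 2 ^ p < r" by (simp only: w_less)
        then obtain p k where x: "x \<in> a p k" "real k / 2 ^ p < r" by (elim exE conjE)
        have "r \<le> real (Suc j) / 2 ^ n" using j(2) by (simp add: field_simps)
        with x(2) have "real k / 2 ^ p \<le> real (Suc j) / 2 ^ n" by linarith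
        from mono[OF this] x(1) show "x \<in> a n (Suc j)" by blast
      qed
      then have "measure M (L r) \<le> measure M (a n (Suc j))" using chain(1) by (intro finite_measure_mono)
      moreover have "r * 2 ^ n \<le> 1 * 2 ^ n" using r(2) by (rule mult_right_mono) simp
      then have "real j < real (2 ^ n)"
        unfolding of_nat_power of_nat_numeral using j(1) by linarith
      then have "Suc j \<le> 2 ^ n" by (simp only: of_nat_less_iff Suc_le_eq)
      then have "real (Suc j) \<le> real (2 ^ n)" by (rule of_nat_mono)
      then have jn: "min (real j) (2 ^ n) = real j" "min (real (Suc j)) (2 ^ n) = real (Suc j)"
        by auto
      have "measure M (a n j) = m * (real j / 2 ^ n)" "measure M (a n (Suc j)) = m * (real (Suc j) / 2 ^ n)"
        by (simp_all only: chain(4) jn)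
      moreover have "m * r - m / 2 ^ n \<le> m * (real j / 2 ^ n)"
      proof -
        have "r \<le> real (Suc j) / 2 ^ n" using j(2) by (simp add: pos_le_divide_eq)
        then have "r - 1 / 2 ^ n \<le> real j / 2 ^ n" by (simp add: add_divide_distrib)
        from mult_left_mono[OF this, of m] \<Omega>(2) show ?thesis by (simp add: m_def right_diff_distrib)
      qed
      moreover have "m * (real (Suc j) / 2 ^ n) \<le> m * r + m / 2 ^ n"
      proof -
        have "real j / 2 ^ n \<le> r" using j(1) by (simp add: pos_divide_le_eq)
        then have "real (Suc j) / 2 ^ n \<le> r + 1 / 2 ^ n" by (simp add: add_divide_distrib)
        from mult_left_mono[OF this, of m] \<Omega>(2) show ?thesis by (simp add: m_def distrib_left)
      qed
      ultimately show ?thesis by linarith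
    qed
    moreover have "(\<lambda>n. m / 2 ^ n) \<longlonglongrightarrow> 0" by (rule LIMSEQ_divide_realpow_zero) simp
    ultimately have "\<bar>measure M (L r) - m * r\<bar> \<le> 0" by (intro LIMSEQ_le_const) auto
    then show ?thesis by simp
  qed
  \<comment> \<open>Passing to \<open>1 - w\<close> turns strict sublevel sets into the strict superlevel sets that determine a
    law; the value outside \<open>\<Omega>\<close> is arbitrary.\<close>
  define u where "u x = (if x \<in> \<Omega> then 1 - w x else 2)" for x
  have u_set: "{x \<in> space M. u x > r} = L (1 - r) \<union> (if r < 2 then space M - \<Omega> else {})" for r
    using sets.sets_into_space[OF \<Omega>(1)] by (auto simp: u_def L_def)
  have u: "u \<in> borel_measurable M"
    unfolding borel_measurable_iff_greater u_set using L_sets \<Omega> by auto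
  have "distr (uniform_measure M \<Omega>) borel u = unit_uniform"
  proof (rule measure_eqI_lessThan)
    have u': "u \<in> measurable (uniform_measure M \<Omega>) borel" using u by simp
    have em: "emeasure (distr (uniform_measure M \<Omega>) borel u) {r<..} = ennreal (measure M (L (1 - r)) / m)" for r
    proof -
      have "\<Omega> \<inter> (u -` {r<..} \<inter> space M) = L (1 - r)"
        using sets.sets_into_space[OF \<Omega>(1)] by (auto simp: u_def L_def)
      moreover have "u -` {r<..} \<inter> space M \<in> sets M" using u by (rule measurable_sets) auto
      ultimately show ?thesis
        using \<Omega> u' by (simp add: emeasure_distr emeasure_eq_measure divide_ennreal m_def)
    qed
    show "emeasure (distr (uniform_measure M \<Omega>) borel u) {r<..} < \<infinity>" for r
      unfolding em by simp
    show "emeasure (distr (uniform_measure M \<Omega>) borel u) {r<..} = emeasure unit_uniform {r<..}" for r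
    proof -
      consider "r < 0" | "0 \<le> r" "r < 1" | "1 \<le> r" by linarith
      then show ?thesis
      proof cases
        case 1
        have "w x < 1 - r" if "x \<in> \<Omega>" for x
        proof -
          have "w x \<le> 1" unfolding w_def using \<open>\<And>x. x \<in> \<Omega> \<Longrightarrow> 1 \<in> Q x\<close>[OF that] Q_bdd by (rule cInf_lower)
          then show ?thesis using 1 by simp
        qed
        then have "L (1 - r) = \<Omega>" by (auto simp: L_def)
        moreover have "{0..1} \<inter> {r<..} = {0..1::real}" using 1 by auto
        ultimately show ?thesis using \<Omega> by (simp add: em emeasure_unit_uniform m_def)
      next
        case 2
        have "emeasure lborel ({0..1} \<inter> {r<..}) = ennreal (1 - r)"
        proof -
          have "{0..1} \<inter> {r<..} = {r<..1}" using 2 by auto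
          then show ?thesis using 2 by simp
        qed
        moreover have "measure M (L (1 - r)) / m = 1 - r" using L_measure[of "1 - r"] 2 \<Omega> by (simp add: m_def)
        ultimately show ?thesis by (simp add: em emeasure_unit_uniform)
      next
        case 3
        have "L (1 - r) = {}" using 3 w_nonneg by (force simp: L_def)
        moreover have "{0..1} \<inter> {r<..} = {}" using 3 by auto
        ultimately show ?thesis by (simp add: em emeasure_unit_uniform)
      qed
    qed
  qed simp_all
  then show ?thesis using u by blast
qed

section \<open>Push-forward densities\<close>

text \<open>\<open>h\<close> is the density, with respect to the law of \<open>u\<close>, of the image under \<open>u\<close> of the measure \<open>f dP\<close>; in
  probabilistic terms \<open>h \<circ> u\<close> is the conditional expectation of \<open>f\<close> given \<open>u\<close>.\<close>

definition pushforward_density :: "'a measure \<Rightarrow> ('a \<Rightarrow> real) \<Rightarrow>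
    ('a \<Rightarrow> 'k::{banach, second_countable_topology}) \<Rightarrow> (real \<Rightarrow> 'k) \<Rightarrow> bool" where
  "pushforward_density P u f h \<longleftrightarrow> integrable (distr P borel u) h \<and>
    (\<forall>D\<in>sets borel. (\<integral>y. indicator D y *\<^sub>R h y \<partial>distr P borel u) = (\<integral>x. indicator D (u x) *\<^sub>R f x \<partial>P))"

lemma pushforward_density_integrable: "pushforward_density P u f h \<Longrightarrow> integrable (distr P borel u) h"
  by (simp add: pushforward_density_def)

lemma pushforward_density_eq:
  "pushforward_density P u f h \<Longrightarrow> D \<in> sets borel \<Longrightarrow>
    (\<integral>y. indicator D y *\<^sub>R h y \<partial>distr P borel u) = (\<integral>x. indicator D (u x) *\<^sub>R f x \<partial>P)"
  by (simp add: pushforward_density_def)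

lemma integrable_indicator_comp:
  fixes f :: "'a \<Rightarrow> 'k::{banach, second_countable_topology}"
  assumes "u \<in> borel_measurable P" "integrable P f" "D \<in> sets borel"
  shows "integrable P (\<lambda>x. indicator D (u x) *\<^sub>R f x)"
proof -
  have D: "u -` D \<inter> space P \<in> sets P" using assms(1,3) by (rule measurable_sets)
  have "integrable P (\<lambda>x. indicator (u -` D \<inter> space P) x *\<^sub>R f x)"
    using D assms(2) by (rule integrable_mult_indicator)
  then show ?thesis
    by (rule Bochner_Integration.integrable_cong[THEN iffD1, rotated -1]) (auto simp: indicator_def)
qed

lemma pushforward_density_unique:
  assumes h: "pushforward_density P u f h" "pushforward_density P u f' h'" and P: "finite_measure P"
    and f: "u \<in> borel_measurable P" "integrable P f" "integrable P f'" "AE x in P. f x = f' x"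
  shows "AE y in distr P borel u. h y = h' y"
proof -
  interpret U: finite_measure "distr P borel u"
    using f(1) by (rule finite_measure.finite_measure_distr[OF P])
  show ?thesis
  proof (rule U.density_unique_banach)
  show "integrable (distr P borel u) h" "integrable (distr P borel u) h'"
    using h by (auto simp: pushforward_density_def)
  fix D assume "D \<in> sets (distr P borel u)"
  then have D: "D \<in> sets borel" by simp
  have "(\<integral>x. indicator D (u x) *\<^sub>R f x \<partial>P) = (\<integral>x. indicator D (u x) *\<^sub>R f' x \<partial>P)"
    using f(4) borel_measurable_integrable[OF integrable_indicator_comp[OF f(1,2) D]]
      borel_measurable_integrable[OF integrable_indicator_comp[OF f(1,3) D]]
    by (intro integral_cong_AE) auto
  then show "set_lebesgue_integral (distr P borel u) D h = set_lebesgue_integral (distr P borel u) D h'"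
    unfolding set_lebesgue_integral_def
    using pushforward_density_eq[OF h(1) D] pushforward_density_eq[OF h(2) D] by simp
  qed
qed

lemma pushforward_density_add:
  assumes h: "pushforward_density P u f h" "pushforward_density P u f' h'"
    and f: "u \<in> borel_measurable P" "integrable P f" "integrable P f'"
  shows "pushforward_density P u (\<lambda>x. f x + f' x) (\<lambda>y. h y + h' y)"
  unfolding pushforward_density_def
proof (intro conjI ballI)
  note hi = pushforward_density_integrable[OF h(1)] pushforward_density_integrable[OF h(2)]
  show "integrable (distr P borel u) (\<lambda>y. h y + h' y)" using hi by auto
  fix D :: "real set" assume D: "D \<in> sets borel"
  have "integrable (distr P borel u) (\<lambda>y. indicator D y *\<^sub>R h y)"
    "integrable (distr P borel u) (\<lambda>y. indicator D y *\<^sub>R h' y)"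
    using D hi by (auto intro: integrable_mult_indicator)
  then show "(\<integral>y. indicator D y *\<^sub>R (h y + h' y) \<partial>distr P borel u) =
      (\<integral>x. indicator D (u x) *\<^sub>R (f x + f' x) \<partial>P)"
    using pushforward_density_eq[OF h(1) D] pushforward_density_eq[OF h(2) D]
      integrable_indicator_comp[OF f(1,2) D] integrable_indicator_comp[OF f(1,3) D]
    by (simp add: scaleR_add_right)
qed

text \<open>Stated for bounded real-linear maps, to cover both multiplication by a scalar and sign changes of
  real functions.\<close>

lemma pushforward_density_linear:
  assumes h: "pushforward_density P u f h" and L: "bounded_linear L"
    and f: "u \<in> borel_measurable P" "integrable P f"
  shows "pushforward_density P u (\<lambda>x. L (f x)) (\<lambda>y. L (h y))"
  unfolding pushforward_density_def
proof (intro conjI ballI)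
  note hi = pushforward_density_integrable[OF h]
  interpret bounded_linear L by fact
  show "integrable (distr P borel u) (\<lambda>y. L (h y))" by (rule integrable_bounded_linear[OF L hi])
  fix D :: "real set" assume D: "D \<in> sets borel"
  have "integrable (distr P borel u) (\<lambda>y. indicator D y *\<^sub>R h y)"
    using D hi by (auto intro: integrable_mult_indicator)
  from integral_bounded_linear[OF L this] integral_bounded_linear[OF L integrable_indicator_comp[OF f D]]
  show "(\<integral>y. indicator D y *\<^sub>R L (h y) \<partial>distr P borel u) = (\<integral>x. indicator D (u x) *\<^sub>R L (f x) \<partial>P)"
    using pushforward_density_eq[OF h D] by (simp add: scaleR)
qed

lemma pushforward_density_indicator:
  assumes h: "pushforward_density P u f h" and f: "u \<in> borel_measurable P" "integrable P f"
    and E: "E \<in> sets borel"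
  shows "pushforward_density P u (\<lambda>x. indicator E (u x) *\<^sub>R f x) (\<lambda>y. indicator E y *\<^sub>R h y)"
  unfolding pushforward_density_def
proof (intro conjI ballI)
  show "integrable (distr P borel u) (\<lambda>y. indicator E y *\<^sub>R h y)"
    using E pushforward_density_integrable[OF h] by (auto intro: integrable_mult_indicator)
  fix D :: "real set" assume D: "D \<in> sets borel"
  then show "(\<integral>y. indicator D y *\<^sub>R indicator E y *\<^sub>R h y \<partial>distr P borel u) =
      (\<integral>x. indicator D (u x) *\<^sub>R indicator E (u x) *\<^sub>R f x \<partial>P)"
    using pushforward_density_eq[OF h, of "D \<inter> E"] D E by (simp add: indicator_inter_arith)
qed

lemma (in finite_measure) pushforward_density_nonneg_exists:
  fixes f :: "'a \<Rightarrow> real"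
  assumes u: "u \<in> borel_measurable M" and f: "integrable M f" "\<And>x. 0 \<le> f x"
  shows "\<exists>h. pushforward_density M u f h"
proof -
  define U where "U = distr M borel u"
  define K where "K = distr (density M (\<lambda>x. ennreal (f x))) borel u"
  have fm: "f \<in> borel_measurable M" using f by simp
  interpret U: finite_measure U unfolding U_def using u by (rule finite_measure_distr)
  have sets: "sets U = sets borel" "space U = UNIV" "sets K = sets U" by (auto simp: U_def K_def)
  have emK: "emeasure K D = (\<integral>\<^sup>+x. indicator D (u x) * ennreal (f x) \<partial>M)" if D: "D \<in> sets borel" for D
  proof -
    have D': "u -` D \<inter> space M \<in> sets M" using u D by (rule measurable_sets)
    have "emeasure K D = (\<integral>\<^sup>+x. ennreal (f x) * indicator (u -` D \<inter> space M) x \<partial>M)"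
      unfolding K_def using u D D' fm by (simp add: emeasure_distr emeasure_density)
    also have "\<dots> = (\<integral>\<^sup>+x. indicator D (u x) * ennreal (f x) \<partial>M)"
      by (intro nn_integral_cong) (auto simp: indicator_def)
    finally show ?thesis .
  qed
  have "absolutely_continuous U K"
    unfolding absolutely_continuous_def
  proof
    fix D assume D: "D \<in> null_sets U"
    then have Db: "D \<in> sets borel" by (auto simp: null_sets_def U_def)
    have "emeasure M (u -` D \<inter> space M) = 0"
      using D u by (auto simp: null_sets_def U_def emeasure_distr)
    then have "u -` D \<inter> space M \<in> null_sets M" using measurable_sets[OF u Db] by (auto simp: null_sets_def)
    then have "AE x in M. x \<notin> u -` D \<inter> space M" by (rule AE_not_in)
    then have "AE x in M. indicator D (u x) * ennreal (f x) = 0"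
      using AE_space by eventually_elim auto
    then have "(\<integral>\<^sup>+x. indicator D (u x) * ennreal (f x) \<partial>M) = (\<integral>\<^sup>+x. 0 \<partial>M)" by (rule nn_integral_cong_AE)
    then show "D \<in> null_sets K" using Db by (simp add: null_sets_def emK sets)
  qed
  from U.Radon_Nikodym[OF this sets(3)] obtain g where g: "g \<in> borel_measurable U" "density U g = K" by blast
  have gD: "(\<integral>\<^sup>+y. g y * indicator D y \<partial>U) = (\<integral>\<^sup>+x. indicator D (u x) * ennreal (f x) \<partial>M)"
    if D: "D \<in> sets borel" for D
    using emK[OF D] D unfolding g(2)[symmetric] by (simp add: emeasure_density g(1) sets)
  have "(\<integral>\<^sup>+x. ennreal (f x) \<partial>M) < \<infinity>" using f by (simp add: nn_integral_eq_integral)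
  then have fin: "(\<integral>\<^sup>+y. g y \<partial>U) < \<infinity>" using gD[of UNIV] by simp
  then have ae: "AE y in U. g y \<noteq> \<infinity>" using g(1) by (intro nn_integral_PInf_AE) auto
  define h where "h y = enn2real (g y)" for y
  have h_nn: "0 \<le> h y" for y by (simp add: h_def)
  have hm: "h \<in> borel_measurable U" unfolding h_def using g(1) by simp
  have hg: "AE y in U. ennreal (h y) = g y" using ae by eventually_elim (simp add: h_def less_top)
  have "(\<integral>\<^sup>+y. ennreal (h y) \<partial>U) = (\<integral>\<^sup>+y. g y \<partial>U)" using hg by (rule nn_integral_cong_AE)
  then have hi: "integrable U h" using hm fin by (intro integrableI_nonneg) (auto simp: h_def)
  have "(\<integral>y. indicator D y *\<^sub>R h y \<partial>U) = (\<integral>x. indicator D (u x) *\<^sub>R f x \<partial>M)" if D: "D \<in> sets borel" for D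
  proof -
    have "(\<integral>y. indicator D y *\<^sub>R h y \<partial>U) = enn2real (\<integral>\<^sup>+y. ennreal (indicator D y *\<^sub>R h y) \<partial>U)"
      using D hi sets
      by (intro integral_eq_nn_integral borel_measurable_integrable integrable_mult_indicator) (auto simp: h_nn)
    also have "(\<integral>\<^sup>+y. ennreal (indicator D y *\<^sub>R h y) \<partial>U) = (\<integral>\<^sup>+y. g y * indicator D y \<partial>U)"
    proof (rule nn_integral_cong_AE)
      show "AE y in U. ennreal (indicator D y *\<^sub>R h y) = g y * indicator D y"
        using hg by eventually_elim (auto simp: indicator_def)
    qed
    also have "\<dots> = (\<integral>\<^sup>+x. ennreal (indicator D (u x) *\<^sub>R f x) \<partial>M)"
      unfolding gD[OF D] by (intro nn_integral_cong) (auto simp: indicator_def)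
    also have "enn2real \<dots> = (\<integral>x. indicator D (u x) *\<^sub>R f x \<partial>M)"
      using integrable_indicator_comp[OF u f(1) D] f(2)
      by (intro integral_eq_nn_integral[symmetric] borel_measurable_integrable) auto
    finally show ?thesis .
  qed
  then have "pushforward_density M u f h" using hi by (simp add: pushforward_density_def U_def)
  then show ?thesis by blast
qed

lemma (in finite_measure) pushforward_density_exists:
  fixes f :: "'a \<Rightarrow> 'k::euclidean_space"
  assumes u: "u \<in> borel_measurable M" and f: "integrable M f"
  shows "\<exists>h. pushforward_density M u f h"
proof -
  have real: "\<exists>h. pushforward_density M u g h" if g: "integrable M g" for g :: "'a \<Rightarrow> real"
  proof -
    have p: "integrable M (\<lambda>x. max 0 (g x))" and n: "integrable M (\<lambda>x. max 0 (- g x))" using g by auto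
    obtain h1 where h1: "pushforward_density M u (\<lambda>x. max 0 (g x)) h1"
      using pushforward_density_nonneg_exists[OF u p] by auto
    obtain h2 where h2: "pushforward_density M u (\<lambda>x. max 0 (- g x)) h2"
      using pushforward_density_nonneg_exists[OF u n] by auto
    have h2': "pushforward_density M u (\<lambda>x. - max 0 (- g x)) (\<lambda>y. - h2 y)"
      using h2 bounded_linear_minus[OF bounded_linear_ident] u n by (rule pushforward_density_linear)
    have "pushforward_density M u (\<lambda>x. max 0 (g x) + - max 0 (- g x)) (\<lambda>y. h1 y + - h2 y)"
      using h1 h2' u p n by (intro pushforward_density_add) auto
    moreover have "(\<lambda>x. max 0 (g x) + - max 0 (- g x)) = g" by (auto simp: max_def)
    ultimately show ?thesis by auto
  qed
  have "\<forall>b. \<exists>h. pushforward_density M u (\<lambda>x. f x \<bullet> b) h" using real f by auto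
  then obtain h where h: "\<And>b. pushforward_density M u (\<lambda>x. f x \<bullet> b) (h b)" by metis
  define H where "H y = (\<Sum>b\<in>Basis. h b y *\<^sub>R b)" for y
  have Hb: "H y \<bullet> b = h b y" if "b \<in> Basis" for y b using that by (simp add: H_def)
  have Hi: "integrable (distr M borel u) H"
    unfolding H_def using pushforward_density_integrable[OF h] by auto
  have "(\<integral>y. indicator D y *\<^sub>R H y \<partial>distr M borel u) = (\<integral>x. indicator D (u x) *\<^sub>R f x \<partial>M)"
    if D: "D \<in> sets borel" for D
  proof (rule euclidean_eqI)
    fix b :: 'k assume b: "b \<in> Basis"
    have i: "integrable (distr M borel u) (\<lambda>y. indicator D y *\<^sub>R H y)"
      using D Hi by (auto intro: integrable_mult_indicator)
    have "(\<integral>y. indicator D y *\<^sub>R H y \<partial>distr M borel u) \<bullet> b =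
        (\<integral>y. (indicator D y *\<^sub>R H y) \<bullet> b \<partial>distr M borel u)"
      using i by (intro integral_inner_left[symmetric])
    also have "\<dots> = (\<integral>y. indicator D y *\<^sub>R h b y \<partial>distr M borel u)" using b by (simp add: Hb)
    also have "\<dots> = (\<integral>x. (indicator D (u x) *\<^sub>R f x) \<bullet> b \<partial>M)"
      using pushforward_density_eq[OF h D] by simp
    also have "\<dots> = (\<integral>x. indicator D (u x) *\<^sub>R f x \<partial>M) \<bullet> b"
      using integrable_indicator_comp[OF u f D] by (intro integral_inner_left)
    finally show "(\<integral>y. indicator D y *\<^sub>R H y \<partial>distr M borel u) \<bullet> b =
        (\<integral>x. indicator D (u x) *\<^sub>R f x \<partial>M) \<bullet> b" .
  qed
  then show ?thesis using Hi by (auto simp: pushforward_density_def)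
qed

text \<open>In each coordinate the \<open>L\<^sub>1\<close> norm is a difference of the integrals over the sets where the coordinate
  is nonnegative and negative.\<close>

lemma L1norm_le_of_set_integrals:
  fixes h :: "'a \<Rightarrow> 'k::euclidean_space" and K :: real
  assumes h: "integrable M h" and K: "\<And>D. D \<in> sets M \<Longrightarrow> norm (\<integral>x. indicator D x *\<^sub>R h x \<partial>M) \<le> K"
  shows "L1norm M h \<le> 2 * DIM('k) * K"
proof -
  have comp: "(\<integral>x. \<bar>h x \<bullet> b\<bar> \<partial>M) \<le> 2 * K" if b: "b \<in> Basis" for b
  proof -
    define D where "D = {x \<in> space M. 0 \<le> h x \<bullet> b}"
    have D: "D \<in> sets M" unfolding D_def using h by measurable
    have i: "integrable M (\<lambda>x. indicator A x *\<^sub>R h x)" if "A \<in> sets M" for A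
      using that h by (rule integrable_mult_indicator)
    have le: "\<bar>\<integral>x. (indicator A x *\<^sub>R h x) \<bullet> b \<partial>M\<bar> \<le> K" if "A \<in> sets M" for A
    proof -
      have "(\<integral>x. (indicator A x *\<^sub>R h x) \<bullet> b \<partial>M) = (\<integral>x. indicator A x *\<^sub>R h x \<partial>M) \<bullet> b"
        using i[OF that] by (intro integral_inner_left)
      then show ?thesis using Basis_le_norm[OF b] K[OF that] order_trans by metis
    qed
    have Dc: "space M - D \<in> sets M" using D by auto
    have "(\<integral>x. \<bar>h x \<bullet> b\<bar> \<partial>M) =
        (\<integral>x. (indicator D x *\<^sub>R h x) \<bullet> b - (indicator (space M - D) x *\<^sub>R h x) \<bullet> b \<partial>M)"
      by (intro Bochner_Integration.integral_cong) (auto simp: D_def indicator_def)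
    also have "\<dots> = (\<integral>x. (indicator D x *\<^sub>R h x) \<bullet> b \<partial>M) - (\<integral>x. (indicator (space M - D) x *\<^sub>R h x) \<bullet> b \<partial>M)"
      using i[OF D] i[OF Dc] by (intro Bochner_Integration.integral_diff integrable_inner_left)
    also have "\<dots> \<le> 2 * K" using le[OF D] le[OF Dc] by linarith
    finally show ?thesis .
  qed
  have "L1norm M h \<le> (\<integral>x. (\<Sum>b\<in>Basis. \<bar>h x \<bullet> b\<bar>) \<partial>M)"
    unfolding L1norm_def using h by (intro integral_mono integrable_norm norm_le_l1) auto
  also have "\<dots> = (\<Sum>b\<in>Basis. \<integral>x. \<bar>h x \<bullet> b\<bar> \<partial>M)" using h by (intro Bochner_Integration.integral_sum) auto
  also have "\<dots> \<le> (\<Sum>b\<in>(Basis::'k set). 2 * K)" using comp by (intro sum_mono)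
  finally show ?thesis by simp
qed

text \<open>The function \<open>c \<mapsto> \<integral>\<^bsub>{..c}\<^esub> norm h\<close> is a distribution function, and it is continuous because the
  measure has no point masses.\<close>

lemma halving_half_line:
  fixes h :: "real \<Rightarrow> 'k::{banach, second_countable_topology}"
  assumes U: "sets U = sets borel" "\<And>x. emeasure U {x} = 0" and h: "integrable U h"
  shows "\<exists>c. (\<integral>y. indicator {..c} y *\<^sub>R norm (h y) \<partial>U) = L1norm U h / 2"
proof -
  define K where "K = density U (\<lambda>y. ennreal (norm (h y)))"
  define W where "W = L1norm U h"
  have hm: "(\<lambda>y. ennreal (norm (h y))) \<in> borel_measurable U" using h by auto
  have spU: "space U = UNIV" using sets_eq_imp_space_eq[OF U(1)] by simp
  have emK: "emeasure K D = ennreal (\<integral>y. indicator D y *\<^sub>R norm (h y) \<partial>U)" if D: "D \<in> sets borel" for D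
  proof -
    have "emeasure K D = (\<integral>\<^sup>+y. ennreal (indicator D y *\<^sub>R norm (h y)) \<partial>U)"
      unfolding K_def using hm D U
      by (simp add: emeasure_density, intro nn_integral_cong) (auto simp: indicator_def)
    also have "\<dots> = ennreal (\<integral>y. indicator D y *\<^sub>R norm (h y) \<partial>U)"
      using D h U by (intro nn_integral_eq_integral integrable_mult_indicator) auto
    finally show ?thesis .
  qed
  have nonneg: "0 \<le> (\<integral>y. indicator D y *\<^sub>R norm (h y) \<partial>U)" for D by (intro Bochner_Integration.integral_nonneg) auto
  have mK: "measure K D = (\<integral>y. indicator D y *\<^sub>R norm (h y) \<partial>U)" if D: "D \<in> sets borel" for D
    using emK[OF D] nonneg[of D] by (simp add: measure_def)
  have total: "measure K UNIV = W" using mK[of UNIV] by (simp add: W_def L1norm_def)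
  have "finite_measure K"
  proof (rule finite_measureI)
    have "space K = UNIV" using spU by (simp add: K_def)
    then show "emeasure K (space K) \<noteq> \<infinity>" using emK[of UNIV] by simp
  qed
  moreover have "sets K = sets borel" using U by (simp add: K_def)
  ultimately interpret K: finite_borel_measure K
    by (simp add: finite_borel_measure_def finite_borel_measure_axioms_def)
  have "measure K {x} = 0" for x
  proof -
    have "AE y in U. y \<notin> {x}" using U by (intro AE_not_in) (auto simp: null_sets_def)
    then have "AE y in U. indicator {x} y *\<^sub>R norm (h y) = 0" by eventually_elim auto
    then show ?thesis using mK[of "{x}"] by (simp add: integral_eq_zero_AE)
  qed
  then have cont: "isCont (cdf K) x" for x using K.isCont_cdf by simp
  have "\<exists>c. cdf K c = W / 2"
  proof (cases "W = 0")
    case True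
    have "cdf K 0 \<le> W" using K.cdf_bounded[of 0] total by (simp add: K.borel_UNIV)
    then show ?thesis using True K.cdf_nonneg[of 0] by (intro exI[of _ 0]) auto
  next
    case False
    then have W: "0 < W" using L1norm_nonneg[of U h] unfolding W_def by linarith
    have "\<forall>\<^sub>F i in sequentially. cdf K (- real i) < W / 2"
      by (rule order_tendstoD(2)[OF K.cdf_lim_neg_infty]) (use W in simp)
    then obtain i where i: "cdf K (- real i) < W / 2" by (auto simp: eventually_sequentially)
    have "\<forall>\<^sub>F j in sequentially. W / 2 < cdf K (real j)"
      by (rule order_tendstoD(1)[OF K.cdf_lim_infty]) (use W total in \<open>simp add: K.borel_UNIV\<close>)
    then obtain j where j: "W / 2 < cdf K (real j)" by (auto simp: eventually_sequentially)
    have "\<exists>x. - real i \<le> x \<and> x \<le> real j \<and> cdf K x = W / 2"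
      using i j cont by (intro IVT) auto
    then show ?thesis by blast
  qed
  then show ?thesis by (auto simp: cdf_def mK W_def)
qed

section \<open>An operator that splits every image in halves\<close>

lemma (in finite_measure) uniform_measure_eq_density:
  assumes "0 < measure M \<Omega>"
  shows "uniform_measure M \<Omega> = density M (\<lambda>x. ennreal (indicator \<Omega> x / measure M \<Omega>))"
  unfolding uniform_measure_def using assms
  by (intro arg_cong[where f="density M"])
    (auto simp: fun_eq_iff emeasure_eq_measure indicator_def divide_ennreal[symmetric])

lemma (in finite_measure) uniform_measure_integrals:
  fixes f :: "'a \<Rightarrow> 'k::{real_normed_field, banach, second_countable_topology}"
  assumes \<Omega>: "\<Omega> \<in> sets M" "0 < measure M \<Omega>" and f: "f \<in> borel_measurable M"
  shows "integrable (uniform_measure M \<Omega>) f \<longleftrightarrow> integrable M (cutoff \<Omega> f)"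
    and "L1norm M (cutoff \<Omega> f) = measure M \<Omega> * L1norm (uniform_measure M \<Omega>) f"
proof -
  define m where "m = measure M \<Omega>"
  have m: "0 < m" using \<Omega> by (simp add: m_def)
  have g: "(\<lambda>x. indicator \<Omega> x / m) \<in> borel_measurable M" "AE x in M. 0 \<le> indicator \<Omega> x / m"
    using \<Omega> m by auto
  note dens = uniform_measure_eq_density[OF \<Omega>(2), folded m_def]
  have eq: "(\<lambda>x. (indicator \<Omega> x / m) *\<^sub>R f x) = (\<lambda>x. (1 / m) *\<^sub>R cutoff \<Omega> f x)"
    by (auto simp: cutoff_def indicator_def)
  show "integrable (uniform_measure M \<Omega>) f \<longleftrightarrow> integrable M (cutoff \<Omega> f)"
    unfolding dens integrable_density[OF f g] eq
    using m integrable_scaleR_right[of m M "\<lambda>x. (1 / m) *\<^sub>R cutoff \<Omega> f x"] by auto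
  have "L1norm (uniform_measure M \<Omega>) f = (\<integral>x. (indicator \<Omega> x / m) *\<^sub>R norm (f x) \<partial>M)"
    unfolding L1norm_def dens using f g by (intro integral_density) auto
  also have "\<dots> = (\<integral>x. (1 / m) *\<^sub>R norm (cutoff \<Omega> f x) \<partial>M)"
    by (intro Bochner_Integration.integral_cong) (auto simp: cutoff_def indicator_def)
  also have "\<dots> = L1norm M (cutoff \<Omega> f) / m" by (simp add: L1norm_def)
  finally show "L1norm M (cutoff \<Omega> f) = measure M \<Omega> * L1norm (uniform_measure M \<Omega>) f"
    using m by (simp add: m_def)
qed

text \<open>Let \<open>u\<close> and \<open>v\<close> be uniformly distributed on atomless parts \<open>A\<close> and \<open>B\<close> of the two spaces. The operator
  sends \<open>f\<close> to \<open>h \<circ> v\<close> on \<open>B\<close>, where \<open>h\<close> is the density of the image of \<open>f\<close> under \<open>u\<close>. It intertwines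
  the cut to \<open>{u \<le> c}\<close> with the cut to \<open>{v \<le> c}\<close>, and \<open>c\<close> can be adapted to \<open>f\<close> so that the latter
  halves the norm of the image.\<close>

lemma exists_halving_operator:
  fixes M :: "'a measure" and N :: "'b measure"
  assumes fin: "finite_measure M" "finite_measure N"
    and not_atomic: "\<not> purely_atomic M" "\<not> purely_atomic N"
  shows "\<exists>(t :: ('a \<Rightarrow> 'k::{real_normed_field, euclidean_space}) \<Rightarrow> 'b \<Rightarrow> 'k) C.
    L1_operator M N t C \<and> 0 < fun_op_norm M N t \<and>
    (\<forall>f. integrable M f \<longrightarrow> (\<exists>F\<in>sets M. \<exists>G\<in>sets N.
      (AE x in N. t (cutoff F f) x = cutoff G (t f) x) \<and>
      L1norm N (cutoff G (t f)) = L1norm N (t f) / 2))"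
proof -
  interpret M: finite_measure M by fact
  interpret N: finite_measure N by fact
  obtain A where A: "A \<in> sets M" "0 < measure M A" "\<And>B. B \<subseteq> A \<Longrightarrow> \<not> atom M B"
    using not_atomic(1) unfolding purely_atomic_def by (auto simp: M.emeasure_eq_measure)
  obtain B where B: "B \<in> sets N" "0 < measure N B" "\<And>D. D \<subseteq> B \<Longrightarrow> \<not> atom N D"
    using not_atomic(2) unfolding purely_atomic_def by (auto simp: N.emeasure_eq_measure)
  obtain u where u: "u \<in> borel_measurable M" "distr (uniform_measure M A) borel u = unit_uniform"
    using M.exists_uniform_variable[OF A] by blast
  obtain v where v: "v \<in> borel_measurable N" "distr (uniform_measure N B) borel v = unit_uniform"
    using N.exists_uniform_variable[OF B] by blast
  define P where "P = uniform_measure M A"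
  define R where "R = uniform_measure N B"
  have pos: "emeasure M A \<noteq> 0" "emeasure M A \<noteq> \<infinity>" "emeasure N B \<noteq> 0" "emeasure N B < \<infinity>"
    using A B by (auto simp: M.emeasure_eq_measure N.emeasure_eq_measure)
  have prob: "prob_space P" unfolding P_def using pos by (intro prob_space_uniform_measure)
  then have finP: "finite_measure P" by (simp add: prob_space_def)
  interpret P: prob_space P by fact
  have uP: "u \<in> borel_measurable P" and vR: "v \<in> borel_measurable R"
    using u v by (simp_all add: P_def R_def)
  have dP: "distr P borel u = unit_uniform" and dR: "distr R borel v = unit_uniform"
    using u v by (simp_all add: P_def R_def)
  have intP: "integrable P f" if "integrable M f" for f :: "'a \<Rightarrow> 'k"
    unfolding P_def using M.uniform_measure_integrals(1)[OF A(1,2), of f] that A(1) by auto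
  \<comment> \<open>Pulling back along \<open>v\<close> multiplies \<open>L\<^sub>1\<close> norms by the measure of \<open>B\<close>.\<close>
  define pull where "pull h = cutoff B (\<lambda>x. h (v x))" for h :: "real \<Rightarrow> 'k"
  have pull_int: "integrable N (pull h)" and pull_norm: "L1norm N (pull h) = measure N B * L1norm unit_uniform h"
    if h: "integrable unit_uniform h" for h
  proof -
    have hm: "h \<in> borel_measurable borel" using borel_measurable_integrable[OF h] by simp
    have hv: "(\<lambda>x. h (v x)) \<in> borel_measurable N" using v(1) hm by (rule measurable_compose)
    have "integrable R (\<lambda>x. h (v x))" using h integrable_distr_eq[OF vR hm] by (simp add: dR)
    then show "integrable N (pull h)"
      unfolding pull_def R_def using N.uniform_measure_integrals(1)[OF B(1,2) hv] by simp
    have "L1norm unit_uniform h = L1norm R (\<lambda>x. h (v x))"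
      unfolding L1norm_def dR[symmetric] using vR hm by (intro integral_distr) auto
    then show "L1norm N (pull h) = measure N B * L1norm unit_uniform h"
      unfolding pull_def R_def using N.uniform_measure_integrals(2)[OF B(1,2) hv] by simp
  qed
  \<comment> \<open>Relations that hold almost everywhere for the law of \<open>v\<close> are inherited on \<open>B\<close>; outside \<open>B\<close> all
    pullbacks vanish, hence the condition at \<open>0\<close>.\<close>
  have pull_AE: "AE x in N. Q (pull h x) (pull g x) (pull k x)"
    if "AE y in unit_uniform. Q (h y) (g y) (k y)" "Q 0 0 0" for h g k :: "real \<Rightarrow> 'k" and Q
  proof -
    have "AE x in R. Q (h (v x)) (g (v x)) (k (v x))"
      using that(1) unfolding dR[symmetric] by (rule AE_distrD[OF vR])
    then have "AE x in N. x \<in> B \<longrightarrow> Q (h (v x)) (g (v x)) (k (v x))"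
      unfolding R_def AE_uniform_measure[OF pos(3,4)] .
    then show ?thesis by eventually_elim (use that(2) in \<open>auto simp: pull_def cutoff_def indicator_def\<close>)
  qed
  define H where "H f = (SOME h. pushforward_density P u f h)" for f :: "'a \<Rightarrow> 'k"
  have H: "pushforward_density P u f (H f)" if "integrable M f" for f
    unfolding H_def using P.pushforward_density_exists[OF uP intP[OF that]] by (rule someI_ex)
  have Hi: "integrable unit_uniform (H f)" if "integrable M f" for f
    using pushforward_density_integrable[OF H[OF that]] by (simp add: dP)
  have unique: "AE y in unit_uniform. H f y = h y"
    if "integrable M f" "integrable M g" "pushforward_density P u g h" "AE x in P. f x = g x" for f g h
    unfolding dP[symmetric]
    by (rule pushforward_density_unique[OF H[OF that(1)] that(3) finP uP intP[OF that(1)] intP[OF that(2)] that(4)])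
  define t where "t f = pull (H f)" for f
  \<comment> \<open>The factors come from pulling back along \<open>v\<close>, from the passage to coordinates and from the
    normalisation of the measure on \<open>A\<close>.\<close>
  define C where "C = measure N B * (2 * DIM('k) * (1 / measure M A))"
  have "L1_operator M N t C"
  proof unfold_locales
    fix f g :: "'a \<Rightarrow> 'k" and c :: 'k assume f: "integrable M f"
    show "integrable N (t f)" unfolding t_def using Hi[OF f] by (rule pull_int)
    have cf: "integrable M (\<lambda>x. c * f x)" using f by auto
    have "pushforward_density P u (\<lambda>x. c * f x) (\<lambda>y. c * H f y)"
      using H[OF f] bounded_linear_mult_right uP intP[OF f] by (rule pushforward_density_linear)
    from unique[OF cf cf this] have "AE y in unit_uniform. H (\<lambda>x. c * f x) y = c * H f y" by simp
    from pull_AE[of "\<lambda>a b d. a = c * b" "H (\<lambda>x. c * f x)" "H f" "H f", OF this]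
    show "AE x in N. t (\<lambda>x. c * f x) x = c * t f x" by (simp add: t_def)
    have "L1norm unit_uniform (H f) \<le> 2 * DIM('k) * L1norm P f"
    proof (rule L1norm_le_of_set_integrals[OF Hi[OF f]])
      fix D assume "D \<in> sets unit_uniform"
      then have D: "D \<in> sets borel" by simp
      have "norm (\<integral>y. indicator D y *\<^sub>R H f y \<partial>unit_uniform) = norm (\<integral>x. indicator D (u x) *\<^sub>R f x \<partial>P)"
        using pushforward_density_eq[OF H[OF f] D] by (simp add: dP)
      also have "\<dots> \<le> L1norm P (\<lambda>x. indicator D (u x) *\<^sub>R f x)" by (rule norm_integral_le_L1norm)
      also have "\<dots> \<le> L1norm P f"
        unfolding L1norm_def
        by (intro integral_mono integrable_norm integrable_indicator_comp[OF uP intP[OF f] D] intP[OF f])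
          (auto simp: indicator_def)
      finally show "norm (\<integral>y. indicator D y *\<^sub>R H f y \<partial>unit_uniform) \<le> L1norm P f" .
    qed
    also have "L1norm P f \<le> 1 / measure M A * L1norm M f"
      using M.uniform_measure_integrals(2)[OF A(1,2), of f] L1norm_cutoff_le[OF f A(1)] f A(2)
      by (simp add: P_def field_simps)
    finally have "L1norm unit_uniform (H f) \<le> 2 * DIM('k) * (1 / measure M A * L1norm M f)"
      by (simp add: mult_left_mono)
    then have "measure N B * L1norm unit_uniform (H f) \<le>
        measure N B * (2 * DIM('k) * (1 / measure M A * L1norm M f))"
      by (intro mult_left_mono) auto
    then show "L1norm N (t f) \<le> C * L1norm M f"
      unfolding t_def pull_norm[OF Hi[OF f]] C_def by (simp add: mult.assoc)
    assume g: "integrable M g"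
    have fg: "integrable M (\<lambda>x. f x + g x)" using f g by auto
    have "pushforward_density P u (\<lambda>x. f x + g x) (\<lambda>y. H f y + H g y)"
      using H[OF f] H[OF g] uP intP[OF f] intP[OF g] by (rule pushforward_density_add)
    from unique[OF fg fg this] have "AE y in unit_uniform. H (\<lambda>x. f x + g x) y = H f y + H g y" by simp
    from pull_AE[of "\<lambda>a b d. a = b + d" "H (\<lambda>x. f x + g x)" "H f" "H g", OF this]
    show "AE x in N. t (\<lambda>x. f x + g x) x = t f x + t g x" by (simp add: t_def)
  qed (auto simp: C_def)
  then interpret t: L1_operator M N t C .
  have "0 < fun_op_norm M N t"
  proof -
    define one where "one = (\<lambda>x::'a. 1 :: 'k)"
    have one: "integrable M one" by (simp add: one_def)
    have "(\<integral>y. indicator UNIV y *\<^sub>R H one y \<partial>unit_uniform) = (\<integral>x. indicator UNIV (u x) *\<^sub>R one x \<partial>P)"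
      using pushforward_density_eq[OF H[OF one], of UNIV] by (simp add: dP)
    then have "(\<integral>y. H one y \<partial>unit_uniform) = 1" by (simp add: one_def P.prob_space)
    then have "1 \<le> L1norm unit_uniform (H one)"
      using norm_integral_le_L1norm[where f="H one" and M=unit_uniform] by simp
    then have "0 < L1norm N (t one)"
      unfolding t_def pull_norm[OF Hi[OF one]] using B(2) by (intro mult_pos_pos) auto
    also have "\<dots> \<le> fun_op_norm M N t * L1norm M one" using one by (rule t.bound_fun_op_norm)
    finally show ?thesis using t.fun_op_norm_nonneg by (cases "fun_op_norm M N t = 0") auto
  qed
  moreover have "\<exists>F\<in>sets M. \<exists>G\<in>sets N. (AE x in N. t (cutoff F f) x = cutoff G (t f) x) \<and>
      L1norm N (cutoff G (t f)) = L1norm N (t f) / 2" if f: "integrable M f" for f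
  proof -
    obtain c where c: "(\<integral>y. indicator {..c} y *\<^sub>R norm (H f y) \<partial>unit_uniform) = L1norm unit_uniform (H f) / 2"
      using halving_half_line[OF sets_unit_uniform unit_uniform_singleton Hi[OF f]] by blast
    define F where "F = u -` {..c} \<inter> space M"
    define G where "G = v -` {..c} \<inter> space N"
    have F: "F \<in> sets M" and G: "G \<in> sets N"
      unfolding F_def G_def using u(1) v(1) by (auto intro: measurable_sets)
    define h where "h y = indicator {..c} y *\<^sub>R H f y" for y
    have hi: "integrable unit_uniform h"
      unfolding h_def using Hi[OF f] by (intro integrable_mult_indicator) auto
    have fF: "integrable M (cutoff F f)" using f F by auto
    have fu: "integrable M (\<lambda>x. indicator {..c} (u x) *\<^sub>R f x)"
      using u(1) f by (rule integrable_indicator_comp) simp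
    have "pushforward_density P u (\<lambda>x. indicator {..c} (u x) *\<^sub>R f x) h"
      unfolding h_def using H[OF f] uP intP[OF f] by (rule pushforward_density_indicator) simp
    moreover have "AE x in P. cutoff F f x = indicator {..c} (u x) *\<^sub>R f x"
      using AE_space by eventually_elim (auto simp: cutoff_def F_def P_def indicator_def)
    ultimately have "AE y in unit_uniform. H (cutoff F f) y = h y" using unique[OF fF fu] by blast
    from pull_AE[of "\<lambda>a b d. a = b" "H (cutoff F f)" h h, OF this]
    have ae: "AE x in N. t (cutoff F f) x = pull h x" by (simp add: t_def)
    have cutoff_pull: "AE x in N. pull h x = cutoff G (t f) x"
      using AE_space by eventually_elim (auto simp: pull_def h_def cutoff_def G_def t_def indicator_def)
    have "L1norm N (cutoff G (t f)) = L1norm N (pull h)"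
      using cutoff_pull pull_int[OF hi] G f by (intro L1norm_cong_AE) auto
    also have "\<dots> = measure N B * L1norm unit_uniform h" using hi by (rule pull_norm)
    also have "L1norm unit_uniform h = (\<integral>y. indicator {..c} y *\<^sub>R norm (H f y) \<partial>unit_uniform)"
      by (simp add: L1norm_def h_def)
    also have "\<dots> = L1norm unit_uniform (H f) / 2" by (rule c)
    also have "measure N B * (L1norm unit_uniform (H f) / 2) = L1norm N (t f) / 2"
      unfolding t_def pull_norm[OF Hi[OF f]] by simp
    finally have "L1norm N (cutoff G (t f)) = L1norm N (t f) / 2" .
    moreover have "AE x in N. t (cutoff F f) x = cutoff G (t f) x"
      using ae cutoff_pull by eventually_elim simp
    ultimately show ?thesis using F G by blast
  qed
  ultimately show ?thesis using t.L1_operator_axioms by blast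
qed

section \<open>Range exposing operators are far from halving operators\<close>

text \<open>The images of a norming sequence converge to a multiple of \<open>t x0\<close> of the same norm.\<close>

lemma (in L1_operator) range_exposed_attains_norm:
  assumes x0: "integrable M x0" and exposed: "range_exposed_at M N t x0"
  shows "L1norm N (t x0) = fun_op_norm M N t"
proof -
  define n where "n = fun_op_norm M N t"
  have "\<exists>f. integrable M f \<and> L1norm M f \<le> 1 \<and> n - 1 / Suc i < L1norm N (t f)" for i
  proof -
    have "n - 1 / Suc i < fun_op_norm M N t" by (simp add: n_def)
    from less_fun_op_normE[OF this] show ?thesis by metis
  qed
  then obtain x where x: "\<And>i. integrable M (x i)" "\<And>i. L1norm M (x i) \<le> 1"
      "\<And>i. n - 1 / Suc i < L1norm N (t (x i))" by metis
  have le: "L1norm N (t (x i)) \<le> n" for i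
  proof -
    have "L1norm N (t (x i)) \<le> n * L1norm M (x i)" unfolding n_def using x(1) by (rule bound_fun_op_norm)
    also have "\<dots> \<le> n * 1" using x(2) fun_op_norm_nonneg unfolding n_def by (rule mult_left_mono)
    finally show ?thesis by simp
  qed
  have "(\<lambda>i. n - 1 / Suc i) \<longlonglongrightarrow> n - 0"
    using LIMSEQ_inverse_real_of_nat by (intro tendsto_intros) (simp add: inverse_eq_divide)
  then have lim0: "(\<lambda>i. n - 1 / Suc i) \<longlonglongrightarrow> n" by simp
  have lim: "(\<lambda>i. L1norm N (t (x i))) \<longlonglongrightarrow> n"
    by (rule tendsto_sandwich[OF _ _ lim0 tendsto_const]; intro always_eventually allI less_imp_le x(3) le)
  from exposed[unfolded range_exposed_at_def, rule_format, of x] x lim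
  obtain \<sigma> \<theta> where \<sigma>: "strict_mono \<sigma>" and \<theta>: "norm \<theta> = 1"
    and conv: "(\<lambda>i. L1norm N (\<lambda>z. t (x (\<sigma> i)) z - \<theta> * t x0 z)) \<longlonglongrightarrow> 0"
    unfolding n_def by auto
  have "norm (L1norm N (t (x (\<sigma> i))) - L1norm N (t x0)) \<le>
      L1norm N (\<lambda>z. t (x (\<sigma> i)) z - \<theta> * t x0 z)" for i
  proof -
    have "L1norm N (\<lambda>z. \<theta> * t x0 z) = L1norm N (t x0)" using \<theta> by (simp add: L1norm_scale)
    then show ?thesis
      using L1norm_le_diff[of N "t (x (\<sigma> i))" "\<lambda>z. \<theta> * t x0 z"]
        L1norm_le_diff[of N "\<lambda>z. \<theta> * t x0 z" "t (x (\<sigma> i))"]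
        L1norm_diff_commute[of N "t (x (\<sigma> i))" "\<lambda>z. \<theta> * t x0 z"] x(1) x0 by auto
  qed
  then have "(\<lambda>i. L1norm N (t (x (\<sigma> i))) - L1norm N (t x0)) \<longlonglongrightarrow> 0"
    using conv by - (rule Lim_null_comparison, auto)
  then have "(\<lambda>i. L1norm N (t (x (\<sigma> i)))) \<longlonglongrightarrow> L1norm N (t x0)" by (rule LIM_zero_cancel)
  moreover have "(\<lambda>i. L1norm N (t (x (\<sigma> i)))) \<longlonglongrightarrow> n"
    using LIMSEQ_subseq_LIMSEQ[OF lim \<sigma>] by (simp add: o_def)
  ultimately show ?thesis unfolding n_def by (rule LIMSEQ_unique)
qed

text \<open>As \<open>t\<close> attains its norm at \<open>x0\<close>, it also does so at the normalised part of \<open>x0\<close> on \<open>F\<close>: the triangle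
  inequality for \<open>t x0\<close>, split along \<open>F\<close> and its complement, must be an equality. The constant
  sequence at that part is thus norming, and its limit condition is an equation.\<close>

lemma (in L1_operator) range_exposed_cutoff:
  assumes x0: "integrable M x0" "L1norm M x0 = 1" and exposed: "range_exposed_at M N t x0"
    and F: "F \<in> sets M"
  shows "\<exists>\<theta>. norm \<theta> = 1 \<and>
    (AE x in N. t (cutoff F x0) x = of_real (L1norm M (cutoff F x0)) * \<theta> * t x0 x)"
proof -
  define n where "n = fun_op_norm M N t"
  define a where "a = L1norm M (cutoff F x0)"
  note xF = integrable_cutoff[OF x0(1) F]
  have xFc: "integrable M (cutoff (space M - F) x0)" using x0 F by auto
  show ?thesis
  proof (cases "a = 0")
    case True
    have "L1norm N (t (cutoff F x0)) \<le> 0" using t_bound[OF xF] True by (simp add: a_def)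
    then have "AE x in N. t (cutoff F x0) x = 0" using xF by (intro L1norm_eq_0) auto
    then show ?thesis using True by (intro exI[of _ 1]) (simp add: a_def)
  next
    case False
    then have a: "0 < a" using L1norm_nonneg[of M "cutoff F x0"] unfolding a_def by linarith
    define z where "z x = of_real (1 / a) * cutoff F x0 x" for x
    have z: "integrable M z" unfolding z_def using xF by auto
    have z1: "L1norm M z = 1" unfolding z_def L1norm_scale norm_of_real using a by (simp add: a_def)
    have tz: "AE x in N. t z x = of_real (1 / a) * t (cutoff F x0) x"
      unfolding z_def using xF by (rule t_scale)
    have "n \<le> L1norm N (t (cutoff F x0)) + L1norm N (t (cutoff (space M - F) x0))"
    proof -
      have "n = L1norm N (t x0)" unfolding n_def using range_exposed_attains_norm[OF x0(1) exposed] by simp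
      also have "\<dots> = L1norm N (\<lambda>x. t (cutoff F x0) x + t (cutoff (space M - F) x0) x)"
        using t_cutoff_compl[OF x0(1) F] x0 xF xFc by (intro L1norm_cong_AE) auto
      also have "\<dots> \<le> L1norm N (t (cutoff F x0)) + L1norm N (t (cutoff (space M - F) x0))"
        using xF xFc by (intro L1norm_add) auto
      finally show ?thesis .
    qed
    also have "L1norm N (t (cutoff (space M - F) x0)) \<le> n * (1 - a)"
    proof -
      have "L1norm M (cutoff (space M - F) x0) = 1 - a"
        using L1norm_cutoff_compl[OF x0(1) F] x0(2) unfolding a_def by linarith
      then show ?thesis using bound_fun_op_norm[OF xFc] by (simp add: n_def)
    qed
    finally have "n * a \<le> L1norm N (t (cutoff F x0))" by (simp add: algebra_simps)
    moreover have "L1norm N (t (cutoff F x0)) \<le> n * a"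
      unfolding n_def a_def using xF by (rule bound_fun_op_norm)
    ultimately have na: "L1norm N (t (cutoff F x0)) = n * a" by simp
    have "L1norm N (t z) = L1norm N (\<lambda>x. of_real (1 / a) * t (cutoff F x0) x)"
      using tz z xF by (intro L1norm_cong_AE) auto
    also have "\<dots> = n" unfolding L1norm_scale norm_of_real na using a by simp
    finally have "(\<lambda>i::nat. L1norm N (t z)) \<longlonglongrightarrow> fun_op_norm M N t" by (simp add: n_def)
    then obtain \<sigma> :: "nat \<Rightarrow> nat" and \<theta> where \<theta>: "norm \<theta> = 1"
      and conv: "(\<lambda>i. L1norm N (\<lambda>x. t z x - \<theta> * t x0 x)) \<longlonglongrightarrow> 0"
      using exposed[unfolded range_exposed_at_def, rule_format, of "\<lambda>_. z"] z z1 by auto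
    have "L1norm N (\<lambda>x. t z x - \<theta> * t x0 x) = 0"
      using conv by (simp add: LIMSEQ_const_iff)
    then have "AE x in N. t z x - \<theta> * t x0 x = 0" using z x0 by (intro L1norm_eq_0) auto
    then have "AE x in N. t (cutoff F x0) x = of_real a * \<theta> * t x0 x"
      using tz by eventually_elim (use a in \<open>simp add: field_simps\<close>)
    then show ?thesis using \<theta> unfolding a_def by blast
  qed
qed

text \<open>Near \<open>t\<close>, the operator \<open>s\<close> would map the part of \<open>x0\<close> on \<open>F\<close> to a multiple of \<open>s x0\<close>, whereas \<open>t\<close> maps
  it to half of \<open>t x0\<close>, cut to \<open>G\<close>. A multiple \<open>c\<close> of \<open>y = t x0\<close> with \<open>norm c = a\<close> differs from
  \<open>y\<close> cut to \<open>G\<close> by \<open>norm (1 - c) \<ge> 1 - a\<close> times half of the norm on \<open>G\<close> and by \<open>a\<close> times half of it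
  outside, in total by at least half of the norm of \<open>y\<close>.\<close>

lemma (in L1_operator) halving_far_from_range_exposed:
  assumes halving: "\<And>f. integrable M f \<Longrightarrow> \<exists>F\<in>sets M. \<exists>G\<in>sets N.
      (AE x in N. t (cutoff F f) x = cutoff G (t f) x) \<and> L1norm N (cutoff G (t f)) = L1norm N (t f) / 2"
    and s: "L1_operator M N s D"
    and x0: "integrable M x0" "L1norm M x0 = 1" and exposed: "range_exposed_at M N s x0"
    and near: "\<And>f. integrable M f \<Longrightarrow> L1norm N (\<lambda>x. s f x - t f x) \<le> \<delta> * L1norm M f" and "0 \<le> \<delta>"
  shows "fun_op_norm M N t \<le> 6 * \<delta>"
proof -
  interpret s: L1_operator M N s D by fact
  obtain F G where F: "F \<in> sets M" and G: "G \<in> sets N"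
    and cut: "AE x in N. t (cutoff F x0) x = cutoff G (t x0) x"
    and half: "L1norm N (cutoff G (t x0)) = L1norm N (t x0) / 2"
    using halving[OF x0(1)] by blast
  define a where "a = L1norm M (cutoff F x0)"
  define y where "y = t x0"
  have y: "integrable N y" using x0 by (simp add: y_def)
  have a: "0 \<le> a" "a \<le> 1" using L1norm_cutoff_le[OF x0(1) F] x0(2) by (auto simp: a_def)
  obtain \<theta> where \<theta>: "norm \<theta> = 1" and sF: "AE x in N. s (cutoff F x0) x = of_real a * \<theta> * s x0 x"
    using s.range_exposed_cutoff[OF x0 exposed F] unfolding a_def by blast
  define c where "c = of_real a * \<theta>"
  have c: "norm c = a" using a \<theta> by (simp add: c_def norm_mult)
  note xF = integrable_cutoff[OF x0(1) F]
  have "L1norm N (\<lambda>x. cutoff G y x - c * y x) \<le> \<delta> * a + a * \<delta>"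
  proof -
    have "AE x in N. cutoff G y x - c * y x =
        - (s (cutoff F x0) x - t (cutoff F x0) x) + c * (s x0 x - t x0 x)"
      using cut sF by eventually_elim (simp add: y_def c_def algebra_simps)
    then have "L1norm N (\<lambda>x. cutoff G y x - c * y x) =
        L1norm N (\<lambda>x. - (s (cutoff F x0) x - t (cutoff F x0) x) + c * (s x0 x - t x0 x))"
      using y G xF x0 by (intro L1norm_cong_AE) auto
    also have "\<dots> \<le> L1norm N (\<lambda>x. - (s (cutoff F x0) x - t (cutoff F x0) x)) +
        L1norm N (\<lambda>x. c * (s x0 x - t x0 x))"
      using xF x0 by (intro L1norm_add) auto
    also have "\<dots> = L1norm N (\<lambda>x. s (cutoff F x0) x - t (cutoff F x0) x) +
        a * L1norm N (\<lambda>x. s x0 x - t x0 x)"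
      by (simp only: L1norm_minus L1norm_scale c)
    also have "\<dots> \<le> \<delta> * a + a * \<delta>"
      using near[OF xF] near[OF x0(1)] x0(2) a unfolding a_def by (intro add_mono mult_left_mono) auto
    finally show ?thesis .
  qed
  moreover have "L1norm N (\<lambda>x. cutoff G y x - c * y x) = (norm (1 - c) + a) * (L1norm N y / 2)"
  proof -
    define g where "g x = cutoff G y x - c * y x" for x
    have g: "integrable N g" unfolding g_def using y G by auto
    have Gc: "space N - G \<in> sets N" using G by auto
    have "cutoff G g = (\<lambda>x. (1 - c) * cutoff G y x)"
      by (auto simp: g_def cutoff_def indicator_def algebra_simps fun_eq_iff)
    then have 1: "L1norm N (cutoff G g) = norm (1 - c) * (L1norm N y / 2)"
      using half by (simp add: L1norm_scale y_def)
    have "cutoff (space N - G) g = (\<lambda>x. (- c) * cutoff (space N - G) y x)"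
      by (auto simp: g_def cutoff_def indicator_def fun_eq_iff)
    moreover have "L1norm N (cutoff (space N - G) y) = L1norm N y / 2"
      using L1norm_cutoff_compl[OF y G] half by (simp add: y_def)
    ultimately have 2: "L1norm N (cutoff (space N - G) g) = a * (L1norm N y / 2)"
      using c by (simp only: L1norm_scale norm_minus_cancel)
    show ?thesis using L1norm_cutoff_compl[OF g G] 1 2 unfolding g_def by (simp add: algebra_simps)
  qed
  moreover have "1 * (L1norm N y / 2) \<le> (norm (1 - c) + a) * (L1norm N y / 2)"
    using norm_triangle_ineq2[of 1 c] c by (intro mult_right_mono) auto
  moreover have "\<delta> * a \<le> \<delta> * 1" using a \<open>0 \<le> \<delta>\<close> by (intro mult_left_mono)
  ultimately have y_small: "L1norm N y \<le> 4 * \<delta>" by (simp add: mult.commute)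
  have "fun_op_norm M N s = L1norm N (s x0)"
    using s.range_exposed_attains_norm[OF x0(1) exposed] by simp
  also have "\<dots> \<le> L1norm N y + L1norm N (\<lambda>x. s x0 x - t x0 x)"
    unfolding y_def using x0 by (intro L1norm_le_diff) auto
  also have "\<dots> \<le> 4 * \<delta> + \<delta>" using y_small near[OF x0(1)] x0(2) by simp
  finally have s5: "fun_op_norm M N s \<le> 5 * \<delta>" by simp
  show ?thesis
  proof (rule fun_op_norm_le)
    fix f :: "'a \<Rightarrow> 'k" assume f: "integrable M f"
    have "L1norm N (t f) \<le> L1norm N (s f) + L1norm N (\<lambda>x. t f x - s f x)"
      using f by (intro L1norm_le_diff) auto
    also have "L1norm N (\<lambda>x. t f x - s f x) \<le> \<delta> * L1norm M f"
      using near[OF f] by (subst L1norm_diff_commute)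
    also have "L1norm N (s f) \<le> fun_op_norm M N s * L1norm M f" using f by (rule s.bound_fun_op_norm)
    also have "\<dots> \<le> 5 * \<delta> * L1norm M f" using s5 by (rule mult_right_mono) simp
    finally show "L1norm N (t f) \<le> 6 * \<delta> * L1norm M f" by simp
  qed (use \<open>0 \<le> \<delta>\<close> in simp)
qed

theorem purely_atomic_if_RSE_dense:
  fixes M :: "'a measure" and N :: "'b measure"
  assumes fin: "finite_measure M" "finite_measure N"
    and dense: "dense_ops (L1 TYPE('k::{real_normed_field, euclidean_space}) M) (L1 TYPE('k) N)
      (RSE (L1 TYPE('k) M) (L1 TYPE('k) N))"
  shows "purely_atomic M \<or> purely_atomic N"
proof (rule ccontr)
  assume "\<not> (purely_atomic M \<or> purely_atomic N)"
  then have "\<not> purely_atomic M" "\<not> purely_atomic N" by auto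
  from exists_halving_operator[OF fin this, where 'k='k]
  obtain t :: "('a \<Rightarrow> 'k) \<Rightarrow> 'b \<Rightarrow> 'k" and C where t: "L1_operator M N t C" and pos: "0 < fun_op_norm M N t"
    and halving: "\<forall>f. integrable M f \<longrightarrow> (\<exists>F\<in>sets M. \<exists>G\<in>sets N.
      (AE x in N. t (cutoff F f) x = cutoff G (t f) x) \<and>
      L1norm N (cutoff G (t f)) = L1norm N (t f) / 2)"
    by (elim exE conjE)
  interpret t: L1_operator M N t C by fact
  obtain T where T: "T \<in> bounded_ops (L1 TYPE('k) M) (L1 TYPE('k) N)" and rt: "represents M N T t"
    using t.lift_op by blast
  \<comment> \<open>Any divisor greater than \<open>6\<close> contradicts the lower bound on the distance.\<close>
  define \<delta> where "\<delta> = fun_op_norm M N t / 7"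
  have "0 < \<delta>" using pos by (simp add: \<delta>_def)
  then obtain S where S: "S \<in> RSE (L1 TYPE('k) M) (L1 TYPE('k) N)"
    and ST: "op_norm (L1 TYPE('k) M) (L1 TYPE('k) N) (op_diff (L1 TYPE('k) M) (L1 TYPE('k) N) S T) < \<delta>"
    using dense T unfolding dense_ops_def by blast
  have Sb: "S \<in> bounded_ops (L1 TYPE('k) M) (L1 TYPE('k) N)" using S by (simp add: RSE_def)
  obtain s D where s: "L1_operator M N s D" and rs: "represents M N S s"
    using bounded_op_represented[OF fin Sb] by blast
  interpret s: L1_operator M N s D by fact
  obtain x0 where x0: "integrable M x0" "L1norm M x0 = 1" "range_exposed_at M N s x0"
    using s.RSE_iff_range_exposed[OF Sb rs] S by blast
  note diff = t.op_diff_represented[OF s rs rt]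
  interpret d: L1_operator M N "\<lambda>f x. s f x - t f x" "D + C" by (fact diff(1))
  have "L1norm N (\<lambda>x. s f x - t f x) \<le> \<delta> * L1norm M f" if f: "integrable M f" for f
  proof -
    have "L1norm N (\<lambda>x. s f x - t f x) \<le> fun_op_norm M N (\<lambda>f x. s f x - t f x) * L1norm M f"
      using f by (rule d.bound_fun_op_norm)
    also have "\<dots> \<le> \<delta> * L1norm M f"
      using ST unfolding d.op_norm_represented[OF diff(2)] by (intro mult_right_mono) auto
    finally show ?thesis .
  qed
  then have "fun_op_norm M N t \<le> 6 * \<delta>"
    using halving s x0 \<open>0 < \<delta>\<close> by (intro t.halving_far_from_range_exposed[of s D x0 \<delta>]) auto
  then show False using pos by (simp add: \<delta>_def)
qed

section \<open>The characterisation\<close>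

theorem RSE_dense_iff_purely_atomic:
  fixes M :: "'a measure" and N :: "'b measure"
  assumes "finite_measure M" "finite_measure N"
    and "nonzero_space (L1 TYPE('k::{real_normed_field, euclidean_space}) M)" "nonzero_space (L1 TYPE('k) N)"
  shows "dense_ops (L1 TYPE('k) M) (L1 TYPE('k) N) (RSE (L1 TYPE('k) M) (L1 TYPE('k) N)) \<longleftrightarrow>
    purely_atomic M \<or> purely_atomic N"
  using RSE_dense_if_purely_atomic[OF assms] purely_atomic_if_RSE_dense[OF assms(1,2)] by blast

theorem corollary3p14:
  fixes \<mu> :: "'a measure" and \<nu> :: "'b measure"
  assumes "finite_measure \<mu>" and "finite_measure \<nu>"
  shows
    "(nonzero_space (L1 TYPE(real) \<mu>) \<and> nonzero_space (L1 TYPE(real) \<nu>) \<longrightarrow>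
       (dense_ops (L1 TYPE(real) \<mu>) (L1 TYPE(real) \<nu>)
          (RSE (L1 TYPE(real) \<mu>) (L1 TYPE(real) \<nu>))
        \<longleftrightarrow> purely_atomic \<mu> \<or> purely_atomic \<nu>)) \<and>
     (nonzero_space (L1 TYPE(complex) \<mu>) \<and> nonzero_space (L1 TYPE(complex) \<nu>) \<longrightarrow>
       (dense_ops (L1 TYPE(complex) \<mu>) (L1 TYPE(complex) \<nu>)
          (RSE (L1 TYPE(complex) \<mu>) (L1 TYPE(complex) \<nu>))
        \<longleftrightarrow> purely_atomic \<mu> \<or> purely_atomic \<nu>))"
  using RSE_dense_iff_purely_atomic[OF assms, where 'k=real]
    RSE_dense_iff_purely_atomic[OF assms, where 'k=complex] by blast

end
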